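(* Let $n$ be a positive integer, let $i,m$ be nonnegative integers, let $k$ be an integer, let $0<\alpha\le 1$, let $Y$ be a Banach space, let $1\le p\le\infty$, let $T\in\mathscr D'(\mathbf R^n,Y)$, and let $a\in\mathbf R^n$. Then: (1) If $k\ge 0$ and for every $\xi\in\Xi(n,m)$ the distribution $D^\xi T$ is $\nu_{i,p}$ pointwise differentiable of order $k$ at $a$, then for every $l=0,1,\dots,m-1$ and every $\beta\in\Xi(n,l)$ the distribution $D^\beta T$ is $\nu_{i,p}$ pointwise differentiable of order $k-l+m$ at $a$. (2) If $k+\alpha\ge 0$ and for every $\xi\in\Xi(n,m)$ the distribution $D^\xi T$ is $\nu_{i,p}$ pointwise differentiable of order $(k,\alpha)$ at $a$, then for every $l=0,1,\dots,m-1$ and every $\beta\in\Xi(n,l)$ the distribution $D^\beta T$ is $\nu_{i,p}$ pointwise differentiable of order $k-l+m$ at $a$.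
   Context: All vector spaces are real. $Y'$ is the topological dual of the Banach space $Y$. $\mathscr D(\mathbf R^n,Y)$ is the space of smooth compactly supported functions $\mathbf R^n\to Y$; for compact $K$, $\mathscr D_K(\mathbf R^n,Y)$ is the subspace of those with support in $K$, topologized by the seminorms $\sup_{x\in K}\|D^j\theta(x)\|$, $j=0,1,2,\dots$. $\mathscr D'(\mathbf R^n,Y)$ is the set of distributions of $Y$ in $\mathbf R^n$, i.e. linear maps $T:\mathscr D(\mathbf R^n,Y)\to\mathbf R$ whose restriction to each $\mathscr D_K(\mathbf R^n,Y)$ is continuous. $\mathbf B(a,r)$ is the closed ball. $\mathscr L^n$ is Lebesgue measure. A polynomial function $P:\mathbf R^n\to Y'$ is a finite sum of maps $x\mapsto\psi_m(x,\dots,x)$ with $\psi_m$ symmetric $m$-linear with values in $Y'$; a polynomial function of degree at most $-1$ is by convention the zero function. Such $P$ is identified with the distribution $P(\theta)=\int\langle\theta(x),P(x)\rangle\,d\mathscr L^n_x$. For $T\in\mathscr D'(\mathbf R^n,Y)$, $a\in\mathbf R^n$, $0<r<\infty$, define $T^{a,r}(\theta)=r^{-n}T_x(\theta(r^{-1}(x-a)))$, where $T_x(\cdot)$ means $T$ applied to the indicated function of $x$. For $1\le p<\infty$, $\nu_{i,p}(\theta)=\left(\int\|D^i\theta\|^p\,d\mathscr L^n\right)^{1/p}$, and $\nu_{i,\infty}(\theta)=\sup_x\|D^i\theta(x)\|$, for $\theta\in\mathscr D_{\mathbf B(0,1)}(\mathbf R^n,Y)$, where $\|\cdot\|$ is the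 norm of multilinear maps. Let $\nu$ be a seminorm on $\mathscr D_{\mathbf B(0,1)}(\mathbf R^n,Y)$, $k$ an integer, $0<\alpha\le1$. For $k+\alpha\ge0$, $T$ is $\nu$ pointwise differentiable of order $(k,\alpha)$ at $a$ iff there is a polynomial function $P:\mathbf R^n\to Y'$ of degree at most $k$ with $$\limsup_{r\to0^+}\sup\{r^{-k-\alpha}(T-P)^{a,r}(\theta):\theta\in\mathscr D_{\mathbf B(0,1)}(\mathbf R^n,Y),\ \nu(\theta)\le1\}<\infty.$$ For $k\ge 0$, $T$ is $\nu$ pointwise differentiable of order $k$ at $a$ iff there is a polynomial function $P:\mathbf R^n\to Y'$ of degree at most $k$ with $$\lim_{r\to0^+}\sup\{r^{-k}(T-P)^{a,r}(\theta):\theta\in\mathscr D_{\mathbf B(0,1)}(\mathbf R^n,Y),\ \nu(\theta)\le1\}=0.$$ $\Xi(n,m)$ is the set of multi-indices $\xi:\{1,\dots,n\}\to\{0,1,2,\dots\}$ with $\xi_1+\dots+\xi_n=m$; $(D^\xi T)(\theta)=(-1)^{|\xi|}T(D^\xi\theta)$ is the distributional partial derivative. *)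

theory Defs
  imports "HOL-Analysis.Analysis"
begin

text \<open>
  The space \<open>R\<^sup>n\<close> is \<^typ>\<open>real ^ 'n\<close> with \<open>n = CARD('n)\<close>, which is positive; the Banach space \<open>Y\<close> is a
  type \<open>'y\<close> of class \<^class>\<open>banach\<close>, and its topological dual is \<^typ>\<open>'y \<Rightarrow>\<^sub>L real\<close>.
  An \<open>m\<close>-linear map on a space is represented by a function on lists of vectors of which only
  the values on lists of length \<open>m\<close> matter.
\<close>

section \<open>Higher derivatives and test functions\<close>

text \<open>
  \<open>Dmult f [v\<^sub>1, \<dots>, v\<^sub>j] x\<close> is the value of the \<open>j\<close>-th derivative of \<open>f\<close> at \<open>x\<close> on \<open>v\<^sub>1, \<dots>, v\<^sub>j\<close>.
\<close>

primrec Dmult :: "('a::real_normed_vector \<Rightarrow> 'b::real_normed_vector) \<Rightarrow> 'a list \<Rightarrow> 'a \<Rightarrow> 'b" where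
  "Dmult f [] = f"
| "Dmult f (v # vs) = (\<lambda>x. frechet_derivative (Dmult f vs) (at x) v)"

text \<open>
  On a finite dimensional domain, a map into the space of multilinear maps is differentiable iff all
  its evaluations at fixed vectors are; hence the following says that the derivatives of
  all orders exist (and so are continuous).
\<close>

definition smooth :: "(real ^ 'n \<Rightarrow> 'y::real_normed_vector) \<Rightarrow> bool" where
  "smooth f \<longleftrightarrow> (\<forall>vs x. Dmult f vs differentiable (at x))"

definition norm_D :: "nat \<Rightarrow> (real ^ 'n \<Rightarrow> 'y::real_normed_vector) \<Rightarrow> real ^ 'n \<Rightarrow> real" where
  "norm_D j f x = (SUP vs \<in> {vs. length vs = j \<and> (\<forall>v\<in>set vs. norm v \<le> 1)}. norm (Dmult f vs x))"

definition supp :: "('a::topological_space \<Rightarrow> 'b::zero) \<Rightarrow> 'a set" where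
  "supp f = closure {x. f x \<noteq> 0}"

definition test_functions :: "(real ^ 'n \<Rightarrow> 'y::real_normed_vector) set" where
  "test_functions = {\<theta>. smooth \<theta> \<and> compact (supp \<theta>)}"

definition test_functions_in :: "(real ^ 'n) set \<Rightarrow> (real ^ 'n \<Rightarrow> 'y::real_normed_vector) set" where
  "test_functions_in K = {\<theta> \<in> test_functions. supp \<theta> \<subseteq> K}"

text \<open>
  The topology is generated by all balls of all the seminorms. For empty \<open>K\<close> the supremum is
  unspecified, but then the space is \<open>{0}\<close> and its topology is the only possible one.
\<close>

definition test_topology :: "(real ^ 'n) set \<Rightarrow> (real ^ 'n \<Rightarrow> 'y::real_normed_vector) topology" where
  "test_topology K = topology_generated_by
     {{\<eta> \<in> test_functions_in K. (SUP x\<in>K. norm_D j (\<lambda>x. \<eta> x - \<theta> x) x) < \<epsilon>} | j \<theta> \<epsilon>.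
        \<theta> \<in> test_functions_in K \<and> \<epsilon> > 0}"

section \<open>Distributions\<close>

text \<open>A distribution is a total HOL function of which only the values on test functions matter.\<close>

definition distribution :: "((real ^ 'n \<Rightarrow> 'y::real_normed_vector) \<Rightarrow> real) \<Rightarrow> bool" where
  "distribution T \<longleftrightarrow>
     (\<forall>\<theta>\<in>test_functions. \<forall>\<eta>\<in>test_functions. T (\<lambda>x. \<theta> x + \<eta> x) = T \<theta> + T \<eta>) \<and>
     (\<forall>c. \<forall>\<theta>\<in>test_functions. T (\<lambda>x. c *\<^sub>R \<theta> x) = c * T \<theta>) \<and>
     (\<forall>K. compact K \<longrightarrow> continuous_map (test_topology K) euclideanreal T)"

definition multi_indices :: "nat \<Rightarrow> ('n::finite \<Rightarrow> nat) set" where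
  "multi_indices m = {\<xi>. (\<Sum>j\<in>UNIV. \<xi> j) = m}"

text \<open>
  \<open>\<xi> j\<close> derivatives are taken in the direction of the \<open>j\<close>-th standard basis vector. The index type
  carries no order, so the order of differentiation is chosen arbitrarily; for smooth functions
  it is irrelevant.
\<close>

definition partial_D ::
    "('n \<Rightarrow> nat) \<Rightarrow> (real ^ 'n \<Rightarrow> 'y::real_normed_vector) \<Rightarrow> real ^ 'n \<Rightarrow> 'y" where
  "partial_D \<xi> f = Dmult f (map (\<lambda>j. axis j 1) (SOME js. \<forall>j. count_list js j = \<xi> j))"

definition distr_D ::
    "('n \<Rightarrow> nat) \<Rightarrow> ((real ^ 'n \<Rightarrow> 'y::real_normed_vector) \<Rightarrow> real)
      \<Rightarrow> (real ^ 'n \<Rightarrow> 'y) \<Rightarrow> real" where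
  "distr_D \<xi> T \<theta> = (- 1) ^ (\<Sum>j\<in>UNIV. \<xi> j) * T (partial_D \<xi> \<theta>)"

definition rescale ::
    "((real ^ 'n \<Rightarrow> 'y) \<Rightarrow> real) \<Rightarrow> real ^ 'n \<Rightarrow> real \<Rightarrow> (real ^ 'n \<Rightarrow> 'y) \<Rightarrow> real" where
  "rescale T a r \<theta> = r powi (- int CARD('n)) * T (\<lambda>x. \<theta> (inverse r *\<^sub>R (x - a)))"

section \<open>Polynomial functions\<close>

definition sym_multilinear :: "nat \<Rightarrow> ('a::real_vector list \<Rightarrow> 'b::real_vector) \<Rightarrow> bool" where
  "sym_multilinear m \<psi> \<longleftrightarrow>
     (\<forall>vs i. length vs = m \<and> i < m \<longrightarrow> linear (\<lambda>v. \<psi> (vs[i := v]))) \<and>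
     (\<forall>vs ws. length vs = m \<and> mset ws = mset vs \<longrightarrow> \<psi> ws = \<psi> vs)"

text \<open>For negative \<open>k\<close> the sum is empty, so only the zero function qualifies.\<close>

definition poly_fun :: "int \<Rightarrow> ('a::real_vector \<Rightarrow> 'b::real_vector) \<Rightarrow> bool" where
  "poly_fun k P \<longleftrightarrow>
     (\<exists>\<psi>. (\<forall>m. int m \<le> k \<longrightarrow> sym_multilinear m (\<psi> m)) \<and>
          (\<forall>x. P x = (\<Sum>m | int m \<le> k. \<psi> m (replicate m x))))"

definition poly_distr ::
    "(real ^ 'n \<Rightarrow> 'y \<Rightarrow>\<^sub>L real) \<Rightarrow> (real ^ 'n \<Rightarrow> 'y::real_normed_vector) \<Rightarrow> real" where
  "poly_distr P \<theta> = (LINT x|lebesgue. blinfun_apply (P x) (\<theta> x))"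

section \<open>Pointwise differentiability\<close>

definition nu :: "nat \<Rightarrow> ennreal \<Rightarrow> (real ^ 'n \<Rightarrow> 'y::real_normed_vector) \<Rightarrow> real" where
  "nu i p \<theta> =
     (if p = \<infinity> then SUP x. norm_D i \<theta> x
      else (LINT x|lebesgue. norm_D i \<theta> x powr enn2real p) powr (1 / enn2real p))"

definition unit_tests ::
    "((real ^ 'n \<Rightarrow> 'y::real_normed_vector) \<Rightarrow> real) \<Rightarrow> (real ^ 'n \<Rightarrow> 'y) set" where
  "unit_tests \<nu> = {\<theta> \<in> test_functions_in (cball 0 1). \<nu> \<theta> \<le> 1}"

text \<open>The suprema are taken in \<^typ>\<open>ereal\<close>, since they may be infinite.\<close>

definition pt_diff_holder ::
    "((real ^ 'n \<Rightarrow> 'y::real_normed_vector) \<Rightarrow> real) \<Rightarrow> int \<Rightarrow> real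
      \<Rightarrow> ((real ^ 'n \<Rightarrow> 'y) \<Rightarrow> real) \<Rightarrow> real ^ 'n \<Rightarrow> bool" where
  "pt_diff_holder \<nu> k \<alpha> T a \<longleftrightarrow>
     (\<exists>P :: real ^ 'n \<Rightarrow> 'y \<Rightarrow>\<^sub>L real. poly_fun k P \<and>
        Limsup (at_right 0) (\<lambda>r. SUP \<theta>\<in>unit_tests \<nu>.
          ereal (r powr (- of_int k - \<alpha>) * rescale (\<lambda>\<eta>. T \<eta> - poly_distr P \<eta>) a r \<theta>)) < \<infinity>)"

definition pt_diff ::
    "((real ^ 'n \<Rightarrow> 'y::real_normed_vector) \<Rightarrow> real) \<Rightarrow> int
      \<Rightarrow> ((real ^ 'n \<Rightarrow> 'y) \<Rightarrow> real) \<Rightarrow> real ^ 'n \<Rightarrow> bool" where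
  "pt_diff \<nu> k T a \<longleftrightarrow>
     (\<exists>P :: real ^ 'n \<Rightarrow> 'y \<Rightarrow>\<^sub>L real. poly_fun k P \<and>
        ((\<lambda>r. SUP \<theta>\<in>unit_tests \<nu>.
          ereal (r powi (- k) * rescale (\<lambda>\<eta>. T \<eta> - poly_distr P \<eta>) a r \<theta>)) \<longlongrightarrow> 0) (at_right 0))"

end

theory Submission
  imports Defs
begin

text \<open>
  The theorem reduces to one step: pass from all first derivatives \<open>D\<^sub>j S\<close> of \<open>S = D\<^sup>\<beta> T\<close> to \<open>S\<close>
  itself, raising the order by one (\<open>approximates_step\<close>); a descending induction on \<open>|\<beta>|\<close> does the rest.

  For the step write \<open>\<theta>\<^sub>r(x) = r\<^sup>-\<^sup>n \<theta>((x - a) / r)\<close>, so that \<open>S\<^sup>a\<^sup>,\<^sup>r(\<theta>) = S(\<theta>\<^sub>r)\<close>. Since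
  \<open>d/dr \<theta>\<^sub>r = - \<Sum>\<^sub>j D\<^sub>j((x\<^sub>j \<theta>)\<^sub>r)\<close>, one has \<open>d/dr S(\<theta>\<^sub>r) = \<Sum>\<^sub>j (D\<^sub>j S)((x\<^sub>j \<theta>)\<^sub>r)\<close>
  (\<open>dist_bounded_dilate_DERIV\<close>, \<open>h_DERIV\<close>). Multiplication by a coordinate is bounded for \<open>\<nu>\<^sub>i\<^sub>,\<^sub>p\<close> on
  functions supported in the unit ball, by a Poincare inequality (\<open>nu_times_coord\<close>). So if the
  \<open>D\<^sub>j S\<close> are approximated to order \<open>d\<close> by polynomials \<open>f\<^sub>j\<close> in \<open>x - a\<close>, this derivative equals
  \<open>\<Sum>\<^sub>j \<integral> \<langle>x\<^sub>j \<theta>(x), f\<^sub>j(r x)\<rangle> dx\<close> up to \<open>o(r\<^sup>d)\<close>, uniformly for \<open>\<nu>\<^sub>i\<^sub>,\<^sub>p(\<theta>) \<le> 1\<close>. Integrating the \<open>f\<^sub>j\<close> along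
  rays gives a polynomial \<open>g\<^sub>0\<close> of degree \<open>d + 1\<close> with \<open>g\<^sub>0(0) = 0\<close> whose pairing with \<open>\<theta>\<close> has exactly
  the main term as its \<open>r\<close>-derivative (\<open>polyf_radial_primitive\<close>). Subtracting it leaves a function
  of \<open>r\<close> with derivative \<open>o(r\<^sup>d)\<close>; it has a limit \<open>L(\<theta>)\<close> as \<open>r\<close> tends to \<open>0\<close>, and differs from it by
  \<open>o(r\<^sup>d\<^sup>+\<^sup>1)\<close>, uniformly in \<open>\<theta>\<close>.

  It remains to see that \<open>L\<close> is a constant. As \<open>S((D\<^sub>j \<eta>)\<^sub>s) = - s (D\<^sub>j S)(\<eta>\<^sub>s)\<close> tends to \<open>0\<close> with \<open>s\<close>, the
  linear functional \<open>L\<close> vanishes on all derivatives. By averaging over one coordinate after the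
  other, every test function is, modulo derivatives, a fixed bump function times a vector
  (\<open>kills_derivatives_representative\<close>); hence \<open>L(\<theta>) = \<integral> \<langle>\<theta>, c\<rangle>\<close> for some \<open>c\<close> in the dual space
  (\<open>L_representation\<close>), and \<open>g\<^sub>0 + c\<close> is the polynomial that approximates \<open>S\<close>.

  For \<open>k \<ge> 0\<close>, order \<open>(k, \<alpha>)\<close> implies order \<open>k\<close>. The other case allowed by \<open>k + \<alpha> \<ge> 0\<close> is \<open>k = -1\<close>,
  \<open>\<alpha> = 1\<close>. There the derivatives of order \<open>m\<close> are merely bounded, the polynomials are zero, and the same
  argument with a fixed bound in place of \<open>o(1)\<close> gives \<open>S(\<theta>\<^sub>r) - L(\<theta>) = O(r)\<close>: the derivatives of order
  \<open>m - 1\<close> have order \<open>0\<close> (\<open>approximates_of_bounded_derivs\<close>), and the first assertion applies to them.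
\<close>

section \<open>Calculus of smooth functions\<close>

definition dir_deriv :: "'a::real_normed_vector \<Rightarrow> ('a \<Rightarrow> 'b::real_normed_vector) \<Rightarrow> 'a \<Rightarrow> 'b" where
  "dir_deriv v f = (\<lambda>x. frechet_derivative f (at x) v)"

lemma dir_deriv_eqI:
  assumes "\<And>x. (f has_derivative f' x) (at x)"
  shows "dir_deriv v f = (\<lambda>x. f' x v)"
  unfolding dir_deriv_def using frechet_derivative_at[OF assms] by metis

lemma Dmult_Cons: "Dmult f (v # vs) = dir_deriv v (Dmult f vs)"
  by (simp add: dir_deriv_def)

lemma Dmult_append: "Dmult f (vs @ ws) = Dmult (Dmult f ws) vs"
  by (induction vs) auto

lemma Dmult_snoc: "Dmult f (vs @ [v]) = Dmult (dir_deriv v f) vs"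
  by (simp add: Dmult_append dir_deriv_def)

text \<open>Differentiability of all derivatives up to order \<open>n\<close>, by recursion on the first derivative. Smoothness
  is \<open>diffn n\<close> for all \<open>n\<close>; in this form closure under an operation follows by induction on \<open>n\<close> as
  soon as the first derivative of the result is expressed by the same operations.\<close>
primrec diffn :: "nat \<Rightarrow> ('a::real_normed_vector \<Rightarrow> 'b::real_normed_vector) \<Rightarrow> bool" where
  "diffn 0 f \<longleftrightarrow> (\<forall>x. f differentiable at x)"
| "diffn (Suc n) f \<longleftrightarrow> (\<forall>x. f differentiable at x) \<and> (\<forall>v. diffn n (dir_deriv v f))"

lemma diffn_Suc_D: "diffn (Suc n) f \<Longrightarrow> diffn n f"
  by (induction n arbitrary: f) auto

lemma diffn_iff_Dmult:
  fixes f :: "'a::real_normed_vector \<Rightarrow> 'b::real_normed_vector"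
  shows "diffn n f \<longleftrightarrow> (\<forall>vs x. length vs \<le> n \<longrightarrow> Dmult f vs differentiable at x)"
proof (induction n arbitrary: f)
  case (Suc n)
  show ?case
  proof safe
    fix vs :: "'a list" and x assume f: "diffn (Suc n) f" and l: "length vs \<le> Suc n"
    show "Dmult f vs differentiable at x"
    proof (cases vs rule: rev_cases)
      case Nil then show ?thesis using f by simp
    next
      case (snoc ys v) then show ?thesis using f l Suc by (simp add: Dmult_snoc del: Dmult.simps)
    qed
  next
    assume a: "\<forall>vs x. length vs \<le> Suc n \<longrightarrow> Dmult f vs differentiable at x"
    have "f differentiable at x" for x using a[rule_format, of "[]"] by simp
    moreover have "diffn n (dir_deriv v f)" for v
      using a[rule_format, of "_ @ [v]"] Suc by (simp add: Dmult_snoc del: Dmult.simps)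
    ultimately show "diffn (Suc n) f" by simp
  qed
qed auto

lemma smooth_iff_diffn: "smooth f \<longleftrightarrow> (\<forall>n. diffn n f)"
  unfolding smooth_def diffn_iff_Dmult by blast

lemma smooth_Dmult: "smooth f \<Longrightarrow> smooth (Dmult f ws)"
  unfolding smooth_def Dmult_append[symmetric] by blast

lemma smooth_dir_deriv: "smooth f \<Longrightarrow> smooth (dir_deriv v f)"
  using smooth_Dmult[of f "[v]"] by (simp add: dir_deriv_def)

lemma smooth_differentiable: "smooth f \<Longrightarrow> f differentiable at x"
  unfolding smooth_def by (metis Dmult.simps(1))

lemma smooth_has_derivative:
  "smooth f \<Longrightarrow> (f has_derivative (\<lambda>v. dir_deriv v f x)) (at x)"
  unfolding dir_deriv_def using smooth_differentiable[of f x] frechet_derivative_works by auto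

lemma smooth_continuous_on: "smooth f \<Longrightarrow> continuous_on A f"
  by (meson continuous_at_imp_continuous_on differentiable_imp_continuous_within smooth_differentiable)

lemma dir_deriv_linear_arg:
  assumes "smooth f"
  shows "linear (\<lambda>v. dir_deriv v f x)"
  using has_derivative_linear[OF smooth_has_derivative[OF assms]] .

lemma dir_deriv_add_arg: "smooth f \<Longrightarrow> dir_deriv (v + w) f x = dir_deriv v f x + dir_deriv w f x"
  using linear_add[OF dir_deriv_linear_arg] .

lemma dir_deriv_scaleR_arg: "smooth f \<Longrightarrow> dir_deriv (c *\<^sub>R v) f x = c *\<^sub>R dir_deriv v f x"
  using linear_scale[OF dir_deriv_linear_arg] .

lemma vec_eq_sum_axis: "v = (\<Sum>j\<in>UNIV. v $ j *\<^sub>R axis j (1::real))" for v :: "real ^ 'n"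
  by (simp add: vec_eq_iff axis_def if_distrib [of "\<lambda>x. _ * x"] cong: if_cong)

lemma dir_deriv_coords:
  fixes f :: "real ^ 'n \<Rightarrow> 'b::real_normed_vector"
  assumes "smooth f"
  shows "dir_deriv v f x = (\<Sum>j\<in>UNIV. v $ j *\<^sub>R dir_deriv (axis j 1) f x)"
proof -
  have "dir_deriv v f x = dir_deriv (\<Sum>j\<in>UNIV. v $ j *\<^sub>R axis j 1) f x"
    using vec_eq_sum_axis[of v] by simp
  also have "\<dots> = (\<Sum>j\<in>UNIV. dir_deriv (v $ j *\<^sub>R axis j 1) f x)"
    by (rule linear_sum[OF dir_deriv_linear_arg[OF assms]])
  finally show ?thesis by (simp add: dir_deriv_scaleR_arg[OF assms])
qed

text \<open>Closure properties of \<^const>\<open>diffn\<close>: since the first derivatives of a sum, product or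
  composition are again of this form, each is an induction on the order.\<close>

lemma has_derivative_dir_deriv:
  "f differentiable at x \<Longrightarrow> (f has_derivative (\<lambda>v. dir_deriv v f x)) (at x)"
  unfolding dir_deriv_def using frechet_derivative_works by auto

lemma diffn_const:
  fixes c :: "'b::real_normed_vector"
  shows "diffn n (\<lambda>x :: 'a::real_normed_vector. c)"
proof (induction n arbitrary: c)
  case (Suc n)
  have "dir_deriv v (\<lambda>x. c) = (\<lambda>x. 0)" for v :: 'a and c :: 'b
    by (rule dir_deriv_eqI) (rule has_derivative_const)
  then show ?case using Suc by simp
qed simp

lemma diffn_bounded_linear:
  assumes "bounded_linear f"
  shows "diffn n f"
proof (cases n)
  case 0 then show ?thesis using assms bounded_linear_imp_differentiable by auto
next
  case (Suc m)
  have "dir_deriv v f = (\<lambda>x. f v)" for v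
    by (rule dir_deriv_eqI) (use assms bounded_linear_imp_has_derivative in blast)
  then show ?thesis using Suc diffn_const assms bounded_linear_imp_differentiable by auto
qed

lemma dir_deriv_add:
  assumes "\<And>x. f differentiable at x" "\<And>x. g differentiable at x"
  shows "dir_deriv v (\<lambda>x. f x + g x) = (\<lambda>x. dir_deriv v f x + dir_deriv v g x)"
  by (rule dir_deriv_eqI, intro has_derivative_add has_derivative_dir_deriv assms)

lemma diffn_add:
  assumes "diffn n f" "diffn n g"
  shows "diffn n (\<lambda>x. f x + g x)"
  using assms
proof (induction n arbitrary: f g)
  case (Suc n)
  then show ?case by (simp add: dir_deriv_add)
qed simp

lemma dir_deriv_linear_comp:
  assumes "bounded_linear h" "\<And>x. f differentiable at x"
  shows "dir_deriv v (\<lambda>x. h (f x)) = (\<lambda>x. h (dir_deriv v f x))"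
  by (rule dir_deriv_eqI, intro bounded_linear.has_derivative[OF assms(1)] has_derivative_dir_deriv assms)

lemma differentiable_linear_comp:
  assumes "bounded_linear h" "f differentiable at x"
  shows "(\<lambda>x. h (f x)) differentiable at x"
  using assms bounded_linear.has_derivative unfolding differentiable_def by blast

lemma diffn_linear_comp:
  assumes h: "bounded_linear h" and "diffn n f"
  shows "diffn n (\<lambda>x. h (f x))"
  using assms(2)
proof (induction n arbitrary: f)
  case (Suc n)
  then show ?case by (auto simp: dir_deriv_linear_comp[OF h] intro: differentiable_linear_comp[OF h])
qed (auto intro: differentiable_linear_comp[OF h])

lemma (in bounded_bilinear) differentiable_prod:
  "f differentiable at x \<Longrightarrow> g differentiable at x \<Longrightarrow> (\<lambda>x. prod (f x) (g x)) differentiable at x"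
  unfolding differentiable_def using FDERIV by blast

lemma (in bounded_bilinear) dir_deriv_prod:
  assumes "\<And>x. f differentiable at x" "\<And>x. g differentiable at x"
  shows "dir_deriv v (\<lambda>x. prod (f x) (g x)) =
    (\<lambda>x. prod (f x) (dir_deriv v g x) + prod (dir_deriv v f x) (g x))"
  by (rule dir_deriv_eqI, intro FDERIV has_derivative_dir_deriv assms)

lemma (in bounded_bilinear) diffn_prod:
  assumes "diffn n f" "diffn n g"
  shows "diffn n (\<lambda>x. prod (f x) (g x))"
  using assms
proof (induction n arbitrary: f g)
  case (Suc n)
  have "diffn n f" "diffn n g" using Suc.prems diffn_Suc_D by blast+
  then show ?case
    using Suc by (auto simp: dir_deriv_prod intro!: differentiable_prod diffn_add)
qed (auto intro: differentiable_prod)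

lemma dir_deriv_affine:
  assumes A: "bounded_linear A" and f: "\<And>x. f differentiable at x"
  shows "dir_deriv v (\<lambda>x. f (A x + b)) = (\<lambda>x. dir_deriv (A v) f (A x + b))"
proof (rule dir_deriv_eqI)
  fix x
  have "((\<lambda>x. A x + b) has_derivative A) (at x)"
    using bounded_linear_imp_has_derivative[OF A] by (auto intro!: derivative_eq_intros)
  from diff_chain_at[OF this has_derivative_dir_deriv[OF f[of "A x + b"]]]
  show "((\<lambda>x. f (A x + b)) has_derivative (\<lambda>v. dir_deriv (A v) f (A x + b))) (at x)"
    by (simp add: o_def)
qed

lemma diffn_affine:
  assumes A: "bounded_linear A" and f: "diffn n f"
  shows "diffn n (\<lambda>x. f (A x + b))"
  using f
proof (induction n arbitrary: f)
  case 0
  have "((\<lambda>x. A x + b) has_derivative A) (at x)" for x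
    using bounded_linear_imp_has_derivative[OF A] by (auto intro!: derivative_eq_intros)
  then show ?case using 0 diff_chain_at[of "\<lambda>x. A x + b" A _ f]
    by (auto simp: differentiable_def o_def) metis
next
  case (Suc n)
  have "diffn 0 f" using Suc.prems by simp
  have "((\<lambda>x. A x + b) has_derivative A) (at x)" for x
    using bounded_linear_imp_has_derivative[OF A] by (auto intro!: derivative_eq_intros)
  then have "\<forall>x. (\<lambda>x. f (A x + b)) differentiable at x"
    using \<open>diffn 0 f\<close> diff_chain_at[of "\<lambda>x. A x + b" A _ f]
    by (auto simp: differentiable_def o_def) metis
  then show ?case using Suc by (simp add: dir_deriv_affine[OF A])
qed

lemma smooth_const: "smooth (\<lambda>x. c)"
  by (simp add: smooth_iff_diffn diffn_const)

lemma smooth_component: "smooth (\<lambda>x. x $ j)"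
  by (simp add: smooth_iff_diffn diffn_bounded_linear bounded_linear_vec_nth)

lemma smooth_add: "smooth f \<Longrightarrow> smooth g \<Longrightarrow> smooth (\<lambda>x. f x + g x)"
  by (simp add: smooth_iff_diffn diffn_add)

lemma smooth_linear_comp: "bounded_linear h \<Longrightarrow> smooth f \<Longrightarrow> smooth (\<lambda>x. h (f x))"
  by (simp add: smooth_iff_diffn diffn_linear_comp)

lemma smooth_scaleR_const: "smooth f \<Longrightarrow> smooth (\<lambda>x. c *\<^sub>R f x)"
  by (rule smooth_linear_comp[OF bounded_linear_scaleR_right])

lemma smooth_scaleR: "smooth f \<Longrightarrow> smooth g \<Longrightarrow> smooth (\<lambda>x. f x *\<^sub>R g x)"
  by (simp add: smooth_iff_diffn bounded_bilinear.diffn_prod[OF bounded_bilinear_scaleR])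

lemma smooth_diff:
  assumes "smooth f" "smooth g"
  shows "smooth (\<lambda>x. f x - g x)"
  using smooth_add[OF assms(1) smooth_scaleR_const[OF assms(2), of "-1"]] by simp

lemma smooth_affine: "bounded_linear A \<Longrightarrow> smooth f \<Longrightarrow> smooth (\<lambda>x. f (A x + b))"
  by (simp add: smooth_iff_diffn diffn_affine)

lemma smooth_sum:
  assumes "\<And>j. j \<in> J \<Longrightarrow> smooth (f j)"
  shows "smooth (\<lambda>x. \<Sum>j\<in>J. f j x)"
  using assms
  by (induction J rule: infinite_finite_induct) (auto intro: smooth_const smooth_add)

lemma smooth_scaleR_comp:
  assumes "smooth f" 
  shows "smooth (\<lambda>x. f (c *\<^sub>R (x - a)))"
  using smooth_affine[OF bounded_linear_scaleR_right[of c] assms, of "- c *\<^sub>R a"]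
  by (simp add: algebra_simps)

subsection \<open>Symmetry of higher derivatives\<close>

lemma norm_increment_le:
  fixes g :: "real \<Rightarrow> 'b::real_normed_vector"
  assumes "0 \<le> t" and g: "\<And>s. 0 \<le> s \<Longrightarrow> s \<le> t \<Longrightarrow> (g has_vector_derivative g' s) (at s)"
    and B: "\<And>s. 0 \<le> s \<Longrightarrow> s \<le> t \<Longrightarrow> norm (g' s) \<le> B"
  shows "norm (g t - g 0) \<le> t * B"
proof -
  have "norm (g t - g 0) \<le> B * norm (t - 0)"
  proof (rule differentiable_bound[of "{0..t}" g "\<lambda>s h. h *\<^sub>R g' s"])
    show "onorm (\<lambda>h. h *\<^sub>R g' x) \<le> B" if "x \<in> {0..t}" for x
      using B[of x] that by (intro onorm_le) (auto simp: mult.commute[of B] intro!: mult_left_mono)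
  qed (use g assms(1) in \<open>auto simp: has_vector_derivative_def intro: has_derivative_at_withinI\<close>)
  then show ?thesis using assms(1) by (simp add: mult.commute)
qed

lemma has_vector_derivative_line:
  assumes "smooth f"
  shows "((\<lambda>s. f (x + s *\<^sub>R v)) has_vector_derivative dir_deriv v f (x + s *\<^sub>R v)) (at s)"
proof -
  have "((\<lambda>s. x + s *\<^sub>R v) has_derivative (\<lambda>h. h *\<^sub>R v)) (at s)"
    by (auto intro!: derivative_eq_intros)
  from diff_chain_at[OF this smooth_has_derivative[OF assms]]
  show ?thesis
    by (simp add: has_vector_derivative_def o_def dir_deriv_scaleR_arg[OF assms])
qed

text \<open>The second difference of \<open>f\<close> is symmetric in \<open>v\<close> and \<open>w\<close>, whereas the bound below involves
  \<open>D\<^sub>w D\<^sub>v f\<close>. It comes from applying the mean value inequality in direction \<open>v\<close> and then, to the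
  derivative, in direction \<open>w\<close>.\<close>
lemma second_difference_bound:
  fixes f :: "real ^ 'n \<Rightarrow> 'b::real_normed_vector"
  assumes f: "smooth f" and e: "0 < e"
  shows "\<exists>d>0. \<forall>t. 0 < t \<and> t < d \<longrightarrow>
    norm (f (x + t *\<^sub>R v + t *\<^sub>R w) - f (x + t *\<^sub>R v) - f (x + t *\<^sub>R w) + f x
      - (t * t) *\<^sub>R dir_deriv w (dir_deriv v f) x) \<le> (t * t) * e"
proof -
  let ?A = "dir_deriv w (dir_deriv v f)"
  have sm: "smooth ?A" "smooth (dir_deriv v f)"
    using f by (simp_all add: smooth_dir_deriv)
  have "isCont ?A x"
    using smooth_continuous_on[OF sm(1), of UNIV] by (simp add: continuous_on_eq_continuous_at)
  then obtain d0 where d0: "d0 > 0" "\<And>y. dist y x < d0 \<Longrightarrow> dist (?A y) (?A x) < e"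
    unfolding continuous_at_eps_delta using e by metis
  \<comment> \<open>small enough that the whole parallelogram lies in the ball of radius \<open>d0\<close>\<close>
  define d where "d = d0 / (norm v + norm w + 1)"
  have pos: "norm v + norm w + 1 > 0" by (simp add: add_nonneg_pos)
  have "d > 0" using d0 pos by (simp add: d_def)
  moreover have "norm (f (x + t *\<^sub>R v + t *\<^sub>R w) - f (x + t *\<^sub>R v) - f (x + t *\<^sub>R w) + f x
      - (t * t) *\<^sub>R ?A x) \<le> (t * t) * e" if t: "0 < t" "t < d" for t
  proof -
    have near: "norm (?A (x + s *\<^sub>R v + u *\<^sub>R w) - ?A x) \<le> e"
      if "0 \<le> s" "s \<le> t" "0 \<le> u" "u \<le> t" for s u
    proof -
      have "norm (s *\<^sub>R v + u *\<^sub>R w) \<le> s * norm v + u * norm w"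
        using that norm_triangle_ineq[of "s *\<^sub>R v" "u *\<^sub>R w"] by simp
      also have "\<dots> \<le> t * norm v + t * norm w"
        using that by (intro add_mono mult_right_mono) auto
      also have "\<dots> \<le> t * (norm v + norm w + 1)" using t by (simp add: algebra_simps)
      also have "\<dots> < d * (norm v + norm w + 1)" using t pos by (intro mult_strict_right_mono) auto
      also have "\<dots> = d0" using pos by (simp add: d_def)
      finally have "dist (x + s *\<^sub>R v + u *\<^sub>R w) x < d0" by (simp add: dist_norm algebra_simps)
      from d0(2)[OF this] show ?thesis by (simp add: dist_norm)
    qed
    have inner: "norm (dir_deriv v f (x + s *\<^sub>R v + t *\<^sub>R w) - dir_deriv v f (x + s *\<^sub>R v) - t *\<^sub>R ?A x) \<le> t * e"
      if s: "0 \<le> s" "s \<le> t" for s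
    proof -
      let ?h = "\<lambda>u. dir_deriv v f ((x + s *\<^sub>R v) + u *\<^sub>R w) - u *\<^sub>R ?A x"
      have "norm (?h t - ?h 0) \<le> t * e"
      proof (rule norm_increment_le)
        show "(?h has_vector_derivative (?A ((x + s *\<^sub>R v) + u *\<^sub>R w) - ?A x)) (at u)" for u
          by (auto intro!: derivative_eq_intros has_vector_derivative_line sm)
      qed (use near s t in auto)
      then show ?thesis by (simp add: algebra_simps)
    qed
    let ?g = "\<lambda>s. f ((x + t *\<^sub>R w) + s *\<^sub>R v) - f (x + s *\<^sub>R v) - s *\<^sub>R (t *\<^sub>R ?A x)"
    have "norm (?g t - ?g 0) \<le> t * (t * e)"
    proof (rule norm_increment_le)
      show "(?g has_vector_derivative (dir_deriv v f ((x + t *\<^sub>R w) + s *\<^sub>R v)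
          - dir_deriv v f (x + s *\<^sub>R v) - t *\<^sub>R ?A x)) (at s)" for s
        by (auto intro!: derivative_eq_intros has_vector_derivative_line f)
    qed (use inner t in \<open>auto simp: algebra_simps\<close>)
    then show ?thesis by (simp add: algebra_simps)
  qed
  ultimately show ?thesis by blast
qed

lemma dir_deriv_commute:
  fixes f :: "real ^ 'n \<Rightarrow> 'b::real_normed_vector"
  assumes f: "smooth f"
  shows "dir_deriv v (dir_deriv w f) = dir_deriv w (dir_deriv v f)"
proof
  fix x
  let ?A = "dir_deriv w (dir_deriv v f) x" and ?B = "dir_deriv v (dir_deriv w f) x"
  have "norm (?A - ?B) \<le> 2 * e" if e: "0 < e" for e :: real
  proof -
    obtain d1 d2 where d: "d1 > 0" "d2 > 0"
      and 1: "\<And>t. 0 < t \<Longrightarrow> t < d1 \<Longrightarrow> norm (f (x + t *\<^sub>R v + t *\<^sub>R w) - f (x + t *\<^sub>R v)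
        - f (x + t *\<^sub>R w) + f x - (t * t) *\<^sub>R ?A) \<le> (t * t) * e"
      and 2: "\<And>t. 0 < t \<Longrightarrow> t < d2 \<Longrightarrow> norm (f (x + t *\<^sub>R w + t *\<^sub>R v) - f (x + t *\<^sub>R w)
        - f (x + t *\<^sub>R v) + f x - (t * t) *\<^sub>R ?B) \<le> (t * t) * e"
      using second_difference_bound[OF f e, of x v w] second_difference_bound[OF f e, of x w v] by metis
    define t where "t = min d1 d2 / 2"
    have t: "0 < t" "t < d1" "t < d2" using d by (auto simp: t_def)
    let ?D = "f (x + t *\<^sub>R v + t *\<^sub>R w) - f (x + t *\<^sub>R v) - f (x + t *\<^sub>R w) + f x"
    have "f (x + t *\<^sub>R w + t *\<^sub>R v) - f (x + t *\<^sub>R w) - f (x + t *\<^sub>R v) + f x = ?D"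
      by (simp add: algebra_simps)
    then have B: "norm (?D - (t * t) *\<^sub>R ?B) \<le> (t * t) * e"
      using 2[OF t(1,3)] by (simp only:)
    have "norm ((?D - (t * t) *\<^sub>R ?B) - (?D - (t * t) *\<^sub>R ?A)) \<le> (t * t) * e + (t * t) * e"
      by (rule order_trans[OF norm_triangle_ineq4 add_mono[OF B 1[OF t(1,2)]]])
    moreover have "(?D - (t * t) *\<^sub>R ?B) - (?D - (t * t) *\<^sub>R ?A) = (t * t) *\<^sub>R (?A - ?B)"
      by (simp add: algebra_simps)
    ultimately have "norm ((t * t) *\<^sub>R (?A - ?B)) \<le> (t * t) * e + (t * t) * e"
      by (simp only:)
    then have "(t * t) * norm (?A - ?B) \<le> (t * t) * (2 * e)"
      unfolding norm_scaleR by (simp add: algebra_simps)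
    then show ?thesis using t(1) by (simp add: mult_le_cancel_left_pos)
  qed
  from this[of "norm (?A - ?B) / 4"] have "norm (?A - ?B) = 0"
    by (cases "?A = ?B") auto
  then show "?B = ?A" by simp
qed

lemma Dmult_dir_deriv:
  fixes f :: "real ^ 'n \<Rightarrow> 'b::real_normed_vector"
  assumes f: "smooth f"
  shows "Dmult (dir_deriv v f) vs = dir_deriv v (Dmult f vs)"
proof (induction vs)
  case (Cons w ws)
  then show ?case
    using dir_deriv_commute[OF smooth_Dmult[OF f, of ws], of w v]
    by (simp add: Dmult_Cons del: Dmult.simps(2))
qed simp

text \<open>This makes the arbitrary order of differentiation in \<^const>\<open>partial_D\<close> irrelevant.\<close>
lemma Dmult_mset_eq:
  fixes f :: "real ^ 'n \<Rightarrow> 'b::real_normed_vector"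
  assumes f: "smooth f" and "mset vs = mset ws"
  shows "Dmult f vs = Dmult f ws"
  using assms(2)
proof (induction vs arbitrary: ws)
  case (Cons v vs)
  have "v \<in> set ws" using Cons.prems by (metis list.set_intros(1) mset_eq_setD)
  then obtain xs ys where ws: "ws = xs @ v # ys" by (meson split_list)
  have "mset vs = mset (xs @ ys)" using Cons.prems ws by simp
  then have "Dmult f (v # vs) = dir_deriv v (Dmult f (xs @ ys))"
    using Cons.IH by (simp only: Dmult_Cons)
  also have "\<dots> = Dmult f ws"
    unfolding ws Dmult_append Dmult_Cons
    using Dmult_dir_deriv[OF smooth_Dmult[OF f, of ys], of v xs] by simp
  finally show ?case .
qed simp

section \<open>Test functions\<close>

lemma supp_subset_iff: "closed K \<Longrightarrow> supp f \<subseteq> K \<longleftrightarrow> (\<forall>x. x \<notin> K \<longrightarrow> f x = 0)"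
  using closure_minimal[of "{x. f x \<noteq> 0}" K] closure_subset[of "{x. f x \<noteq> 0}"]
  unfolding supp_def by auto

lemma test_functions_in_iff:
  assumes "compact K"
  shows "f \<in> test_functions_in K \<longleftrightarrow> smooth f \<and> (\<forall>x. x \<notin> K \<longrightarrow> f x = 0)"
proof -
  have "compact (supp f)" if "supp f \<subseteq> K"
  proof -
    have "supp f = K \<inter> supp f" using that by blast
    then show ?thesis using compact_Int_closed[OF assms, of "supp f"] by (simp add: supp_def)
  qed
  then show ?thesis
    unfolding test_functions_in_def test_functions_def
    using supp_subset_iff[OF compact_imp_closed[OF assms], of f] by auto
qed

lemma test_functions_in_cball_iff:
  "f \<in> test_functions_in (cball 0 \<rho>) \<longleftrightarrow> smooth f \<and> (\<forall>x. \<rho> < norm x \<longrightarrow> f x = 0)"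
  by (subst test_functions_in_iff) (auto simp: not_le)

lemma test_functions_in_subset: "test_functions_in K \<subseteq> test_functions"
  by (auto simp: test_functions_in_def)

lemma test_functionsE:
  assumes "f \<in> test_functions"
  obtains \<rho> where "0 < \<rho>" "f \<in> test_functions_in (cball 0 \<rho>)"
proof -
  obtain r where "0 < r" "supp f \<subseteq> ball 0 r"
    using assms bounded_subset_ballD[of "supp f" 0] compact_imp_bounded
    by (auto simp: test_functions_def)
  then have "f \<in> test_functions_in (cball 0 r)"
    using assms ball_subset_cball[of 0 r] by (auto simp: test_functions_in_def)
  with \<open>0 < r\<close> show ?thesis by (rule that)
qed

lemma test_functions_smooth: "f \<in> test_functions \<Longrightarrow> smooth f"
  by (simp add: test_functions_def)

lemma dir_deriv_zero_outside:
  assumes "closed K" "\<And>x. x \<notin> K \<Longrightarrow> f x = 0" "x \<notin> K"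
  shows "dir_deriv v f x = 0"
proof -
  have "((\<lambda>x. 0) has_derivative (\<lambda>_. 0)) (at x)" by simp
  then have "(f has_derivative (\<lambda>_. 0)) (at x)"
    by (rule has_derivative_transform_within_open[where s="- K"]) (use assms in auto)
  from frechet_derivative_at[OF this] show ?thesis by (metis dir_deriv_def)
qed

lemma Dmult_zero_outside:
  assumes "closed K" "\<And>x. x \<notin> K \<Longrightarrow> f x = 0" "x \<notin> K"
  shows "Dmult f vs x = 0"
  using assms(3)
proof (induction vs arbitrary: x)
  case (Cons v vs)
  have "dir_deriv v (Dmult f vs) x = 0"
    by (rule dir_deriv_zero_outside[OF assms(1) Cons.IH Cons.prems])
  then show ?case by (simp only: Dmult_Cons)
qed (use assms in auto)

lemma test_in_dir_deriv:
  assumes "compact K" "f \<in> test_functions_in K"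
  shows "dir_deriv v f \<in> test_functions_in K"
  using assms dir_deriv_zero_outside[OF compact_imp_closed[OF assms(1)], of f]
  by (auto simp: test_functions_in_iff smooth_dir_deriv)

lemma test_in_Dmult:
  assumes "compact K" "f \<in> test_functions_in K"
  shows "Dmult f vs \<in> test_functions_in K"
  using assms Dmult_zero_outside[OF compact_imp_closed[OF assms(1)], of f]
  by (auto simp: test_functions_in_iff smooth_Dmult)

lemma test_in_add:
  assumes "compact K" "f \<in> test_functions_in K" "g \<in> test_functions_in K"
  shows "(\<lambda>x. f x + g x) \<in> test_functions_in K"
  using assms by (simp add: test_functions_in_iff smooth_add)

lemma test_in_diff:
  assumes "compact K" "f \<in> test_functions_in K" "g \<in> test_functions_in K"
  shows "(\<lambda>x. f x - g x) \<in> test_functions_in K"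
  using assms by (simp add: test_functions_in_iff smooth_diff)

lemma test_in_scaleR:
  assumes "compact K" "f \<in> test_functions_in K" "smooth g"
  shows "(\<lambda>x. g x *\<^sub>R f x) \<in> test_functions_in K"
  using assms by (simp add: test_functions_in_iff smooth_scaleR)

lemma test_in_scaleR_const:
  assumes "compact K" "f \<in> test_functions_in K"
  shows "(\<lambda>x. c *\<^sub>R f x) \<in> test_functions_in K"
  using test_in_scaleR[OF assms smooth_const] .

lemma test_dir_deriv: "f \<in> test_functions \<Longrightarrow> dir_deriv v f \<in> test_functions"
  by (meson compact_cball subsetD test_functionsE test_functions_in_subset test_in_dir_deriv)

lemma test_Dmult: "f \<in> test_functions \<Longrightarrow> Dmult f vs \<in> test_functions"
  by (meson compact_cball subsetD test_functionsE test_functions_in_subset test_in_Dmult)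

lemma test_scaleR: "f \<in> test_functions \<Longrightarrow> smooth g \<Longrightarrow> (\<lambda>x. g x *\<^sub>R f x) \<in> test_functions"
  by (metis compact_cball subsetD test_functionsE test_functions_in_subset test_in_scaleR)

lemma test_scaleR_const: "f \<in> test_functions \<Longrightarrow> (\<lambda>x. c *\<^sub>R f x) \<in> test_functions"
  by (rule test_scaleR[OF _ smooth_const])

lemma test_add:
  assumes "f \<in> test_functions" "g \<in> test_functions"
  shows "(\<lambda>x. f x + g x) \<in> test_functions"
proof -
  obtain r s where "f \<in> test_functions_in (cball 0 r)" "g \<in> test_functions_in (cball 0 s)"
    using assms test_functionsE by metis
  then have "(\<lambda>x. f x + g x) \<in> test_functions_in (cball 0 (max r s))"
    by (simp add: test_functions_in_cball_iff smooth_add)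
  then show ?thesis using test_functions_in_subset by blast
qed

lemma test_zero: "(\<lambda>x. 0) \<in> test_functions_in K"
  by (simp add: test_functions_in_def test_functions_def smooth_const supp_def)

lemma test_sum:
  assumes "\<And>j. j \<in> J \<Longrightarrow> f j \<in> test_functions"
  shows "(\<lambda>x. \<Sum>j\<in>J. f j x) \<in> test_functions"
  using assms
proof (induction J rule: infinite_finite_induct)
  case (insert j J)
  then show ?case by (simp add: test_add)
qed (use test_zero[of UNIV] test_functions_in_subset in auto)

section \<open>Partial antiderivatives\<close>

text \<open>Integrals of a smooth function along moving segments in the direction of one coordinate.
  Two cases are used: \<open>\<mu> = -1\<close> gives the integral over a line, and \<open>\<mu> \<tau> = \<tau> - 1\<close> gives, up to a
  factor, the primitive in that coordinate, rescaled to the parameter interval \<open>{0..1}\<close> so that the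
  limits of integration do not move.\<close>

definition segment_integral ::
    "'n::finite \<Rightarrow> real \<Rightarrow> real \<Rightarrow> (real \<Rightarrow> real) \<Rightarrow> (real \<Rightarrow> real) \<Rightarrow> (real \<Rightarrow> real)
      \<Rightarrow> (real ^ 'n \<Rightarrow> 'b::banach) \<Rightarrow> real ^ 'n \<Rightarrow> 'b" where
  "segment_integral j p q \<mu> \<sigma> w f x =
     integral {p..q} (\<lambda>\<tau>. w \<tau> *\<^sub>R f (x + (\<mu> \<tau> * x $ j + \<sigma> \<tau>) *\<^sub>R axis j 1))"

text \<open>Differentiation under the integral sign. Both terms of the derivative are again segment integrals,
  the second one because a displacement in direction \<open>j\<close> moves the point with parameter \<open>\<tau>\<close> by the
  additional factor \<open>\<mu> \<tau>\<close>; so smoothness follows by induction.\<close>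
lemma has_derivative_segment_integral:
  fixes f :: "real ^ 'n \<Rightarrow> 'b::banach"
  assumes f: "smooth f" and w: "continuous_on {p..q} w"
    and mu: "continuous_on {p..q} \<mu>" and si: "continuous_on {p..q} \<sigma>"
  shows "(segment_integral j p q \<mu> \<sigma> w f has_derivative
    (\<lambda>v. segment_integral j p q \<mu> \<sigma> w (dir_deriv v f) x
       + v $ j *\<^sub>R segment_integral j p q \<mu> \<sigma> (\<lambda>\<tau>. w \<tau> * \<mu> \<tau>) (dir_deriv (axis j 1) f) x)) (at x)"
proof -
  let ?e = "axis j 1 :: real ^ 'n"
  let ?a = "\<lambda>x \<tau>. x + (\<mu> \<tau> * x $ j + \<sigma> \<tau>) *\<^sub>R ?e"
  let ?D = "\<lambda>x \<tau> v. w \<tau> *\<^sub>R dir_deriv (v + (\<mu> \<tau> * v $ j) *\<^sub>R ?e) f (?a x \<tau>)"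
  have D: "((\<lambda>x. w \<tau> *\<^sub>R f (?a x \<tau>)) has_derivative ?D x \<tau>) (at x)" for x \<tau>
  proof -
    have "((\<lambda>x. ?a x \<tau>) has_derivative (\<lambda>v. v + (\<mu> \<tau> * v $ j) *\<^sub>R ?e)) (at x)"
      by (auto intro!: derivative_eq_intros bounded_linear_imp_has_derivative bounded_linear_vec_nth)
    from diff_chain_at[OF this smooth_has_derivative[OF f]]
    have "((\<lambda>x. f (?a x \<tau>)) has_derivative (\<lambda>v. dir_deriv (v + (\<mu> \<tau> * v $ j) *\<^sub>R ?e) f (?a x \<tau>))) (at x)"
      by (simp add: o_def)
    then show ?thesis by (intro derivative_intros)
  qed
  have split: "?D x \<tau> v = w \<tau> *\<^sub>R dir_deriv v f (?a x \<tau>) + v $ j *\<^sub>R ((w \<tau> * \<mu> \<tau>) *\<^sub>R dir_deriv ?e f (?a x \<tau>))"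
    for x \<tau> v
    by (simp add: dir_deriv_add_arg[OF f] dir_deriv_scaleR_arg[OF f] scaleR_add_right algebra_simps)
  have bl: "bounded_linear (?D x \<tau>)" for x \<tau>
    using D has_derivative_bounded_linear by blast
  have ca: "continuous_on (UNIV \<times> {p..q}) (\<lambda>(x, \<tau>). g (?a x \<tau>))" if "smooth g" for g :: "real ^ 'n \<Rightarrow> 'b"
    unfolding case_prod_unfold
    by (rule continuous_on_compose2[OF smooth_continuous_on[OF that, of UNIV]])
       (auto intro!: continuous_intros continuous_on_compose2[OF mu] continuous_on_compose2[OF si])
  have c1: "continuous_on {p..q} (\<lambda>\<tau>. g (?a x \<tau>))" if "smooth g" for g :: "real ^ 'n \<Rightarrow> 'b" and x
    by (rule continuous_on_compose2[OF smooth_continuous_on[OF that, of UNIV]])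
       (auto intro!: continuous_intros mu si)
  have D0: "((\<lambda>x. integral (cbox p q) (\<lambda>\<tau>. w \<tau> *\<^sub>R f (?a x \<tau>))) has_derivative
      blinfun_apply (integral (cbox p q) (\<lambda>\<tau>. Blinfun (?D x \<tau>)))) (at x within UNIV)"
  proof (rule leibniz_rule)
    show "((\<lambda>x. w t *\<^sub>R f (?a x t)) has_derivative blinfun_apply (Blinfun (?D x t))) (at x)" for x t
      using D bl by (simp add: bounded_linear_Blinfun_apply)
    show "(\<lambda>\<tau>. w \<tau> *\<^sub>R f (?a x \<tau>)) integrable_on cbox p q" for x
      using c1[OF f] w by (intro integrable_continuous) (auto intro!: continuous_intros)
    show "continuous_on (UNIV \<times> cbox p q) (\<lambda>(x, t). Blinfun (?D x t))"
    proof (rule continuous_on_blinfun_componentwise)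
      fix i :: "real ^ 'n"
      have "continuous_on (UNIV \<times> cbox p q) (\<lambda>(x, t). w t *\<^sub>R dir_deriv i f (?a x t)
          + i $ j *\<^sub>R ((w t * \<mu> t) *\<^sub>R dir_deriv ?e f (?a x t)))"
        using ca[OF smooth_dir_deriv[OF f]]
        by (auto simp: case_prod_unfold intro!: continuous_intros continuous_on_compose2[OF mu] continuous_on_compose2[OF w])
      then show "continuous_on (UNIV \<times> cbox p q) (\<lambda>x. blinfun_apply (case x of (x, t) \<Rightarrow> Blinfun (?D x t)) i)"
        by (simp only: case_prod_unfold split bounded_linear_Blinfun_apply[OF bl[unfolded split]])
    qed
  qed auto
  have E: "blinfun_apply (integral (cbox p q) (\<lambda>\<tau>. Blinfun (?D x \<tau>))) v =
      segment_integral j p q \<mu> \<sigma> w (dir_deriv v f) x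
       + v $ j *\<^sub>R segment_integral j p q \<mu> \<sigma> (\<lambda>\<tau>. w \<tau> * \<mu> \<tau>) (dir_deriv ?e f) x" for v
  proof -
    have ci: "continuous_on (cbox p q) (\<lambda>\<tau>. Blinfun (?D x \<tau>))"
    proof (rule continuous_on_blinfun_componentwise)
      fix i :: "real ^ 'n"
      show "continuous_on (cbox p q) (\<lambda>\<tau>. blinfun_apply (Blinfun (?D x \<tau>)) i)"
        unfolding split bounded_linear_Blinfun_apply[OF bl[unfolded split]]
        using c1[OF smooth_dir_deriv[OF f]] w mu by (auto intro!: continuous_intros)
    qed
    have "blinfun_apply (integral (cbox p q) (\<lambda>\<tau>. Blinfun (?D x \<tau>))) v =
        integral (cbox p q) (\<lambda>\<tau>. ?D x \<tau> v)"
      unfolding blinfun_apply_integral[OF integrable_continuous[OF ci]] bounded_linear_Blinfun_apply[OF bl] ..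
    also have "\<dots> = integral (cbox p q) (\<lambda>\<tau>. w \<tau> *\<^sub>R dir_deriv v f (?a x \<tau>))
        + integral (cbox p q) (\<lambda>\<tau>. v $ j *\<^sub>R ((w \<tau> * \<mu> \<tau>) *\<^sub>R dir_deriv ?e f (?a x \<tau>)))"
      unfolding split
      using c1[OF smooth_dir_deriv[OF f]] w mu
      by (intro integral_add integrable_continuous) (auto intro!: continuous_intros)
    finally show ?thesis by (simp only: segment_integral_def integral_cmul cbox_interval)
  qed
  have "(\<lambda>x. integral (cbox p q) (\<lambda>\<tau>. w \<tau> *\<^sub>R f (?a x \<tau>))) = segment_integral j p q \<mu> \<sigma> w f"
    by (simp add: fun_eq_iff segment_integral_def)
  with D0 show ?thesis by (simp only: ext[OF E])
qed

lemma dir_deriv_segment_integral: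
  fixes f :: "real ^ 'n \<Rightarrow> 'b::banach"
  assumes f: "smooth f" and w: "continuous_on {p..q} w"
    and mu: "continuous_on {p..q} \<mu>" and si: "continuous_on {p..q} \<sigma>"
  shows "dir_deriv v (segment_integral j p q \<mu> \<sigma> w f) =
    (\<lambda>x. segment_integral j p q \<mu> \<sigma> w (dir_deriv v f) x
       + v $ j *\<^sub>R segment_integral j p q \<mu> \<sigma> (\<lambda>\<tau>. w \<tau> * \<mu> \<tau>) (dir_deriv (axis j 1) f) x)"
  by (rule dir_deriv_eqI[OF has_derivative_segment_integral[OF assms]])

lemma smooth_segment_integral:
  fixes f :: "real ^ 'n \<Rightarrow> 'b::banach"
  assumes f: "smooth f" and w: "continuous_on {p..q} w"
    and mu: "continuous_on {p..q} \<mu>" and si: "continuous_on {p..q} \<sigma>"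
  shows "smooth (segment_integral j p q \<mu> \<sigma> w f)"
proof -
  have diff: "segment_integral j p q \<mu> \<sigma> w f differentiable at x"
    if "smooth f" "continuous_on {p..q} w" for f :: "real ^ 'n \<Rightarrow> 'b" and w x
    using has_derivative_segment_integral[OF that mu si] unfolding differentiable_def by blast
  have "diffn n (segment_integral j p q \<mu> \<sigma> w f)" for n
    using f w
  proof (induction n arbitrary: f w)
    case (Suc n)
    have "continuous_on {p..q} (\<lambda>\<tau>. w \<tau> * \<mu> \<tau>)"
      using Suc.prems mu by (intro continuous_intros)
    then show ?case using Suc diff
      by (auto simp: dir_deriv_segment_integral[OF _ _ mu si] smooth_dir_deriv
          intro!: diffn_add diffn_linear_comp[OF bounded_linear_scaleR_right])
  qed (use diff in auto)
  then show ?thesis by (simp add: smooth_iff_diffn)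
qed

section \<open>A smooth bump function\<close>

text \<open>The function \<open>t\<^sup>-\<^sup>k exp (- 1/t)\<close>, extended by zero. The powers of \<open>1/t\<close> make the family closed under
  differentiation up to linear combinations.\<close>
definition flat :: "nat \<Rightarrow> real \<Rightarrow> real" where
  "flat k t = (if t \<le> 0 then 0 else inverse t ^ k * exp (- inverse t))"

text \<open>This gives the derivative at \<open>0\<close>, as the difference quotient of \<open>flat k\<close> there is \<open>flat (k + 1)\<close>.\<close>
lemma flat_tendsto_0: "((\<lambda>t. flat k t) \<longlongrightarrow> 0) (at 0)"
proof -
  have "((\<lambda>t. inverse t ^ k / exp (inverse t)) \<longlongrightarrow> (0::real)) (at_right 0)"
    using filterlim_compose[OF tendsto_power_div_exp_0 filterlim_inverse_at_top_right] .
  then have r: "(flat k \<longlongrightarrow> 0) (at_right 0)"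
    by (rule Lim_transform_eventually)
       (auto simp: flat_def exp_minus divide_inverse eventually_at_right_less intro: eventually_mono[OF eventually_at_right_less])
  have "(flat k \<longlongrightarrow> 0) (at_left 0)"
    by (rule Lim_transform_eventually[OF tendsto_const])
       (auto simp: flat_def intro: eventually_mono[OF eventually_at_left_real[of "-1" 0]])
  with r show ?thesis by (simp add: filterlim_split_at)
qed

lemma flat_has_derivative:
  "(flat k has_real_derivative (flat (k + 2) t - real k * flat (k + 1) t)) (at t)"
proof -
  consider "t < 0" | "t = 0" | "t > 0" by linarith
  then show ?thesis
  proof cases
    case 1
    have "((\<lambda>t. 0) has_real_derivative 0) (at t)" by simp
    then have "(flat k has_real_derivative 0) (at t)"
      by (rule DERIV_cong_ev[THEN iffD1, rotated -1])
         (use 1 in \<open>auto simp: flat_def eventually_nhds intro!: exI[of _ "{..<0}"]\<close>)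
    with 1 show ?thesis by (simp add: flat_def)
  next
    case 2
    have "(flat k h - flat k 0) / h = flat (k + 1) h" if "h \<noteq> 0" for h
      using that by (auto simp: flat_def divide_inverse)
    then have "((\<lambda>h. (flat k (0 + h) - flat k 0) / h) \<longlongrightarrow> 0) (at 0)"
      by (intro Lim_transform_eventually[OF flat_tendsto_0[of "k + 1"]]) (auto simp: eventually_at intro!: exI[of _ 1])
    with 2 show ?thesis by (simp add: DERIV_def flat_def)
  next
    case 3
    have "((\<lambda>t. inverse t ^ k * exp (- inverse t)) has_real_derivative
        (inverse t ^ (k + 2) * exp (- inverse t) - real k * (inverse t ^ (k + 1) * exp (- inverse t)))) (at t)"
    proof -
      have d: "(inverse has_real_derivative - (inverse t ^ Suc (Suc 0))) (at t)"
        using 3 by (intro DERIV_inverse) simp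
      have "((\<lambda>t. inverse t ^ k * exp (- inverse t)) has_real_derivative
          inverse t ^ k * (exp (- inverse t) * - (- (inverse t ^ Suc (Suc 0))))
          + real k * (- (inverse t ^ Suc (Suc 0)) * inverse t ^ (k - Suc 0)) * exp (- inverse t)) (at t)"
        by (intro DERIV_mult' DERIV_power DERIV_fun_exp DERIV_minus d)
      then show ?thesis by (cases k) (simp_all add: algebra_simps)
    qed
    then have "(flat k has_real_derivative
        (inverse t ^ (k + 2) * exp (- inverse t) - real k * (inverse t ^ (k + 1) * exp (- inverse t)))) (at t)"
      by (rule DERIV_cong_ev[THEN iffD1, rotated -1])
         (use 3 in \<open>auto simp: flat_def eventually_nhds intro!: exI[of _ "{0<..}"]\<close>)
    with 3 show ?thesis by (simp add: flat_def)
  qed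
qed

lemma diffn_flat: "diffn n (\<lambda>x :: real ^ 'n. flat k (c * x $ j + b))"
proof -
  have D: "((\<lambda>x :: real ^ 'n. flat k (c * x $ j + b)) has_derivative
      (\<lambda>v. (c * v $ j) *\<^sub>R (flat (k + 2) (c * x $ j + b) + (- real k) *\<^sub>R flat (k + 1) (c * x $ j + b)))) (at x)" for k x
  proof -
    have "((\<lambda>x. c * x $ j + b) has_derivative (\<lambda>v. c * v $ j)) (at x)"
      by (auto intro!: derivative_eq_intros bounded_linear_imp_has_derivative bounded_linear_vec_nth)
    from diff_chain_at[OF this flat_has_derivative[THEN has_field_derivative_imp_has_derivative]]
    show ?thesis by (simp add: o_def algebra_simps)
  qed
  have diff: "(\<lambda>x :: real ^ 'n. flat k (c * x $ j + b)) differentiable at x" for k x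
    using D unfolding differentiable_def by blast
  show ?thesis
  proof (induction n arbitrary: k)
    case (Suc n)
    have "diffn n (dir_deriv v (\<lambda>x :: real ^ 'n. flat k (c * x $ j + b)))" for v
      unfolding dir_deriv_eqI[OF D]
      by (intro diffn_linear_comp[OF bounded_linear_scaleR_right] diffn_add Suc)
    then show ?case using diff by simp
  qed (use diff in simp)
qed

lemma continuous_flat: "continuous_on A (flat k)"
  using flat_has_derivative DERIV_isCont continuous_at_imp_continuous_on by blast

definition bump0 :: "real \<Rightarrow> real" where
  "bump0 t = flat 0 (1 + t) * flat 0 (1 - t)"

definition bump :: "real \<Rightarrow> real" where
  "bump t = bump0 t / integral {-1..1} bump0"

lemma bump0_nonneg: "0 \<le> bump0 t"
  by (simp add: bump0_def flat_def)

lemma bump0_eq_0: "1 \<le> \<bar>t\<bar> \<Longrightarrow> bump0 t = 0"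
  by (auto simp: bump0_def flat_def)

lemma continuous_bump0: "continuous_on A bump0"
  unfolding bump0_def
  by (intro continuous_intros continuous_on_compose2[OF continuous_flat[of UNIV]]) auto

lemma integral_bump0_pos: "0 < integral {-1..1} bump0"
proof -
  have "integral {-1..1} bump0 \<noteq> 0"
  proof
    assume "integral {-1..1} bump0 = 0"
    then have "(bump0 has_integral 0) (cbox (-1) 1)"
      using integrable_integral[OF integrable_continuous_real[OF continuous_bump0, of "-1" 1]] by simp
    then have "bump0 0 = 0"
      by (intro has_integral_0_cbox_imp_0[of "-1" 1 bump0] continuous_bump0 bump0_nonneg) auto
    then show False by (simp add: bump0_def flat_def)
  qed
  moreover have "0 \<le> integral {-1..1} bump0"
    using integrable_continuous_real[OF continuous_bump0] bump0_nonneg by (intro integral_nonneg) auto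
  ultimately show ?thesis by simp
qed

lemma bump_nonneg: "0 \<le> bump t"
  using integral_bump0_pos by (simp add: bump_def bump0_nonneg)

lemma bump_eq_0: "1 \<le> \<bar>t\<bar> \<Longrightarrow> bump t = 0"
  by (simp add: bump_def bump0_eq_0)

lemma bump_0_pos: "0 < bump 0"
  using integral_bump0_pos by (simp add: bump_def) (simp add: bump0_def flat_def)

lemma smooth_bump: "smooth (\<lambda>x :: real ^ 'n. bump (x $ j))"
proof -
  have "smooth (\<lambda>x :: real ^ 'n. inverse (integral {-1..1} bump0) *\<^sub>R (flat 0 (1 * x $ j + 1) *\<^sub>R flat 0 ((-1) * x $ j + 1)))"
    by (intro smooth_scaleR_const smooth_scaleR) (simp_all only: smooth_iff_diffn diffn_flat simp_thms)
  then show ?thesis by (simp add: bump_def bump0_def divide_inverse algebra_simps)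
qed

lemma bump_has_integral: "1 \<le> N \<Longrightarrow> (bump has_integral 1) {-N..N}"
proof -
  assume N: "1 \<le> N"
  have "(bump0 has_integral integral {-1..1} bump0) {-1..1}"
    using integrable_continuous_real[OF continuous_bump0] by blast
  from has_integral_divide[OF this, of "integral {-1..1} bump0"]
  have "(bump has_integral 1) {-1..1}"
    using integral_bump0_pos by (simp add: bump_def[abs_def])
  then show ?thesis
    by (rule has_integral_on_superset) (use N bump_eq_0 in auto)
qed

definition bump_prod :: "real ^ 'n \<Rightarrow> real" where
  "bump_prod x = (\<Prod>l\<in>UNIV. bump (x $ l))"

lemma smooth_prod_bump: "smooth (\<lambda>x :: real ^ 'n. \<Prod>l\<in>J. bump (x $ l))"
proof (induction J rule: infinite_finite_induct)
  case (insert j J)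
  have "smooth (\<lambda>x :: real ^ 'n. bump (x $ j) *\<^sub>R (\<Prod>l\<in>J. bump (x $ l)))"
    by (intro smooth_scaleR smooth_bump insert)
  then show ?case using insert by simp
qed (auto intro: smooth_const)

section \<open>Functionals that vanish on all derivatives\<close>

definition upd :: "real ^ 'n \<Rightarrow> 'n \<Rightarrow> real \<Rightarrow> real ^ 'n" where
  "upd x j s = (\<chi> l. if l = j then s else x $ l)"

lemma upd_nth [simp]: "upd x j s $ l = (if l = j then s else x $ l)"
  by (simp add: upd_def)

lemma upd_upd [simp]: "upd (upd x j s) j t = upd x j t"
  by (simp add: vec_eq_iff)

lemma upd_commute: "j \<noteq> l \<Longrightarrow> upd (upd x l t) j s = upd (upd x j s) l t"
  by (simp add: vec_eq_iff)

lemma upd_same [simp]: "upd x j (x $ j) = x"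
  by (simp add: vec_eq_iff)

lemma upd_eq: "upd x j s = x + (s - x $ j) *\<^sub>R axis j 1"
  by (simp add: vec_eq_iff axis_def)

definition line_integral :: "'n \<Rightarrow> real \<Rightarrow> (real ^ 'n \<Rightarrow> 'b::banach) \<Rightarrow> real ^ 'n \<Rightarrow> 'b" where
  "line_integral j N f x = integral {-N..N} (\<lambda>s. f (upd x j s))"

text \<open>\<open>primitive j N f\<close> is \<open>\<integral>\<close> of \<open>f\<close> along the line in direction \<open>j\<close> from coordinate \<open>-N\<close> up to the point,
  parametrised by \<open>{0..1}\<close>.\<close>
definition primitive :: "'n \<Rightarrow> real \<Rightarrow> (real ^ 'n \<Rightarrow> 'b::banach) \<Rightarrow> real ^ 'n \<Rightarrow> 'b" where
  "primitive j N f x = (x $ j + N) *\<^sub>R integral {0..1} (\<lambda>\<tau>. f (upd x j (\<tau> * (x $ j + N) - N)))"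

lemma line_integral_eq:
  "line_integral j N f = segment_integral j (-N) N (\<lambda>_. -1) (\<lambda>s. s) (\<lambda>_. 1) f"
  by (auto simp: line_integral_def segment_integral_def upd_eq)

lemma primitive_eq:
  "primitive j N f = (\<lambda>x. (x $ j + N) *\<^sub>R segment_integral j 0 1 (\<lambda>\<tau>. \<tau> - 1) (\<lambda>\<tau>. \<tau> * N - N) (\<lambda>_. 1) f x)"
  by (auto simp: primitive_def segment_integral_def upd_eq algebra_simps)

lemma smooth_line_integral: "smooth f \<Longrightarrow> smooth (line_integral j N f)"
  unfolding line_integral_eq by (intro smooth_segment_integral continuous_intros)

lemma smooth_primitive: "smooth f \<Longrightarrow> smooth (primitive j N f)"
  unfolding primitive_eq
  by (intro smooth_segment_integral smooth_scaleR smooth_add smooth_component smooth_const continuous_intros)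

text \<open>Along the segment \<open>\<gamma>\<close> the derivative of the integral is the integral of \<open>d/d\<tau> (\<tau> f(\<gamma> \<tau>))\<close>.\<close>
lemma dir_deriv_primitive:
  fixes f :: "real ^ 'n \<Rightarrow> 'b::banach"
  assumes f: "smooth f"
  shows "dir_deriv (axis j 1) (primitive j N f) = f"
proof
  fix x
  let ?e = "axis j 1 :: real ^ 'n"
  let ?\<gamma> = "\<lambda>\<tau>. upd x j (\<tau> * (x $ j + N) - N)"
  let ?G = "segment_integral j 0 1 (\<lambda>\<tau>. \<tau> - 1) (\<lambda>\<tau>. \<tau> * N - N)"
  let ?c = "x $ j + N"
  have path: "x + ((\<tau> - 1) * x $ j + (\<tau> * N - N)) *\<^sub>R ?e = ?\<gamma> \<tau>" for \<tau>
    by (simp add: upd_eq algebra_simps)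
  have G: "?G w g x = integral {0..1} (\<lambda>\<tau>. w \<tau> *\<^sub>R g (?\<gamma> \<tau>))" for w and g :: "real ^ 'n \<Rightarrow> 'b"
    by (simp only: segment_integral_def path)
  have "((\<lambda>x. (x $ j + N) *\<^sub>R ?G (\<lambda>_. 1) f x) has_derivative
      (\<lambda>v. ?c *\<^sub>R (?G (\<lambda>_. 1) (dir_deriv v f) x + v $ j *\<^sub>R ?G (\<lambda>\<tau>. 1 * (\<tau> - 1)) (dir_deriv ?e f) x)
        + (v $ j + 0) *\<^sub>R ?G (\<lambda>_. 1) f x)) (at x)"
    by (intro has_derivative_scaleR has_derivative_add has_derivative_const has_derivative_segment_integral f
        continuous_intros bounded_linear_imp_has_derivative bounded_linear_vec_nth)
  from fun_cong[OF frechet_derivative_at[OF this], of ?e]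
  have "dir_deriv ?e (primitive j N f) x =
      ?c *\<^sub>R (?G (\<lambda>_. 1) (dir_deriv ?e f) x + ?G (\<lambda>\<tau>. \<tau> - 1) (dir_deriv ?e f) x) + ?G (\<lambda>_. 1) f x"
    unfolding primitive_eq by (simp add: dir_deriv_def)
  also have "\<dots> = f x"
  proof -
    have cont: "continuous_on {0..1} (\<lambda>\<tau>. g (?\<gamma> \<tau>))" if "smooth g" for g :: "real ^ 'n \<Rightarrow> 'b"
      unfolding upd_eq
      by (rule continuous_on_compose2[OF smooth_continuous_on[OF that, of UNIV]]) (auto intro!: continuous_intros)
    have 1: "((\<lambda>\<tau>. w \<tau> *\<^sub>R g (?\<gamma> \<tau>)) has_integral ?G w g x) {0..1}"
      if "smooth g" "continuous_on {0..1} w" for g :: "real ^ 'n \<Rightarrow> 'b" and w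
      unfolding G using that
      by (intro integrable_integral integrable_continuous_real continuous_on_scaleR cont)
    have "((\<lambda>\<tau>. ?c *\<^sub>R (1 *\<^sub>R dir_deriv ?e f (?\<gamma> \<tau>) + (\<tau> - 1) *\<^sub>R dir_deriv ?e f (?\<gamma> \<tau>)) + 1 *\<^sub>R f (?\<gamma> \<tau>))
       has_integral (?c *\<^sub>R (?G (\<lambda>_. 1) (dir_deriv ?e f) x + ?G (\<lambda>\<tau>. \<tau> - 1) (dir_deriv ?e f) x) + ?G (\<lambda>_. 1) f x)) {0..1}"
      by (intro has_integral_add has_integral_cmul 1 f smooth_dir_deriv continuous_intros)
    moreover have "((\<lambda>\<tau>. ?c *\<^sub>R (1 *\<^sub>R dir_deriv ?e f (?\<gamma> \<tau>) + (\<tau> - 1) *\<^sub>R dir_deriv ?e f (?\<gamma> \<tau>)) + 1 *\<^sub>R f (?\<gamma> \<tau>))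
       has_integral (1 *\<^sub>R f (?\<gamma> 1) - 0 *\<^sub>R f (?\<gamma> 0))) {0..1}"
    proof (rule fundamental_theorem_of_calculus)
      fix \<tau> :: real assume "\<tau> \<in> {0..1}"
      have "((\<lambda>\<tau>. f (upd x j (- N) + \<tau> *\<^sub>R (?c *\<^sub>R ?e))) has_vector_derivative
          dir_deriv (?c *\<^sub>R ?e) f (upd x j (- N) + \<tau> *\<^sub>R (?c *\<^sub>R ?e))) (at \<tau>)"
        by (rule has_vector_derivative_line[OF f])
      moreover have "upd x j (- N) + \<tau> *\<^sub>R (?c *\<^sub>R ?e) = ?\<gamma> \<tau>" for \<tau>
        by (simp add: upd_eq algebra_simps)
      ultimately have "((\<lambda>\<tau>. f (?\<gamma> \<tau>)) has_vector_derivative ?c *\<^sub>R dir_deriv ?e f (?\<gamma> \<tau>)) (at \<tau>)"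
        by (simp add: dir_deriv_scaleR_arg[OF f])
      then have "((\<lambda>\<tau>. \<tau> *\<^sub>R f (?\<gamma> \<tau>)) has_vector_derivative \<tau> *\<^sub>R (?c *\<^sub>R dir_deriv ?e f (?\<gamma> \<tau>)) + 1 *\<^sub>R f (?\<gamma> \<tau>)) (at \<tau>)"
        by (intro has_vector_derivative_scaleR) auto
      then have "((\<lambda>\<tau>. \<tau> *\<^sub>R f (?\<gamma> \<tau>)) has_vector_derivative
          ?c *\<^sub>R (1 *\<^sub>R dir_deriv ?e f (?\<gamma> \<tau>) + (\<tau> - 1) *\<^sub>R dir_deriv ?e f (?\<gamma> \<tau>)) + 1 *\<^sub>R f (?\<gamma> \<tau>)) (at \<tau>)"
        by (simp add: algebra_simps)
      then show "((\<lambda>\<tau>. \<tau> *\<^sub>R f (?\<gamma> \<tau>)) has_vector_derivative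
          ?c *\<^sub>R (1 *\<^sub>R dir_deriv ?e f (?\<gamma> \<tau>) + (\<tau> - 1) *\<^sub>R dir_deriv ?e f (?\<gamma> \<tau>)) + 1 *\<^sub>R f (?\<gamma> \<tau>)) (at \<tau> within {0..1})"
        by (rule has_vector_derivative_at_within)
    qed simp
    ultimately show ?thesis
      by (metis (no_types, lifting) add_diff_cancel_right' diff_zero has_integral_unique mult_1 scaleR_one scaleR_zero_left upd_same)
  qed
  finally show "dir_deriv ?e (primitive j N f) x = f x" .
qed

text \<open>The functions considered vanish outside an open cube \<open>{x. \<forall>l. \<bar>x $ l\<bar> < N}\<close>.\<close>

definition in_cube :: "real \<Rightarrow> (real ^ 'n \<Rightarrow> 'b::real_normed_vector) \<Rightarrow> bool" where
  "in_cube N f \<longleftrightarrow> smooth f \<and> (\<forall>x l. N \<le> \<bar>x $ l\<bar> \<longrightarrow> f x = 0)"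

lemma in_cube_zero: "in_cube N f \<Longrightarrow> N \<le> \<bar>x $ l\<bar> \<Longrightarrow> f x = 0"
  by (auto simp: in_cube_def)

lemma in_cube_test:
  fixes f :: "real ^ 'n \<Rightarrow> 'b::real_normed_vector"
  assumes "smooth f" "\<And>x l. N < \<bar>x $ l\<bar> \<Longrightarrow> f x = 0"
  shows "f \<in> test_functions"
proof -
  have "f x = 0" if "real CARD('n) * N < norm x" for x
  proof -
    have "\<exists>l. N < \<bar>x $ l\<bar>"
    proof (rule ccontr)
      assume "\<not> ?thesis"
      then have "(\<Sum>l\<in>UNIV. \<bar>x $ l\<bar>) \<le> of_nat CARD('n) * N"
        by (intro sum_bounded_above) (auto simp: not_less)
      with that norm_le_l1_cart[of x] show False by simp
    qed
    with assms(2) show ?thesis by blast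
  qed
  then have "f \<in> test_functions_in (cball 0 (real CARD('n) * N))"
    using assms(1) by (simp add: test_functions_in_cball_iff)
  then show ?thesis using test_functions_in_subset by blast
qed

lemma test_functions_in_cube:
  assumes "f \<in> test_functions"
  obtains N where "1 \<le> N" "in_cube N f"
proof -
  obtain \<rho> where r: "0 < \<rho>" "f \<in> test_functions_in (cball 0 \<rho>)" using test_functionsE[OF assms] .
  have "f x = 0" if "\<rho> + 1 \<le> \<bar>x $ l\<bar>" for x l
    using r that component_le_norm_cart[of x l] by (auto simp: test_functions_in_cball_iff)
  then have "in_cube (\<rho> + 1) f" using r by (auto simp: in_cube_def test_functions_in_cball_iff)
  with r show ?thesis by (intro that[of "\<rho> + 1"]) auto
qed

lemma in_cube_imp_test: "in_cube N f \<Longrightarrow> f \<in> test_functions"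
  by (rule in_cube_test[of f N]) (simp add: in_cube_def, meson in_cube_zero less_imp_le)

text \<open>Beyond the support in the positive direction the primitive is constant with value the integral over
  the whole line, so it has compact support when these integrals vanish.\<close>
lemma primitive_test:
  fixes f :: "real ^ 'n \<Rightarrow> 'b::banach"
  assumes f: "in_cube N f" and N: "0 \<le> N" and line: "\<And>x. line_integral j N f x = 0"
  shows "primitive j N f \<in> test_functions"
proof (rule in_cube_test)
  have sf: "smooth f" using f by (simp add: in_cube_def)
  then show "smooth (primitive j N f)" by (rule smooth_primitive)
  let ?e = "axis j 1 :: real ^ 'n"
  fix x :: "real ^ 'n" and l assume l: "N < \<bar>x $ l\<bar>"
  show "primitive j N f x = 0"
  proof (cases "l = j")
    case False
    then have "f (upd x j s) = 0" for s using in_cube_zero[OF f, of "upd x j s" l] l by simp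
    then show ?thesis by (simp add: primitive_def)
  next
    case True
    define K where "K t = primitive j N f (upd x j t)" for t
    have K': "(K has_vector_derivative f (upd x j t)) (at t)" for t
    proof -
      have "((\<lambda>s. primitive j N f (upd x j 0 + s *\<^sub>R ?e)) has_vector_derivative
          dir_deriv ?e (primitive j N f) (upd x j 0 + t *\<^sub>R ?e)) (at t)"
        by (rule has_vector_derivative_line[OF smooth_primitive[OF sf]])
      moreover have "upd x j 0 + s *\<^sub>R ?e = upd x j s" for s by (simp add: upd_eq algebra_simps)
      ultimately show ?thesis by (simp add: K_def[abs_def] dir_deriv_primitive[OF sf])
    qed
    have const: "K s = K t" if "s \<le> t" "t \<le> - N \<or> N \<le> s" for s t
    proof -
      have "((\<lambda>u. f (upd x j u)) has_integral (K t - K s)) {s..t}"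
        using that(1) by (intro fundamental_theorem_of_calculus has_vector_derivative_at_within[OF K'])
      moreover have "((\<lambda>u. f (upd x j u)) has_integral 0) {s..t}"
      proof (rule has_integral_is_0)
        fix u assume "u \<in> {s..t}"
        with that(2) have "N \<le> \<bar>upd x j u $ j\<bar>" by auto
        then show "f (upd x j u) = 0" by (rule in_cube_zero[OF f])
      qed
      ultimately have "K t - K s = 0" by (rule has_integral_unique)
      then show ?thesis by simp
    qed
    have "K (- N) = 0" by (simp add: K_def primitive_def)
    moreover have "K N - K (- N) = 0"
    proof -
      have "((\<lambda>u. f (upd x j u)) has_integral (K N - K (- N))) {-N..N}"
        using N by (intro fundamental_theorem_of_calculus has_vector_derivative_at_within[OF K']) simp
      then show ?thesis using line[of x] by (simp add: line_integral_def integral_unique)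
    qed
    moreover have "N < \<bar>x $ j\<bar>" using l True by simp
    then have "N < x $ j \<or> x $ j < - N" by linarith
    then have "K (x $ j) = K N \<or> K (x $ j) = K (- N)"
      using const[of N "x $ j"] const[of "x $ j" "- N"] by auto
    ultimately have "K (x $ j) = 0" by auto
    then show ?thesis by (simp add: K_def)
  qed
qed

text \<open>Since \<^const>\<open>bump\<close> has integral \<open>1\<close>, the function \<open>f\<close> and its average over the coordinate \<open>j\<close>, spread
  out again by the bump function, have the same integrals over all lines in that direction; hence
  their difference has a compactly supported primitive.\<close>
lemma line_integral_step:
  fixes f :: "real ^ 'n \<Rightarrow> 'b::banach"
  assumes f: "in_cube N f" and N: "1 \<le> N"
  shows "in_cube N (\<lambda>x. bump (x $ j) *\<^sub>R line_integral j N f x)"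
    and "\<exists>\<eta>\<in>test_functions. f = (\<lambda>x. bump (x $ j) *\<^sub>R line_integral j N f x + dir_deriv (axis j 1) \<eta> x)"
proof -
  let ?g = "\<lambda>x. bump (x $ j) *\<^sub>R line_integral j N f x"
  have sf: "smooth f" using f by (simp add: in_cube_def)
  have "?g x = 0" if "N \<le> \<bar>x $ l\<bar>" for x l
  proof (cases "l = j")
    case True then show ?thesis using that N bump_eq_0[of "x $ j"] by simp
  next
    case False
    then have "f (upd x j s) = 0" for s using in_cube_zero[OF f, of "upd x j s" l] that by simp
    then show ?thesis by (simp add: line_integral_def)
  qed
  moreover have "smooth ?g"
    by (intro smooth_scaleR smooth_bump smooth_line_integral sf)
  ultimately show g: "in_cube N ?g"
    unfolding in_cube_def by blast
  let ?h = "\<lambda>x. f x - ?g x"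
  have h: "in_cube N ?h" using f g smooth_diff[of f ?g] by (simp add: in_cube_def)
  have "line_integral j N ?h x = 0" for x
  proof -
    have "(\<lambda>s. f (upd x j s)) integrable_on {-N..N}"
      unfolding upd_eq
      by (intro integrable_continuous_real continuous_on_compose2[OF smooth_continuous_on[OF sf, of UNIV]])
         (auto intro!: continuous_intros)
    then have a: "((\<lambda>s. f (upd x j s)) has_integral line_integral j N f x) {-N..N}"
      unfolding line_integral_def by (rule integrable_integral)
    have b: "((\<lambda>s. bump s *\<^sub>R line_integral j N f x) has_integral 1 *\<^sub>R line_integral j N f x) {-N..N}"
      by (rule has_integral_scaleR_left[OF bump_has_integral[OF N]])
    have "?g (upd x j s) = bump s *\<^sub>R line_integral j N f x" for s
      by (simp add: line_integral_def)
    then have "((\<lambda>s. ?h (upd x j s)) has_integral line_integral j N f x - 1 *\<^sub>R line_integral j N f x) {-N..N}"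
      using has_integral_diff[OF a b] by (simp only:)
    then show ?thesis by (simp add: line_integral_def integral_unique)
  qed
  then have "primitive j N ?h \<in> test_functions" using primitive_test[OF h] N by simp
  moreover have "f = (\<lambda>x. ?g x + dir_deriv (axis j 1) (primitive j N ?h) x)"
    using h by (subst dir_deriv_primitive) (auto simp: in_cube_def)
  ultimately show "\<exists>\<eta>\<in>test_functions. f = (\<lambda>x. ?g x + dir_deriv (axis j 1) \<eta> x)" by blast
qed

definition kills_derivatives :: "((real ^ 'n \<Rightarrow> 'b::real_normed_vector) \<Rightarrow> real) \<Rightarrow> bool" where
  "kills_derivatives F \<longleftrightarrow>
     (\<forall>\<theta>\<in>test_functions. \<forall>\<eta>\<in>test_functions. F (\<lambda>x. \<theta> x + \<eta> x) = F \<theta> + F \<eta>) \<and>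
     (\<forall>\<eta>\<in>test_functions. \<forall>j. F (dir_deriv (axis j 1) \<eta>) = 0)"

lemma kills_derivatives_add:
  "kills_derivatives F \<Longrightarrow> \<theta> \<in> test_functions \<Longrightarrow> \<eta> \<in> test_functions
    \<Longrightarrow> F (\<lambda>x. \<theta> x + \<eta> x) = F \<theta> + F \<eta>"
  by (simp add: kills_derivatives_def)

lemma bump_prod_test: "(\<lambda>x. bump_prod x *\<^sub>R y) \<in> test_functions"
proof (rule in_cube_test[where N = 1])
  show "smooth (\<lambda>x. bump_prod x *\<^sub>R y)"
    unfolding bump_prod_def by (intro smooth_scaleR smooth_prod_bump smooth_const)
  fix x :: "real ^ 'c" and l assume "1 < \<bar>x $ l\<bar>"
  then have "bump (x $ l) = 0" by (simp add: bump_eq_0)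
  then show "bump_prod x *\<^sub>R y = 0" by (auto simp: bump_prod_def)
qed

lemma independent_of_coordinates:
  fixes g :: "real ^ 'n \<Rightarrow> 'b"
  assumes "\<And>l x s. g (upd x l s) = g x"
  shows "g x = g 0"
proof -
  have "g (\<chi> l. if l \<in> J then 0 else x $ l) = g x" for J
  proof (induction J rule: infinite_finite_induct)
    case (insert j J)
    have "(\<chi> l. if l \<in> insert j J then 0 else x $ l) = upd (\<chi> l. if l \<in> J then 0 else x $ l) j 0"
      by (simp add: vec_eq_iff)
    then show ?case using assms insert by metis
  qed auto
  from this[of UNIV] show ?thesis by (simp add: zero_vec_def)
qed

text \<open>The vector \<open>y\<close> works for all functionals at once. This is what allows a functional to be compared
  with integration against a constant, of which only the values on \<open>bump_prod x *\<^sub>R y\<close> need to be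
  computed; no iterated integral occurs.\<close>
theorem kills_derivatives_representative:
  fixes \<theta> :: "real ^ 'n \<Rightarrow> 'b::banach"
  assumes \<theta>: "\<theta> \<in> test_functions"
  obtains y where "\<And>F. kills_derivatives F \<Longrightarrow> F \<theta> = F (\<lambda>x. bump_prod x *\<^sub>R y)"
proof -
  obtain N where N: "1 \<le> N" "in_cube N \<theta>" using test_functions_in_cube[OF \<theta>] .
  \<comment> \<open>after averaging over the coordinates in \<open>J\<close>; the remaining factor \<open>g\<close> does not depend on them\<close>
  have "\<exists>g. in_cube N (\<lambda>x. (\<Prod>l\<in>J. bump (x $ l)) *\<^sub>R g x) \<and> (\<forall>l\<in>J. \<forall>x s. g (upd x l s) = g x) \<and>
      (\<forall>F. kills_derivatives F \<longrightarrow> F \<theta> = F (\<lambda>x. (\<Prod>l\<in>J. bump (x $ l)) *\<^sub>R g x))" for J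
  proof (induction J rule: infinite_finite_induct)
    case (insert j J)
    then obtain g where g: "in_cube N (\<lambda>x. (\<Prod>l\<in>J. bump (x $ l)) *\<^sub>R g x)"
      and ind: "\<And>l x s. l \<in> J \<Longrightarrow> g (upd x l s) = g x"
      and F: "\<And>F. kills_derivatives F \<Longrightarrow> F \<theta> = F (\<lambda>x. (\<Prod>l\<in>J. bump (x $ l)) *\<^sub>R g x)"
      by blast
    let ?f = "\<lambda>x. (\<Prod>l\<in>J. bump (x $ l)) *\<^sub>R g x"
    define g' where "g' x = integral {-N..N} (\<lambda>s. g (upd x j s))" for x
    have "(\<Prod>l\<in>J. bump (upd x j s $ l)) = (\<Prod>l\<in>J. bump (x $ l))" for x s
      using insert(2) by (intro prod.cong) auto
    then have eq: "bump (x $ j) *\<^sub>R line_integral j N ?f x = (\<Prod>l\<in>insert j J. bump (x $ l)) *\<^sub>R g' x" for x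
      using insert(1,2) by (simp add: line_integral_def g'_def)
    have "in_cube N (\<lambda>x. (\<Prod>l\<in>insert j J. bump (x $ l)) *\<^sub>R g' x)"
      using line_integral_step(1)[OF g N(1), of j] unfolding eq .
    moreover have "g' (upd x l s) = g' x" if "l \<in> insert j J" for l x s
      using that ind by (cases "l = j") (auto simp: g'_def upd_commute)
    moreover have "F \<theta> = F (\<lambda>x. (\<Prod>l\<in>insert j J. bump (x $ l)) *\<^sub>R g' x)" if "kills_derivatives F" for F
    proof -
      obtain \<eta> where \<eta>: "\<eta> \<in> test_functions"
        "?f = (\<lambda>x. (\<Prod>l\<in>insert j J. bump (x $ l)) *\<^sub>R g' x + dir_deriv (axis j 1) \<eta> x)"
        using line_integral_step(2)[OF g N(1), of j] unfolding eq by blast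
      have "(\<lambda>x. (\<Prod>l\<in>insert j J. bump (x $ l)) *\<^sub>R g' x) \<in> test_functions"
        using line_integral_step(1)[OF g N(1), of j] unfolding eq
        by (rule in_cube_imp_test)
      then have "F ?f = F (\<lambda>x. (\<Prod>l\<in>insert j J. bump (x $ l)) *\<^sub>R g' x) + F (dir_deriv (axis j 1) \<eta>)"
        by (subst \<eta>(2)) (rule kills_derivatives_add[OF that _ test_dir_deriv[OF \<eta>(1)]])
      then show ?thesis using F[OF that] that \<eta>(1) by (simp add: kills_derivatives_def)
    qed
    ultimately show ?case by blast
  qed (use N in auto)
  from this[of UNIV] obtain g where "\<And>x l s. g (upd x l s) = g x"
    and F: "\<And>F. kills_derivatives F \<Longrightarrow> F \<theta> = F (\<lambda>x. (\<Prod>l\<in>UNIV. bump (x $ l)) *\<^sub>R g x)"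
    by auto
  then have "g x = g 0" for x by (intro independent_of_coordinates)
  then have "(\<lambda>x. (\<Prod>l\<in>UNIV. bump (x $ l)) *\<^sub>R g x) = (\<lambda>x. bump_prod x *\<^sub>R g 0)"
    by (simp add: fun_eq_iff bump_prod_def)
  with F show ?thesis by (intro that[of "g 0"]) simp
qed

section \<open>Distributions as functionals bounded by finitely many derivatives\<close>

lemma Dmult_add:
  assumes "smooth f" "smooth g"
  shows "Dmult (\<lambda>x. f x + g x) vs = (\<lambda>x. Dmult f vs x + Dmult g vs x)"
proof (induction vs)
  case (Cons v vs)
  then show ?case
    using dir_deriv_add[OF smooth_differentiable[OF smooth_Dmult[OF assms(1)]]
        smooth_differentiable[OF smooth_Dmult[OF assms(2)]], of v vs vs]
    by (simp only: Dmult_Cons)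
qed simp

lemma Dmult_linear_comp:
  assumes h: "bounded_linear h" and f: "smooth f"
  shows "Dmult (\<lambda>x. h (f x)) vs = (\<lambda>x. h (Dmult f vs x))"
proof (induction vs)
  case (Cons v vs)
  then show ?case
    using dir_deriv_linear_comp[OF h smooth_differentiable[OF smooth_Dmult[OF f]], of v vs]
    by (simp only: Dmult_Cons)
qed simp

lemma Dmult_scaleR:
  assumes f: "smooth f"
  shows "Dmult (\<lambda>x. c *\<^sub>R f x) vs = (\<lambda>x. c *\<^sub>R Dmult f vs x)"
  by (rule Dmult_linear_comp[OF bounded_linear_scaleR_right f])

lemma Dmult_zero: "Dmult (\<lambda>x :: real ^ 'n. 0 :: 'b::real_normed_vector) vs = (\<lambda>x. 0)"
  using Dmult_scaleR[OF smooth_const[of "0 :: 'b"], of 0 vs] by simp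

lemma Dmult_sum:
  assumes "\<And>j. j \<in> J \<Longrightarrow> smooth (f j)"
  shows "Dmult (\<lambda>x. \<Sum>j\<in>J. f j x) vs = (\<lambda>x. \<Sum>j\<in>J. Dmult (f j) vs x)"
  using assms
proof (induction J rule: infinite_finite_induct)
  case (insert j J)
  then show ?case by (simp add: Dmult_add smooth_sum)
qed (simp_all add: Dmult_zero)

text \<open>Bounds for the multilinear maps \<open>D\<^sup>j f\<close>, \<open>j \<le> N\<close>, stated pointwise so that no suprema have to be
  handled.\<close>
definition derivs_le :: "nat \<Rightarrow> real \<Rightarrow> (real ^ 'n \<Rightarrow> 'b::real_normed_vector) \<Rightarrow> bool" where
  "derivs_le N B f \<longleftrightarrow>
     (\<forall>vs x. length vs \<le> N \<longrightarrow> (\<forall>v\<in>set vs. norm v \<le> 1) \<longrightarrow> norm (Dmult f vs x) \<le> B)"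

lemma derivs_leD: "derivs_le N B f \<Longrightarrow> length vs \<le> N \<Longrightarrow> \<forall>v\<in>set vs. norm v \<le> 1 \<Longrightarrow> norm (Dmult f vs x) \<le> B"
  by (simp add: derivs_le_def)

lemma test_function_bounded:
  fixes f :: "real ^ 'n \<Rightarrow> 'b::real_normed_vector"
  assumes "f \<in> test_functions"
  shows "\<exists>B. \<forall>x. norm (f x) \<le> B"
proof -
  obtain r where f: "f \<in> test_functions_in (cball 0 r)" using test_functionsE[OF assms] .
  then have "compact (f ` cball 0 r)"
    by (intro compact_continuous_image smooth_continuous_on) (auto simp: test_functions_in_cball_iff)
  then obtain B where B: "\<And>x. norm x \<le> r \<Longrightarrow> norm (f x) \<le> B"
    using compact_imp_bounded bounded_iff by (metis imageI mem_cball_0)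
  have "norm (f x) \<le> max B 0" for x
    using B[of x] f by (cases "norm x \<le> r") (auto simp: test_functions_in_cball_iff le_max_iff_disj)
  then show ?thesis by blast
qed

text \<open>Expanding the innermost direction in coordinates reduces the order by one, at the cost of finitely many
  functions; continuity alone gives no uniformity in the directions.\<close>
lemma Dmult_bounded:
  fixes f :: "real ^ 'n \<Rightarrow> 'b::real_normed_vector"
  assumes "f \<in> test_functions"
  shows "\<exists>B. \<forall>vs x. length vs = j \<longrightarrow> (\<forall>v\<in>set vs. norm v \<le> 1) \<longrightarrow> norm (Dmult f vs x) \<le> B"
  using assms
proof (induction j arbitrary: f)
  case 0
  then show ?case using test_function_bounded by auto
next
  case (Suc j)
  have "\<forall>i. \<exists>B. \<forall>vs x. length vs = j \<longrightarrow> (\<forall>v\<in>set vs. norm v \<le> 1)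
      \<longrightarrow> norm (Dmult (dir_deriv (axis i 1) f) vs x) \<le> B"
    using Suc test_dir_deriv by blast
  then obtain B where B: "\<And>i vs x. length vs = j \<Longrightarrow> \<forall>v\<in>set vs. norm v \<le> 1
      \<Longrightarrow> norm (Dmult (dir_deriv (axis i 1) f) vs x) \<le> B i"
    by metis
  have sf: "smooth f" using Suc test_functions_smooth by blast
  have "norm (Dmult f vs x) \<le> (\<Sum>i\<in>UNIV. B i)" if vs: "length vs = Suc j" "\<forall>v\<in>set vs. norm v \<le> 1" for vs x
  proof -
    obtain ws v where w: "vs = ws @ [v]" using vs(1) by (metis length_Suc_conv_rev)
    have "dir_deriv v f = (\<lambda>x. \<Sum>i\<in>UNIV. v $ i *\<^sub>R dir_deriv (axis i 1) f x)"
      using dir_deriv_coords[OF sf, of v] by blast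
    then have "Dmult f vs x = (\<Sum>i\<in>UNIV. v $ i *\<^sub>R Dmult (dir_deriv (axis i 1) f) ws x)"
      unfolding w Dmult_snoc
      by (simp add: Dmult_sum Dmult_scaleR smooth_scaleR_const smooth_dir_deriv sf)
    moreover have "norm (v $ i *\<^sub>R Dmult (dir_deriv (axis i 1) f) ws x) \<le> B i" for i
    proof -
      have "\<bar>v $ i\<bar> \<le> 1" using component_le_norm_cart[of v i] vs(2) w by simp
      moreover have "norm (Dmult (dir_deriv (axis i 1) f) ws x) \<le> B i" using vs w by (intro B) auto
      ultimately show ?thesis
        using mult_mono[of "\<bar>v $ i\<bar>" 1 "norm (Dmult (dir_deriv (axis i 1) f) ws x)" "B i"] by simp
    qed
    ultimately show ?thesis by (simp add: sum_norm_le)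
  qed
  then show ?case by blast
qed

lemma test_derivs_le:
  fixes f :: "real ^ 'n \<Rightarrow> 'b::real_normed_vector"
  assumes "f \<in> test_functions"
  shows "\<exists>B\<ge>0. derivs_le N B f"
proof -
  obtain B where B: "\<And>j vs x. length vs = j \<Longrightarrow> \<forall>v\<in>set vs. norm v \<le> 1 \<Longrightarrow> norm (Dmult f vs x) \<le> B j"
    using Dmult_bounded[OF assms] by metis
  have nonneg: "0 \<le> B j" for j
    using B[of "replicate j 0" j] norm_ge_zero order_trans by (metis length_replicate in_set_replicate norm_zero zero_le_one)
  have "norm (Dmult f vs x) \<le> (\<Sum>j\<le>N. B j)" if "length vs \<le> N" "\<forall>v\<in>set vs. norm v \<le> 1" for vs x
    using B[of vs "length vs" x] that member_le_sum[of "length vs" "{..N}" B] nonneg by force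
  then show ?thesis using nonneg sum_nonneg[of "{..N}" B] by (auto simp: derivs_le_def)
qed

subsection \<open>The seminorms\<close>

lemma norm_D_upper:
  assumes "f \<in> test_functions" "length vs = j" "\<forall>v\<in>set vs. norm v \<le> 1"
  shows "norm (Dmult f vs x) \<le> norm_D j f x"
proof -
  obtain B where "derivs_le j B f" using test_derivs_le[OF assms(1)] by blast
  then show ?thesis
    unfolding norm_D_def using assms
    by (intro cSUP_upper bdd_aboveI2[where M = B]) (auto simp: derivs_le_def)
qed

lemma norm_D_least:
  fixes f :: "real ^ 'n \<Rightarrow> 'b::real_normed_vector"
  assumes "\<And>vs. length vs = j \<Longrightarrow> \<forall>v\<in>set vs. norm v \<le> 1 \<Longrightarrow> norm (Dmult f vs x) \<le> B"
  shows "norm_D j f x \<le> B"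
proof -
  have "replicate j 0 \<in> {vs. length vs = j \<and> (\<forall>v\<in>set vs. norm v \<le> 1)}" by simp
  then have "{vs :: (real ^ 'n) list. length vs = j \<and> (\<forall>v\<in>set vs. norm v \<le> 1)} \<noteq> {}"
    by blast
  then show ?thesis unfolding norm_D_def by (rule cSUP_least) (use assms in auto)
qed

lemma norm_D_nonneg: "f \<in> test_functions \<Longrightarrow> 0 \<le> norm_D j f x"
  using norm_D_upper[of f "replicate j 0" j x] norm_ge_zero order_trans
  by (metis length_replicate in_set_replicate norm_zero zero_le_one)

lemma norm_D_add_le:
  fixes f :: "real ^ 'n \<Rightarrow> 'b::real_normed_vector"
  assumes "f \<in> test_functions" "g \<in> test_functions"
  shows "norm_D j (\<lambda>x. f x + g x) x \<le> norm_D j f x + norm_D j g x"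
proof (rule norm_D_least)
  fix vs :: "(real ^ 'n) list" assume vs: "length vs = j" "\<forall>v\<in>set vs. norm v \<le> 1"
  have "norm (Dmult (\<lambda>x. f x + g x) vs x) \<le> norm (Dmult f vs x) + norm (Dmult g vs x)"
    using assms by (simp add: Dmult_add test_functions_smooth norm_triangle_ineq)
  also have "\<dots> \<le> norm_D j f x + norm_D j g x"
    using assms vs by (intro add_mono norm_D_upper)
  finally show "norm (Dmult (\<lambda>x. f x + g x) vs x) \<le> norm_D j f x + norm_D j g x" .
qed

lemma norm_D_zero: "norm_D j (\<lambda>x :: real ^ 'n. 0 :: 'b::real_normed_vector) x = 0"
proof -
  have "norm_D j (\<lambda>x :: real ^ 'n. 0 :: 'b) x \<le> 0" by (rule norm_D_least) (simp add: Dmult_zero)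
  moreover have "(\<lambda>x :: real ^ 'n. 0 :: 'b) \<in> test_functions"
    using test_zero test_functions_in_subset by blast
  ultimately show ?thesis using norm_D_nonneg by (metis order_antisym)
qed

lemma norm_D_le: "derivs_le N B f \<Longrightarrow> j \<le> N \<Longrightarrow> norm_D j f x \<le> B"
  by (rule norm_D_least) (auto intro: derivs_leD)

text \<open>The usual description of distributions by finitely many seminorms.\<close>
definition dist_bounded :: "((real ^ 'n \<Rightarrow> 'b::real_normed_vector) \<Rightarrow> real) \<Rightarrow> bool" where
  "dist_bounded S \<longleftrightarrow>
     (\<forall>\<theta>\<in>test_functions. \<forall>\<eta>\<in>test_functions. S (\<lambda>x. \<theta> x + \<eta> x) = S \<theta> + S \<eta>) \<and>
     (\<forall>c. \<forall>\<theta>\<in>test_functions. S (\<lambda>x. c *\<^sub>R \<theta> x) = c * S \<theta>) \<and>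
     (\<forall>\<rho>>0. \<exists>N C. \<forall>\<theta>\<in>test_functions_in (cball 0 \<rho>). \<forall>B\<ge>0. derivs_le N B \<theta> \<longrightarrow> \<bar>S \<theta>\<bar> \<le> C * B)"

lemma dist_bounded_add:
  "dist_bounded S \<Longrightarrow> \<theta> \<in> test_functions \<Longrightarrow> \<eta> \<in> test_functions \<Longrightarrow> S (\<lambda>x. \<theta> x + \<eta> x) = S \<theta> + S \<eta>"
  by (simp add: dist_bounded_def)

lemma dist_bounded_scaleR:
  "dist_bounded S \<Longrightarrow> \<theta> \<in> test_functions \<Longrightarrow> S (\<lambda>x. c *\<^sub>R \<theta> x) = c * S \<theta>"
  by (simp add: dist_bounded_def)

lemma dist_bounded_sum:
  assumes S: "dist_bounded S" and f: "\<And>j. j \<in> J \<Longrightarrow> f j \<in> test_functions"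
  shows "S (\<lambda>x. \<Sum>j\<in>J. f j x) = (\<Sum>j\<in>J. S (f j))"
proof -
  have "S (\<lambda>x. 0) = 0"
    using dist_bounded_scaleR[OF S, of "\<lambda>x. 0" 0] test_zero test_functions_in_subset by force
  then show ?thesis
    using f
  proof (induction J rule: infinite_finite_induct)
    case (insert j J)
    then show ?case by (simp add: dist_bounded_add[OF S] test_sum)
  qed auto
qed

text \<open>A basic open set is a seminorm ball about some \<open>\<theta>\<close>; if it contains \<open>0\<close>, the triangle inequality puts
  a ball about \<open>0\<close> into it. The general case is an induction on the generation of the topology.\<close>
lemma test_topology_nbhd_zero:
  fixes U :: "(real ^ 'n \<Rightarrow> 'b::real_normed_vector) set"
  assumes K: "compact K" "K \<noteq> {}" and U: "openin (test_topology K) U" "(\<lambda>x. 0) \<in> U"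
  shows "\<exists>N. \<exists>\<delta>>0. \<forall>\<eta>\<in>test_functions_in K. derivs_le N \<delta> \<eta> \<longrightarrow> \<eta> \<in> U"
proof -
  let ?\<S> = "{{\<eta> \<in> test_functions_in K. (SUP x\<in>K. norm_D j (\<lambda>x. \<eta> x - \<theta> x) x) < \<epsilon>} | j \<theta> \<epsilon>.
        \<theta> \<in> test_functions_in K \<and> \<epsilon> > 0} :: (real ^ 'n \<Rightarrow> 'b) set set"
  have "generate_topology_on ?\<S> U"
    using U(1) by (simp add: test_topology_def openin_topology_generated_by_iff)
  then show ?thesis
    using U(2)
  proof induction
    case (Int a b)
    then obtain N1 d1 N2 d2 where d: "d1 > 0" "d2 > 0"
      "\<And>\<eta>. \<eta> \<in> test_functions_in K \<Longrightarrow> derivs_le N1 d1 \<eta> \<Longrightarrow> \<eta> \<in> a"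
      "\<And>\<eta>. \<eta> \<in> test_functions_in K \<Longrightarrow> derivs_le N2 d2 \<eta> \<Longrightarrow> \<eta> \<in> b"
      by (metis IntD1 IntD2)
    have "derivs_le (max N1 N2) (min d1 d2) \<eta> \<Longrightarrow> derivs_le N1 d1 \<eta> \<and> derivs_le N2 d2 \<eta>"
      for \<eta> :: "real ^ 'n \<Rightarrow> 'b"
      unfolding derivs_le_def by (simp add: le_max_iff_disj)
    with d show ?case by (intro exI[of _ "max N1 N2"] exI[of _ "min d1 d2"]) auto
  next
    case (UN \<K>)
    then obtain k where k: "k \<in> \<K>" "(\<lambda>x. 0) \<in> k" by blast
    with UN(2)[of k] show ?case by (meson UnionI)
  next
    case (Basis s)
    then obtain j \<theta> \<epsilon> where s: "s = {\<eta> \<in> test_functions_in K. (SUP x\<in>K. norm_D j (\<lambda>x. \<eta> x - \<theta> x) x) < \<epsilon>}"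
      and t: "\<theta> \<in> test_functions_in K" by blast
    define m where "m = (SUP x\<in>K. norm_D j (\<lambda>x. 0 - \<theta> x) x)"
    have m: "m < \<epsilon>" using Basis(2) s by (simp add: m_def)
    have tm: "(\<lambda>x. 0 - \<theta> x) \<in> test_functions"
      using test_in_diff[OF K(1) test_zero t] test_functions_in_subset by blast
    obtain B where B: "derivs_le j B (\<lambda>x. 0 - \<theta> x)" using test_derivs_le[OF tm] by blast
    have "\<eta> \<in> s" if e: "\<eta> \<in> test_functions_in K" and d: "derivs_le j ((\<epsilon> - m) / 2) \<eta>" for \<eta>
    proof -
      have "norm_D j (\<lambda>x. \<eta> x - \<theta> x) x \<le> (\<epsilon> - m) / 2 + m" if x: "x \<in> K" for x
      proof -
        have "norm_D j (\<lambda>x. \<eta> x + (0 - \<theta> x)) x \<le> norm_D j \<eta> x + norm_D j (\<lambda>x. 0 - \<theta> x) x"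
          using e test_functions_in_subset by (intro norm_D_add_le tm) blast
        moreover have "norm_D j \<eta> x \<le> (\<epsilon> - m) / 2" using norm_D_le[OF d] by simp
        moreover have "norm_D j (\<lambda>x. 0 - \<theta> x) x \<le> m"
          unfolding m_def using norm_D_le[OF B] by (intro cSUP_upper[OF x] bdd_aboveI2[where M = B]) simp
        moreover have "(\<lambda>x. \<eta> x + (0 - \<theta> x)) = (\<lambda>x. \<eta> x - \<theta> x)" by simp
        ultimately show ?thesis by (simp only:)
      qed
      then have "(SUP x\<in>K. norm_D j (\<lambda>x. \<eta> x - \<theta> x) x) \<le> (\<epsilon> - m) / 2 + m"
        by (intro cSUP_least K(2))
      also have "\<dots> < \<epsilon>" using m by (simp add: field_simps)
      finally show ?thesis using e s by simp
    qed
    with m show ?case by (intro exI[of _ j] exI[of _ "(\<epsilon> - m) / 2"]) auto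
  qed auto
qed

lemma topspace_test_topology:
  fixes K :: "(real ^ 'n) set"
  assumes "K \<noteq> {}"
  shows "topspace (test_topology K :: (real ^ 'n \<Rightarrow> 'b::real_normed_vector) topology) = test_functions_in K"
proof -
  have "\<theta> \<in> topspace (test_topology K)"
    if t: "\<theta> \<in> test_functions_in K" for \<theta> :: "real ^ 'n \<Rightarrow> 'b"
  proof -
    have "\<theta> \<in> {\<eta> \<in> test_functions_in K. (SUP x\<in>K. norm_D 0 (\<lambda>x. \<eta> x - \<theta> x) x) < 1}"
      using that assms by (simp add: norm_D_zero)
    moreover have "(1 :: real) > 0" by simp
    ultimately show ?thesis
      unfolding test_topology_def topology_generated_by_topspace using t by blast
  qed
  moreover have "topspace (test_topology K) \<subseteq> (test_functions_in K :: (real ^ 'n \<Rightarrow> 'b) set)"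
    unfolding test_topology_def topology_generated_by_topspace by blast
  ultimately show ?thesis by blast
qed

lemma distribution_dist_bounded:
  fixes T :: "(real ^ 'n \<Rightarrow> 'b::real_normed_vector) \<Rightarrow> real"
  assumes T: "distribution T"
  shows "dist_bounded T"
proof -
  have sc: "T (\<lambda>x. c *\<^sub>R \<theta> x) = c * T \<theta>" if "\<theta> \<in> test_functions" for c \<theta>
    using T that by (simp add: distribution_def)
  have T0: "T (\<lambda>x. 0) = 0"
    using sc[of "\<lambda>x. 0" 0] test_zero test_functions_in_subset by force
  have "\<exists>N C. \<forall>\<theta>\<in>test_functions_in (cball 0 \<rho>). \<forall>B\<ge>0. derivs_le N B \<theta> \<longrightarrow> \<bar>T \<theta>\<bar> \<le> C * B"
    if \<rho>: "0 < \<rho>" for \<rho>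
  proof -
    let ?K = "cball 0 \<rho> :: (real ^ 'n) set"
    have "continuous_map (test_topology ?K) euclideanreal T" using T by (simp add: distribution_def)
    then have "openin (test_topology ?K) {\<theta> \<in> topspace (test_topology ?K). T \<theta> \<in> {-1<..<1}}"
      by (rule openin_continuous_map_preimage) auto
    then have "openin (test_topology ?K) {\<theta> \<in> test_functions_in ?K. T \<theta> \<in> {-1<..<1}}"
      using \<rho> by (simp add: topspace_test_topology)
    moreover have "(\<lambda>x. 0) \<in> {\<theta> \<in> test_functions_in ?K. T \<theta> \<in> {-1<..<1}}"
      using T0 test_zero by simp
    ultimately have "\<exists>N. \<exists>\<delta>>0. \<forall>\<eta>\<in>test_functions_in ?K. derivs_le N \<delta> \<eta>
        \<longrightarrow> \<eta> \<in> {\<theta> \<in> test_functions_in ?K. T \<theta> \<in> {-1<..<1}}"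
      using \<rho> by (intro test_topology_nbhd_zero) auto
    then obtain N \<delta> where \<delta>: "\<delta> > 0"
      and small: "\<And>\<eta>. \<eta> \<in> test_functions_in ?K \<Longrightarrow> derivs_le N \<delta> \<eta> \<Longrightarrow> T \<eta> \<in> {-1<..<1}"
      by blast
    have "\<bar>T \<theta>\<bar> \<le> inverse \<delta> * B" if t: "\<theta> \<in> test_functions_in ?K" and B: "0 \<le> B" "derivs_le N B \<theta>" for \<theta> B
    proof (cases "B = 0")
      case True
      then have "norm (Dmult \<theta> [] x) \<le> 0" for x using derivs_leD[OF B(2), of "[]"] by simp
      then have "\<theta> = (\<lambda>x. 0)" by (simp add: fun_eq_iff)
      then show ?thesis using T0 True by simp
    next
      case False
      have st: "\<theta> \<in> test_functions" "smooth \<theta>" using t by (auto simp: test_functions_in_def test_functions_def)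
      have "derivs_le N \<delta> (\<lambda>x. (\<delta> / B) *\<^sub>R \<theta> x)"
        unfolding derivs_le_def Dmult_scaleR[OF st(2)]
      proof safe
        fix vs :: "(real ^ 'n) list" and x assume "length vs \<le> N" "\<forall>v\<in>set vs. norm v \<le> 1"
        then have "norm (Dmult \<theta> vs x) \<le> B" by (rule derivs_leD[OF B(2)])
        then have "(\<delta> / B) * norm (Dmult \<theta> vs x) \<le> (\<delta> / B) * B" using \<delta> B by (intro mult_left_mono) auto
        then show "norm ((\<delta> / B) *\<^sub>R Dmult \<theta> vs x) \<le> \<delta>" using \<delta> B False by simp
      qed
      then have "T (\<lambda>x. (\<delta> / B) *\<^sub>R \<theta> x) \<in> {-1<..<1}"
        by (intro small test_in_scaleR_const t) auto
      then have "\<bar>(\<delta> / B) * T \<theta>\<bar> \<le> 1" unfolding sc[OF st(1)] by auto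
      then show ?thesis using \<delta> B False by (simp add: abs_mult field_simps)
    qed
    then show ?thesis by blast
  qed
  then show ?thesis using T unfolding dist_bounded_def distribution_def by blast
qed

lemma dist_bounded_Dmult:
  fixes S :: "(real ^ 'n \<Rightarrow> 'b::real_normed_vector) \<Rightarrow> real"
  assumes S: "dist_bounded S" and ws: "\<forall>w\<in>set ws. norm w \<le> 1"
  shows "dist_bounded (\<lambda>\<theta>. c * S (Dmult \<theta> ws))"
  unfolding dist_bounded_def
proof (intro conjI ballI allI impI)
  fix \<theta> \<eta> :: "real ^ 'n \<Rightarrow> 'b" assume "\<theta> \<in> test_functions" "\<eta> \<in> test_functions"
  then show "c * S (Dmult (\<lambda>x. \<theta> x + \<eta> x) ws) = c * S (Dmult \<theta> ws) + c * S (Dmult \<eta> ws)"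
    by (simp add: Dmult_add test_functions_smooth dist_bounded_add[OF S] test_Dmult distrib_left)
next
  fix b and \<theta> :: "real ^ 'n \<Rightarrow> 'b" assume "\<theta> \<in> test_functions"
  then show "c * S (Dmult (\<lambda>x. b *\<^sub>R \<theta> x) ws) = b * (c * S (Dmult \<theta> ws))"
    by (simp add: Dmult_scaleR test_functions_smooth dist_bounded_scaleR[OF S] test_Dmult)
next
  fix \<rho> :: real assume "0 < \<rho>"
  then obtain N C where NC: "\<And>\<theta> B. \<theta> \<in> test_functions_in (cball 0 \<rho>) \<Longrightarrow> 0 \<le> B \<Longrightarrow> derivs_le N B \<theta> \<Longrightarrow> \<bar>S \<theta>\<bar> \<le> C * B"
    using S unfolding dist_bounded_def by meson
  show "\<exists>N C. \<forall>\<theta>\<in>test_functions_in (cball 0 \<rho>). \<forall>B\<ge>0. derivs_le N B \<theta> \<longrightarrow> \<bar>c * S (Dmult \<theta> ws)\<bar> \<le> C * B"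
  proof (intro exI[of _ "N + length ws"] exI[of _ "\<bar>c\<bar> * C"] ballI allI impI)
    fix \<theta> :: "real ^ 'n \<Rightarrow> 'b" and B :: real
    assume t: "\<theta> \<in> test_functions_in (cball 0 \<rho>)" and B: "0 \<le> B" "derivs_le (N + length ws) B \<theta>"
    have "derivs_le N B (Dmult \<theta> ws)"
      unfolding derivs_le_def Dmult_append[symmetric]
      by (intro allI impI derivs_leD[OF B(2)]) (use ws in auto)
    then have "\<bar>S (Dmult \<theta> ws)\<bar> \<le> C * B" using NC[OF test_in_Dmult[OF _ t]] B by simp
    then show "\<bar>c * S (Dmult \<theta> ws)\<bar> \<le> \<bar>c\<bar> * C * B"
      by (simp add: abs_mult mult.assoc mult_left_mono)
  qed
qed

section \<open>Dilations and the Euler operator\<close>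

text \<open>\<open>T\<^sup>a\<^sup>,\<^sup>t(\<theta>) = T(dilate a t \<theta>)\<close>.\<close>
definition dilate :: "real ^ 'n \<Rightarrow> real \<Rightarrow> (real ^ 'n \<Rightarrow> 'b::real_normed_vector) \<Rightarrow> real ^ 'n \<Rightarrow> 'b" where
  "dilate a t \<theta> x = inverse t ^ CARD('n) *\<^sub>R \<theta> (inverse t *\<^sub>R (x - a))"

definition times_coord :: "'n \<Rightarrow> (real ^ 'n \<Rightarrow> 'b::real_normed_vector) \<Rightarrow> real ^ 'n \<Rightarrow> 'b" where
  "times_coord j \<theta> x = x $ j *\<^sub>R \<theta> x"

text \<open>The divergence of \<open>x \<theta>(x)\<close>. Up to the factor \<open>- 1/t\<close> it generates the dilations, and in this form it is
  a sum of derivatives, which a distribution turns into its own derivatives.\<close>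
definition euler :: "(real ^ 'n \<Rightarrow> 'b::real_normed_vector) \<Rightarrow> real ^ 'n \<Rightarrow> 'b" where
  "euler \<theta> x = (\<Sum>j\<in>UNIV. dir_deriv (axis j 1) (times_coord j \<theta>) x)"

lemma smooth_dilate: "smooth \<theta> \<Longrightarrow> smooth (dilate a t \<theta>)"
  unfolding dilate_def[abs_def] by (intro smooth_scaleR_const smooth_scaleR_comp)

lemma smooth_times_coord: "smooth \<theta> \<Longrightarrow> smooth (times_coord j \<theta>)"
  unfolding times_coord_def[abs_def] by (intro smooth_scaleR smooth_component)

lemma test_in_times_coord: "\<theta> \<in> test_functions_in (cball 0 \<rho>) \<Longrightarrow> times_coord j \<theta> \<in> test_functions_in (cball 0 \<rho>)"
  using smooth_times_coord[of \<theta> j] by (auto simp: test_functions_in_cball_iff times_coord_def)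

lemma test_times_coord: "\<theta> \<in> test_functions \<Longrightarrow> times_coord j \<theta> \<in> test_functions"
  unfolding times_coord_def[abs_def] by (intro test_scaleR smooth_component)

lemma test_euler: "\<theta> \<in> test_functions \<Longrightarrow> euler \<theta> \<in> test_functions"
  unfolding euler_def[abs_def] by (intro test_sum test_dir_deriv test_times_coord)

lemma dilate_test_in:
  assumes "0 < t" "t \<le> T" "0 < \<rho>" "\<theta> \<in> test_functions_in (cball 0 \<rho>)"
  shows "dilate a t \<theta> \<in> test_functions_in (cball 0 (norm a + T * \<rho>))"
proof -
  have "\<theta> (inverse t *\<^sub>R (x - a)) = 0" if "norm a + T * \<rho> < norm x" for x
  proof -
    have "t * \<rho> \<le> T * \<rho>" using assms by (intro mult_right_mono) auto
    then have "t * \<rho> < norm (x - a)" using that norm_triangle_ineq2[of x a] by linarith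
    then have "\<rho> < norm (inverse t *\<^sub>R (x - a))" 
      using assms(1) unfolding norm_scaleR by (simp add: field_simps)
    then show ?thesis using assms(4) by (simp add: test_functions_in_cball_iff)
  qed
  then show ?thesis
    using assms(4) by (simp add: test_functions_in_cball_iff smooth_dilate) (simp add: dilate_def)
qed

lemma dilate_test:
  assumes "0 < t" "\<theta> \<in> test_functions"
  shows "dilate a t \<theta> \<in> test_functions"
  using test_functionsE[OF assms(2)] dilate_test_in[OF assms(1) order_refl] test_functions_in_subset
  by (metis subsetD)

lemma dilate_dilate: "dilate a s (dilate 0 t \<theta>) = dilate a (s * t) \<theta>"
  by (simp add: fun_eq_iff dilate_def power_mult_distrib mult.commute)

lemma dilate_add: "dilate a t (\<lambda>x. f x + g x) = (\<lambda>x. dilate a t f x + dilate a t g x)"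
  by (simp add: dilate_def fun_eq_iff scaleR_add_right)

lemma dilate_scaleR: "dilate a t (\<lambda>x. c *\<^sub>R f x) = (\<lambda>x. c *\<^sub>R dilate a t f x)"
  by (simp add: dilate_def fun_eq_iff)

lemma dilate_sum: "dilate a t (\<lambda>x. \<Sum>j\<in>J. f j x) = (\<lambda>x. \<Sum>j\<in>J. dilate a t (f j) x)"
  by (simp add: dilate_def fun_eq_iff scaleR_sum_right)

lemma Dmult_dilate:
  fixes \<theta> :: "real ^ 'n \<Rightarrow> 'b::real_normed_vector"
  assumes "smooth \<theta>"
  shows "Dmult (dilate a t \<theta>) vs x =
    inverse t ^ (CARD('n) + length vs) *\<^sub>R Dmult \<theta> vs (inverse t *\<^sub>R (x - a))"
proof (induction vs arbitrary: x)
  case (Cons v vs)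
  let ?m = "CARD('n) + length vs"
  let ?\<phi> = "Dmult \<theta> vs"
  have s: "smooth ?\<phi>" by (rule smooth_Dmult[OF assms])
  have "Dmult (dilate a t \<theta>) (v # vs) = dir_deriv v (\<lambda>x. inverse t ^ ?m *\<^sub>R ?\<phi> (inverse t *\<^sub>R (x - a)))"
    unfolding Dmult_Cons using Cons by presburger
  also have "\<dots> = (\<lambda>x. inverse t ^ ?m *\<^sub>R dir_deriv v (\<lambda>x. ?\<phi> (inverse t *\<^sub>R (x - a))) x)"
    by (intro dir_deriv_linear_comp[OF bounded_linear_scaleR_right] smooth_differentiable smooth_scaleR_comp s)
  also have "(\<lambda>x. ?\<phi> (inverse t *\<^sub>R (x - a))) = (\<lambda>x. ?\<phi> (inverse t *\<^sub>R x + - inverse t *\<^sub>R a))"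
    by (simp add: algebra_simps)
  also have "dir_deriv v \<dots> = (\<lambda>x. dir_deriv (inverse t *\<^sub>R v) ?\<phi> (inverse t *\<^sub>R x + - inverse t *\<^sub>R a))"
    by (intro dir_deriv_affine bounded_linear_scaleR_right smooth_differentiable s)
  finally show ?case
    by (simp add: dir_deriv_scaleR_arg[OF s] Dmult_Cons algebra_simps del: Dmult.simps(2))
qed (simp add: dilate_def)

lemma dir_deriv_dilate:
  assumes "smooth \<theta>"
  shows "dir_deriv v (dilate a t \<theta>) = (\<lambda>x. inverse t *\<^sub>R dilate a t (dir_deriv v \<theta>) x)"
  using Dmult_dilate[OF assms, of a t "[v]"]
  by (simp add: fun_eq_iff dir_deriv_def dilate_def mult.commute)

lemma dir_deriv_component: "dir_deriv v (\<lambda>x :: real ^ 'n. x $ j) = (\<lambda>x. v $ j)"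
  by (rule dir_deriv_eqI) (intro bounded_linear_imp_has_derivative bounded_linear_vec_nth)

lemma dir_deriv_times_coord:
  assumes "smooth \<theta>"
  shows "dir_deriv v (times_coord j \<theta>) = (\<lambda>x. x $ j *\<^sub>R dir_deriv v \<theta> x + v $ j *\<^sub>R \<theta> x)"
  unfolding times_coord_def[abs_def]
  using bounded_bilinear.dir_deriv_prod[OF bounded_bilinear_scaleR,
      OF smooth_differentiable[OF smooth_component] smooth_differentiable[OF assms], of v j]
  by (simp add: dir_deriv_component)

lemma dir_deriv_sum:
  assumes "\<And>j. j \<in> J \<Longrightarrow> smooth (f j)"
  shows "dir_deriv v (\<lambda>x. \<Sum>j\<in>J. f j x) = (\<lambda>x. \<Sum>j\<in>J. dir_deriv v (f j) x)"
  using Dmult_sum[OF assms, where vs = "[v]"] by (simp add: dir_deriv_def)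

text \<open>The homogeneity degree is raised by one with every derivative. Together with the chain rule for the
  explicit formula \<open>Dmult_dilate\<close> this shows that \<open>- 1/t\<close> times the dilated Euler derivative is the
  \<open>t\<close>-derivative of the dilation, derivative by derivative.\<close>
lemma Dmult_euler:
  fixes \<theta> :: "real ^ 'n \<Rightarrow> 'b::real_normed_vector"
  assumes "smooth \<theta>"
  shows "Dmult (euler \<theta>) vs x = real (CARD('n) + length vs) *\<^sub>R Dmult \<theta> vs x + dir_deriv x (Dmult \<theta> vs) x"
proof (induction vs arbitrary: x)
  case Nil
  have "euler \<theta> x = (\<Sum>j\<in>UNIV. x $ j *\<^sub>R dir_deriv (axis j 1) \<theta> x + \<theta> x)"
    unfolding euler_def by (simp add: dir_deriv_times_coord[OF assms])
  then show ?case
    by (simp add: sum.distrib dir_deriv_coords[OF assms, of x x] scaleR_conv_of_real[symmetric] sum_constant_scaleR add.commute)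
next
  case (Cons v vs)
  let ?\<phi> = "Dmult \<theta> vs" and ?m = "real (CARD('n) + length vs)"
  have s: "smooth ?\<phi>" by (rule smooth_Dmult[OF assms])
  have tc: "smooth (times_coord j (dir_deriv (axis j 1) ?\<phi>))" for j
    by (intro smooth_times_coord smooth_dir_deriv s)
  have "Dmult (euler \<theta>) vs = (\<lambda>x. ?m *\<^sub>R ?\<phi> x + (\<Sum>j\<in>UNIV. times_coord j (dir_deriv (axis j 1) ?\<phi>) x))"
    using Cons by (simp add: fun_eq_iff times_coord_def dir_deriv_coords[OF s, symmetric])
  then have "Dmult (euler \<theta>) (v # vs) =
      dir_deriv v (\<lambda>x. ?m *\<^sub>R ?\<phi> x + (\<Sum>j\<in>UNIV. times_coord j (dir_deriv (axis j 1) ?\<phi>) x))"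
    by (simp only: Dmult_Cons)
  also have "\<dots> = (\<lambda>x. dir_deriv v (\<lambda>x. ?m *\<^sub>R ?\<phi> x) x
      + dir_deriv v (\<lambda>x. \<Sum>j\<in>UNIV. times_coord j (dir_deriv (axis j 1) ?\<phi>) x) x)"
    by (intro dir_deriv_add smooth_differentiable smooth_scaleR_const smooth_sum tc s)
  also have "\<dots> = (\<lambda>x. ?m *\<^sub>R dir_deriv v ?\<phi> x
      + (\<Sum>j\<in>UNIV. x $ j *\<^sub>R dir_deriv v (dir_deriv (axis j 1) ?\<phi>) x + v $ j *\<^sub>R dir_deriv (axis j 1) ?\<phi> x))"
    using dir_deriv_linear_comp[OF bounded_linear_scaleR_right smooth_differentiable[OF s], of v ?m]
    by (simp add: dir_deriv_sum[OF tc] dir_deriv_times_coord[OF smooth_dir_deriv[OF s]])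
  also have "\<dots> = (\<lambda>x. ?m *\<^sub>R dir_deriv v ?\<phi> x + dir_deriv x (dir_deriv v ?\<phi>) x + dir_deriv v ?\<phi> x)"
    by (simp add: fun_eq_iff sum.distrib dir_deriv_commute[OF s, of v] add.assoc
        dir_deriv_coords[OF s, symmetric] dir_deriv_coords[OF smooth_dir_deriv[OF s], symmetric])
  finally show ?case by (simp add: Dmult_Cons algebra_simps del: Dmult.simps(2))
qed

lemma dilate_has_vector_derivative:
  fixes \<theta> :: "real ^ 'n \<Rightarrow> 'b::real_normed_vector"
  assumes s: "smooth \<theta>" and t: "0 < t"
  shows "((\<lambda>t. Dmult (dilate a t \<theta>) vs x) has_vector_derivative
    - inverse t *\<^sub>R Dmult (dilate a t (euler \<theta>)) vs x) (at t)"
proof -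
  let ?m = "CARD('n) + length vs" and ?\<phi> = "Dmult \<theta> vs"
  have sp: "smooth ?\<phi>" by (rule smooth_Dmult[OF s])
  have se: "smooth (euler \<theta>)"
    unfolding euler_def[abs_def] by (intro smooth_sum smooth_dir_deriv smooth_times_coord s)
  have i: "(inverse has_real_derivative - (inverse t ^ Suc (Suc 0))) (at t)"
    using t by (intro DERIV_inverse) simp
  have p: "((\<lambda>t. inverse t ^ ?m) has_real_derivative
      real ?m * (- (inverse t ^ Suc (Suc 0)) * inverse t ^ (?m - Suc 0))) (at t)"
    by (rule DERIV_power[OF i])
  have "((\<lambda>t. inverse t *\<^sub>R (x - a)) has_vector_derivative - (inverse t ^ Suc (Suc 0)) *\<^sub>R (x - a)) (at t)"
    using has_vector_derivative_scaleR[OF i has_vector_derivative_const[of "x - a"]] by simp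
  then have "((\<lambda>t. inverse t *\<^sub>R (x - a)) has_derivative (\<lambda>h. h *\<^sub>R (- (inverse t ^ Suc (Suc 0)) *\<^sub>R (x - a)))) (at t)"
    by (simp add: has_vector_derivative_def)
  from diff_chain_at[OF this smooth_has_derivative[OF sp]]
  have q: "((\<lambda>t. ?\<phi> (inverse t *\<^sub>R (x - a))) has_vector_derivative
      (- (inverse t ^ Suc (Suc 0))) *\<^sub>R dir_deriv (x - a) ?\<phi> (inverse t *\<^sub>R (x - a))) (at t)"
    by (simp only: has_vector_derivative_def o_def dir_deriv_scaleR_arg[OF sp])
  have "?m > 0" by simp
  then have "inverse t ^ ?m = inverse t * inverse t ^ (?m - Suc 0)"
    by (metis Suc_pred power_Suc)
  then show ?thesis
    using has_vector_derivative_scaleR[OF p q]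
    unfolding Dmult_dilate[OF s] Dmult_dilate[OF se] Dmult_euler[OF s] dir_deriv_scaleR_arg[OF sp]
    by (simp add: scaleR_add_right algebra_simps)
qed

lemma vector_taylor2:
  fixes g :: "real \<Rightarrow> 'b::real_normed_vector"
  assumes g: "\<And>t. t \<in> closed_segment r s \<Longrightarrow> (g has_vector_derivative g' t) (at t)"
    and g': "\<And>t. t \<in> closed_segment r s \<Longrightarrow> (g' has_vector_derivative g'' t) (at t)"
    and M: "\<And>t. t \<in> closed_segment r s \<Longrightarrow> norm (g'' t) \<le> M"
  shows "norm (g s - g r - (s - r) *\<^sub>R g' r) \<le> M * (s - r)\<^sup>2"
proof -
  have "norm (g s - g r - (s - r) *\<^sub>R g' r) \<le> norm (s - r) * (M * norm (s - r))"
  proof (rule vector_differentiable_bound_linearization[of "closed_segment r s" g g'])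
    fix t assume t: "t \<in> closed_segment r s"
    show "(g has_vector_derivative g' t) (at t within closed_segment r s)"
      using g[OF t] by (rule has_vector_derivative_at_within)
    have "norm (g' t - g' r) \<le> M * norm (t - r)"
    proof (rule differentiable_bound[of "closed_segment r s" g' "\<lambda>t h. h *\<^sub>R g'' t"])
      fix u assume u: "u \<in> closed_segment r s"
      show "(g' has_derivative (\<lambda>h. h *\<^sub>R g'' u)) (at u within closed_segment r s)"
        using g'[OF u] unfolding has_vector_derivative_def by (rule has_derivative_at_withinI)
      show "onorm (\<lambda>h. h *\<^sub>R g'' u) \<le> M"
        using M[OF u] by (intro onorm_le) (auto simp: mult.commute[of M] intro!: mult_left_mono)
    qed (use t in auto)
    also have "\<dots> \<le> M * norm (s - r)"
    proof -
      have "0 \<le> M" using M[OF t] norm_ge_zero order_trans by blast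
      moreover have "norm (t - r) \<le> norm (s - r)"
        using t by (auto simp: closed_segment_eq_real_ivl split: if_splits)
      ultimately show ?thesis by (rule mult_left_mono[rotated])
    qed
    finally show "norm (g' t - g' r) \<le> M * norm (s - r)" .
  qed auto
  also have "norm (s - r) * (M * norm (s - r)) = M * (norm (s - r) * norm (s - r))"
    by (rule mult.left_commute)
  also have "\<dots> = M * (s - r)\<^sup>2" by (simp add: power2_eq_square)
  finally show ?thesis .
qed

lemma quadratic_remainder_imp_DERIV:
  fixes f :: "real \<Rightarrow> real"
  assumes "0 < d" and f: "\<And>s. \<bar>s - r\<bar> < d \<Longrightarrow> \<bar>f s - f r - (s - r) * D\<bar> \<le> M * (s - r)\<^sup>2"
  shows "(f has_real_derivative D) (at r)"
proof -
  have "((\<lambda>h. (f (r + h) - f r) / h - D) \<longlongrightarrow> 0) (at 0)"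
  proof (rule Lim_null_comparison)
    show "\<forall>\<^sub>F h in at 0. norm ((f (r + h) - f r) / h - D) \<le> M * \<bar>h\<bar>"
      unfolding eventually_at
    proof (intro exI[of _ d] conjI ballI impI)
      fix h :: real assume h: "h \<noteq> 0 \<and> dist h 0 < d"
      have "\<bar>f (r + h) - f r - h * D\<bar> \<le> M * h\<^sup>2" using f[of "r + h"] h by simp
      then have "\<bar>f (r + h) - f r - h * D\<bar> / \<bar>h\<bar> \<le> M * h\<^sup>2 / \<bar>h\<bar>" by (rule divide_right_mono) simp
      moreover have "(f (r + h) - f r) / h - D = (f (r + h) - f r - h * D) / h"
        using h by (simp add: field_simps)
      moreover have "M * h\<^sup>2 / \<bar>h\<bar> = M * \<bar>h\<bar>"
        using h by (cases "h > 0") (auto simp: power2_eq_square)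
      ultimately show "norm ((f (r + h) - f r) / h - D) \<le> M * \<bar>h\<bar>" by simp
    qed (use assms in auto)
    show "((\<lambda>h. M * \<bar>h\<bar>) \<longlongrightarrow> 0) (at 0)" by (auto intro!: tendsto_eq_intros)
  qed
  then show ?thesis by (simp add: DERIV_def LIM_zero_iff)
qed

text \<open>By continuity of \<open>S\<close> it suffices that the difference quotients of \<open>t \<mapsto> dilate a t \<theta>\<close> converge with all
  their derivatives, uniformly in the point. The remainder is quadratic because the second derivative
  in \<open>t\<close> involves only dilations of \<open>euler \<theta>\<close> and \<open>euler (euler \<theta>)\<close>.\<close>
lemma dist_bounded_dilate_DERIV:
  fixes \<theta> :: "real ^ 'n \<Rightarrow> 'b::real_normed_vector"
  assumes S: "dist_bounded S" and \<theta>: "\<theta> \<in> test_functions" and r: "0 < r"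
  shows "((\<lambda>t. S (dilate a t \<theta>)) has_real_derivative - inverse r * S (dilate a r (euler \<theta>))) (at r)"
proof -
  let ?E = "euler \<theta>" and ?I = "max (2 * inverse r) 1"
  obtain \<rho> where \<rho>: "0 < \<rho>" "\<theta> \<in> test_functions_in (cball 0 \<rho>)" using test_functionsE[OF \<theta>] .
  have E: "?E \<in> test_functions" "euler ?E \<in> test_functions" using \<theta> by (simp_all add: test_euler)
  note sm = test_functions_smooth[OF \<theta>] test_functions_smooth[OF E(1)] test_functions_smooth[OF E(2)]
  have E\<rho>: "?E \<in> test_functions_in (cball 0 \<rho>)"
  proof -
    have "?E x = 0" if "\<rho> < norm x" for x
      unfolding euler_def
      using test_in_dir_deriv[OF compact_cball test_in_times_coord[OF \<rho>(2)]] that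
      by (intro sum.neutral) (auto simp: test_functions_in_cball_iff)
    then show ?thesis using sm(2) by (simp add: test_functions_in_cball_iff)
  qed
  define R where "R = norm a + 2 * r * \<rho>"
  have "0 < R" using r \<rho> by (simp add: R_def add_nonneg_pos)
  then obtain N C where NC: "\<And>\<theta> B. \<theta> \<in> test_functions_in (cball 0 R) \<Longrightarrow> 0 \<le> B \<Longrightarrow> derivs_le N B \<theta> \<Longrightarrow> \<bar>S \<theta>\<bar> \<le> C * B"
    using S unfolding dist_bounded_def by meson
  obtain B1 where B1: "0 \<le> B1" "derivs_le N B1 ?E" using test_derivs_le[OF E(1)] by blast
  obtain B2 where B2: "0 \<le> B2" "derivs_le N B2 (euler ?E)" using test_derivs_le[OF E(2)] by blast
  define M where "M = ?I ^ (2 + (CARD('n) + N)) * (B1 + B2)"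
  have M: "0 \<le> M" using B1 B2 by (simp add: M_def)
  show ?thesis
  proof (rule quadratic_remainder_imp_DERIV[where d = "r / 2" and M = "C * M"])
    fix s assume s: "\<bar>s - r\<bar> < r / 2"
    have seg: "r / 2 < t" "t < 2 * r" if "t \<in> closed_segment r s" for t
      using that s r by (auto simp: closed_segment_eq_real_ivl abs_if split: if_splits)
    have s': "0 < s" "s < 2 * r" using s r by (auto simp: abs_if split: if_splits)
    let ?\<Delta> = "\<lambda>x. dilate a s \<theta> x + ((- 1) *\<^sub>R dilate a r \<theta> x + ((s - r) * inverse r) *\<^sub>R dilate a r ?E x)"
    have tr: "dilate a s \<theta> \<in> test_functions_in (cball 0 R)" "dilate a r \<theta> \<in> test_functions_in (cball 0 R)"
      "dilate a r ?E \<in> test_functions_in (cball 0 R)"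
      unfolding R_def using r s' \<rho> E\<rho> by (auto intro!: dilate_test_in simp: mult.assoc[symmetric])
    have D: "?\<Delta> \<in> test_functions_in (cball 0 R)"
      by (intro test_in_add test_in_scaleR_const tr compact_cball)
    have "derivs_le N (M * (s - r)\<^sup>2) ?\<Delta>"
      unfolding derivs_le_def
    proof (intro allI impI)
      fix vs :: "(real ^ 'n) list" and x assume vs: "length vs \<le> N" "\<forall>v\<in>set vs. norm v \<le> 1"
      let ?g = "\<lambda>t. Dmult (dilate a t \<theta>) vs x"
      let ?g1 = "\<lambda>t. - inverse t *\<^sub>R Dmult (dilate a t ?E) vs x"
      let ?g2 = "\<lambda>t. - inverse t *\<^sub>R (- inverse t *\<^sub>R Dmult (dilate a t (euler ?E)) vs x)
        + inverse t ^ Suc (Suc 0) *\<^sub>R Dmult (dilate a t ?E) vs x"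
      have "norm (?g s - ?g r - (s - r) *\<^sub>R ?g1 r) \<le> M * (s - r)\<^sup>2"
      proof (rule vector_taylor2[where g'' = ?g2])
        fix t assume t: "t \<in> closed_segment r s"
        then have t0: "0 < t" "r / 2 < t" using seg[OF t] r by auto
        show "(?g has_vector_derivative ?g1 t) (at t)" by (rule dilate_has_vector_derivative[OF sm(1) t0(1)])
        have "((\<lambda>t. - inverse t) has_real_derivative inverse t ^ Suc (Suc 0)) (at t)"
          using DERIV_minus[OF DERIV_inverse, of t UNIV] t0 by simp
        from has_vector_derivative_scaleR[OF this dilate_has_vector_derivative[OF sm(2) t0(1), of a vs x]]
        show "(?g1 has_vector_derivative ?g2 t) (at t)" .
        have it: "inverse t \<le> 2 * inverse r" "0 < inverse t"
          using t0 r by (auto simp: field_simps)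
        let ?k = "CARD('n) + length vs"
        \<comment> \<open>\<open>?I\<close> is at least \<open>1\<close>, so that its powers are bounded by the one of highest order\<close>
        have pw: "inverse t ^ (2 + ?k) \<le> ?I ^ (2 + (CARD('n) + N))"
        proof -
          have "inverse t ^ (2 + ?k) \<le> ?I ^ (2 + ?k)" using it by (intro power_mono) auto
          also have "\<dots> \<le> ?I ^ (2 + (CARD('n) + N))" using vs by (intro power_increasing) auto
          finally show ?thesis .
        qed
        have "?g2 t = inverse t ^ (2 + ?k) *\<^sub>R
            (Dmult (euler ?E) vs (inverse t *\<^sub>R (x - a)) + Dmult ?E vs (inverse t *\<^sub>R (x - a)))"
          by (simp add: Dmult_dilate sm scaleR_add_right power_add mult.assoc)
        then have "norm (?g2 t) \<le> inverse t ^ (2 + ?k) *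
            (norm (Dmult (euler ?E) vs (inverse t *\<^sub>R (x - a))) + norm (Dmult ?E vs (inverse t *\<^sub>R (x - a))))"
          using it by (simp only: norm_scaleR) (intro mult_mono norm_triangle_ineq, auto)
        also have "\<dots> \<le> ?I ^ (2 + (CARD('n) + N)) * (B2 + B1)"
          using it by (intro mult_mono pw add_mono derivs_leD[OF B2(2)] derivs_leD[OF B1(2)] vs) auto
        finally show "norm (?g2 t) \<le> M" by (simp add: M_def add.commute)
      qed
      moreover have "Dmult ?\<Delta> vs x = ?g s + ((- 1) *\<^sub>R ?g r + ((s - r) * inverse r) *\<^sub>R Dmult (dilate a r ?E) vs x)"
        by (simp only: Dmult_add Dmult_scaleR smooth_dilate sm smooth_add smooth_scaleR_const)
      then have "Dmult ?\<Delta> vs x = ?g s - ?g r - (s - r) *\<^sub>R ?g1 r" by (simp add: algebra_simps)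
      ultimately show "norm (Dmult ?\<Delta> vs x) \<le> M * (s - r)\<^sup>2" by simp
    qed
    then have "\<bar>S ?\<Delta>\<bar> \<le> C * (M * (s - r)\<^sup>2)" using NC[OF D] M by simp
    moreover have "S ?\<Delta> = S (dilate a s \<theta>) + ((- 1) * S (dilate a r \<theta>) + ((s - r) * inverse r) * S (dilate a r ?E))"
      using r s' by (simp only: dist_bounded_add[OF S] dist_bounded_scaleR[OF S] dilate_test \<theta> E test_add test_scaleR_const)
    ultimately show "\<bar>S (dilate a s \<theta>) - S (dilate a r \<theta>) - (s - r) * (- inverse r * S (dilate a r ?E))\<bar>
        \<le> C * M * (s - r)\<^sup>2"
      by (simp add: algebra_simps)
  qed (use r in simp)
qed

section \<open>Polynomial functions\<close>

text \<open>Polynomial functions of degree at most \<open>d\<close>, built from constants by sums and multiplication with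
  coordinates. Statements that are linear in the polynomial and compatible with one coordinate factor
  can be proved by induction; the multilinear forms appear only in the translation from and to
  \<^const>\<open>poly_fun\<close>.\<close>
inductive polyf :: "nat \<Rightarrow> (real ^ 'n \<Rightarrow> 'b::real_vector) \<Rightarrow> bool" where
  const: "polyf d (\<lambda>_. c)"
| add: "polyf d f \<Longrightarrow> polyf d g \<Longrightarrow> polyf d (\<lambda>x. f x + g x)"
| coord: "polyf d f \<Longrightarrow> polyf (Suc d) (\<lambda>x. x $ j *\<^sub>R f x)"

lemma polyf_Suc: "polyf d f \<Longrightarrow> polyf (Suc d) f"
  by (induction rule: polyf.induct) (auto intro: polyf.intros)

lemma polyf_mono: "d \<le> e \<Longrightarrow> polyf d f \<Longrightarrow> polyf e f"
  by (induction e rule: dec_induct) (auto intro: polyf_Suc)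

lemma polyf_scaleR: "polyf d f \<Longrightarrow> polyf d (\<lambda>x. c *\<^sub>R f x)"
proof (induction rule: polyf.induct)
  case (coord d f j)
  then show ?case using polyf.coord[of d "\<lambda>x. c *\<^sub>R f x" j] by (simp add: mult.commute)
qed (auto simp: scaleR_add_right intro: polyf.intros)

lemma polyf_sum: "(\<And>j. j \<in> J \<Longrightarrow> polyf d (f j)) \<Longrightarrow> polyf d (\<lambda>x. \<Sum>j\<in>J. f j x)"
  by (induction J rule: infinite_finite_induct) (auto intro: polyf.intros)

lemma polyf_translate: "polyf d f \<Longrightarrow> polyf d (\<lambda>x. f (b + x))"
proof (induction rule: polyf.induct)
  case (coord d f j)
  have "polyf (Suc d) (\<lambda>x. b $ j *\<^sub>R f (b + x) + x $ j *\<^sub>R f (b + x))"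
    using coord by (intro polyf.add polyf.coord polyf_Suc polyf_scaleR)
  then show ?case by (simp add: scaleR_add_left)
qed (auto intro: polyf.intros)

lemma polyf_continuous:
  fixes f :: "real ^ 'n \<Rightarrow> 'b::real_normed_vector"
  shows "polyf d f \<Longrightarrow> continuous_on A f"
  by (induction rule: polyf.induct) (auto intro!: continuous_intros)

text \<open>Multilinear expansion: all but the first \<open>l\<close> slots carry fixed vectors.\<close>

lemma multilinear_polyf:
  fixes \<psi> :: "(real ^ 'n) list \<Rightarrow> 'b::real_vector"
  assumes lin: "\<And>vs i. length vs = m \<Longrightarrow> i < m \<Longrightarrow> linear (\<lambda>v. \<psi> (vs[i := v]))"
  shows "l + length bs = m \<Longrightarrow> polyf l (\<lambda>x. \<psi> (replicate l x @ bs))"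
proof (induction l arbitrary: bs)
  case 0
  then show ?case by (simp add: polyf.const)
next
  case (Suc l)
  have "\<psi> (replicate (Suc l) x @ bs) = (\<Sum>j\<in>UNIV. x $ j *\<^sub>R \<psi> (replicate l x @ axis j 1 # bs))" for x
  proof -
    let ?h = "\<lambda>v. \<psi> ((replicate l x @ 0 # bs)[l := v])"
    have h: "linear ?h" using Suc.prems by (intro lin) auto
    have e: "?h v = \<psi> (replicate l x @ v # bs)" for v by (simp add: list_update_append)
    have "\<psi> (replicate (Suc l) x @ bs) = ?h x"
      by (simp add: e replicate_app_Cons_same)
    also have "\<dots> = ?h (\<Sum>j\<in>UNIV. x $ j *\<^sub>R axis j 1)"
      by (rule arg_cong[where f = ?h]) (rule vec_eq_sum_axis)
    also have "\<dots> = (\<Sum>j\<in>UNIV. ?h (x $ j *\<^sub>R axis j 1))" by (rule linear_sum[OF h])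
    also have "\<dots> = (\<Sum>j\<in>UNIV. x $ j *\<^sub>R ?h (axis j 1))" by (simp only: linear_scale[OF h])
    finally show ?thesis by (simp only: e)
  qed
  moreover have "polyf (Suc l) (\<lambda>x. \<Sum>j\<in>UNIV. x $ j *\<^sub>R \<psi> (replicate l x @ axis j 1 # bs))"
    using Suc.prems by (intro polyf_sum polyf.coord Suc.IH) simp
  ultimately show ?case by simp
qed

lemma poly_fun_imp_polyf:
  fixes P :: "real ^ 'n \<Rightarrow> 'b::real_vector"
  assumes "poly_fun (int d) P"
  shows "polyf d P"
proof -
  obtain \<psi> where \<psi>: "\<And>m. int m \<le> int d \<Longrightarrow> sym_multilinear m (\<psi> m)"
    and P: "\<And>x. P x = (\<Sum>m | int m \<le> int d. \<psi> m (replicate m x))"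
    using assms unfolding poly_fun_def by blast
  have "polyf d (\<lambda>x. \<psi> m (replicate m x))" if "m \<le> d" for m
    using multilinear_polyf[of m "\<psi> m" m "[]"] \<psi>[of m] that
    by (intro polyf_mono[OF that]) (auto simp: sym_multilinear_def)
  then have "polyf d (\<lambda>x. \<Sum>m | int m \<le> int d. \<psi> m (replicate m x))"
    by (intro polyf_sum) auto
  moreover have "P = (\<lambda>x. \<Sum>m | int m \<le> int d. \<psi> m (replicate m x))" using P by (rule ext)
  ultimately show ?thesis by simp
qed

text \<open>The product of a coordinate with a symmetric multilinear form, symmetrised.\<close>

definition sym_coord_mult :: "'n \<Rightarrow> nat \<Rightarrow> ((real ^ 'n) list \<Rightarrow> 'b::real_vector) \<Rightarrow> (real ^ 'n) list \<Rightarrow> 'b" where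
  "sym_coord_mult j m \<psi> vs =
     inverse (real (Suc m)) *\<^sub>R (\<Sum>l<Suc m. (vs ! l) $ j *\<^sub>R \<psi> (take l vs @ drop (Suc l) vs))"

lemma mset_take_drop_remove1:
  assumes "l < length us"
  shows "mset (take l us @ drop (Suc l) us) = mset (remove1 (us ! l) us)"
proof -
  have "us = take l us @ us ! l # drop (Suc l) us"
    using assms by (intro id_take_nth_drop) simp
  then have "mset us = mset (take l us @ us ! l # drop (Suc l) us)" by (rule arg_cong)
  then show ?thesis by simp
qed

lemma linear_scaleR_comp:
  assumes "linear f"
  shows "linear (\<lambda>x. c *\<^sub>R f x)"
  by (rule linearI) (simp_all add: linear_add[OF assms] linear_scale[OF assms] scaleR_add_right)

lemma linear_coord_mult_slot:
  fixes \<psi> :: "(real ^ 'n) list \<Rightarrow> 'b::real_vector"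
  assumes lin: "\<And>vs i. length vs = m \<Longrightarrow> i < m \<Longrightarrow> linear (\<lambda>v. \<psi> (vs[i := v]))"
    and vs: "length vs = Suc m" "i < Suc m" and l: "l < Suc m"
  shows "linear (\<lambda>v. (vs[i := v] ! l) $ j *\<^sub>R \<psi> (take l (vs[i := v]) @ drop (Suc l) (vs[i := v])))"
proof -
  consider "l = i" | "i < l" | "l < i" by linarith
  then show ?thesis
  proof cases
    case 1
    have "(\<lambda>v. (vs[i := v] ! l) $ j *\<^sub>R \<psi> (take l (vs[i := v]) @ drop (Suc l) (vs[i := v])))
        = (\<lambda>v. v $ j *\<^sub>R \<psi> (take i vs @ drop (Suc i) vs))"
      using 1 vs by simp
    moreover have "linear \<dots>" by (rule linearI) (simp_all add: scaleR_add_left)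
    ultimately show ?thesis by simp
  next
    case 2
    have "(\<lambda>v. (vs[i := v] ! l) $ j *\<^sub>R \<psi> (take l (vs[i := v]) @ drop (Suc l) (vs[i := v])))
        = (\<lambda>v. (vs ! l) $ j *\<^sub>R \<psi> ((take l vs @ drop (Suc l) vs)[i := v]))"
      using 2 vs l by (simp add: take_update_swap list_update_append)
    moreover have "linear \<dots>"
      using 2 vs l by (intro linear_scaleR_comp lin) auto
    ultimately show ?thesis by simp
  next
    case 3
    then have "\<not> i - 1 < l" "i - Suc l = i - 1 - l" by auto
    then have "(\<lambda>v. (vs[i := v] ! l) $ j *\<^sub>R \<psi> (take l (vs[i := v]) @ drop (Suc l) (vs[i := v])))
        = (\<lambda>v. (vs ! l) $ j *\<^sub>R \<psi> ((take l vs @ drop (Suc l) vs)[i - 1 := v]))"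
      using 3 vs l by (simp add: drop_update_swap list_update_append)
    moreover have "linear \<dots>"
      using 3 vs l by (intro linear_scaleR_comp lin) auto
    ultimately show ?thesis by simp
  qed
qed

text \<open>Symmetry becomes visible after writing the sum over the positions as a sum over the entries of the
  list, where each term depends only on the multiset of entries.\<close>
lemma sym_multilinear_coord_mult:
  fixes \<psi> :: "(real ^ 'n) list \<Rightarrow> 'b::real_vector"
  assumes "sym_multilinear m \<psi>"
  shows "sym_multilinear (Suc m) (sym_coord_mult j m \<psi>)"
proof -
  have lin: "linear (\<lambda>v. \<psi> (vs[i := v]))" if "length vs = m" "i < m" for vs i
    using assms that by (simp add: sym_multilinear_def)
  have sym: "\<psi> ws = \<psi> vs" if "length vs = m" "mset ws = mset vs" for vs ws
    using assms that unfolding sym_multilinear_def by blast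
  have "linear (\<lambda>v. sym_coord_mult j m \<psi> (vs[i := v]))" if "length vs = Suc m" "i < Suc m" for vs i
    unfolding sym_coord_mult_def
    by (intro linear_scaleR_comp linear_compose_sum ballI linear_coord_mult_slot lin) (use that in simp_all)
  moreover have "sym_coord_mult j m \<psi> ws = sym_coord_mult j m \<psi> vs"
    if vs: "length vs = Suc m" and ws: "mset ws = mset vs" for vs ws
  proof -
    have lw: "length ws = Suc m" using vs ws mset_eq_length by fastforce
    have remove: "(\<Sum>l<Suc m. (us ! l) $ j *\<^sub>R \<psi> (take l us @ drop (Suc l) us))
        = sum_list (map (\<lambda>v. v $ j *\<^sub>R \<psi> (remove1 v us)) us)" if us: "length us = Suc m" for us
    proof -
      have "\<psi> (take l us @ drop (Suc l) us) = \<psi> (remove1 (us ! l) us)" if "l < Suc m" for l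
        using that us mset_take_drop_remove1[of l us] by (intro sym) (simp_all add: length_remove1)
      then show ?thesis unfolding sum_list_sum_nth length_map us atLeast0LessThan
        by (intro sum.cong refl) (simp add: us)
    qed
    have "sum_list (map (\<lambda>v. v $ j *\<^sub>R \<psi> (remove1 v ws)) ws) = sum_list (map (\<lambda>v. v $ j *\<^sub>R \<psi> (remove1 v vs)) ws)"
    proof (intro arg_cong[where f = sum_list] map_cong refl)
      fix v assume "v \<in> set ws"
      then have "v \<in> set vs" using mset_eq_setD[OF ws] by simp
      then have "\<psi> (remove1 v ws) = \<psi> (remove1 v vs)"
        using vs ws by (intro sym) (simp_all add: length_remove1)
      then show "v $ j *\<^sub>R \<psi> (remove1 v ws) = v $ j *\<^sub>R \<psi> (remove1 v vs)" by simp
    qed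
    also have "\<dots> = sum_list (map (\<lambda>v. v $ j *\<^sub>R \<psi> (remove1 v vs)) vs)"
      unfolding sum_mset_sum_list[symmetric] mset_map ws ..
    finally show ?thesis
      unfolding sym_coord_mult_def remove[OF vs] remove[OF lw] by simp
  qed
  ultimately show ?thesis unfolding sym_multilinear_def by blast
qed

lemma sym_multilinear_add:
  assumes "sym_multilinear m \<psi>" "sym_multilinear m \<phi>"
  shows "sym_multilinear m (\<lambda>vs. \<psi> vs + \<phi> vs)"
  unfolding sym_multilinear_def
proof (intro conjI allI impI; elim conjE)
  fix vs :: "'a list" and i assume "length vs = m" "i < m"
  then show "linear (\<lambda>v. \<psi> (vs[i := v]) + \<phi> (vs[i := v]))"
    using assms by (intro linear_compose_add) (simp_all add: sym_multilinear_def)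
next
  fix vs ws :: "'a list" assume "length vs = m" "mset ws = mset vs"
  then have "\<psi> ws = \<psi> vs" "\<phi> ws = \<phi> vs" using assms unfolding sym_multilinear_def by blast+
  then show "\<psi> ws + \<phi> ws = \<psi> vs + \<phi> vs" by simp
qed

lemma sym_coord_mult_diag: "sym_coord_mult j m \<psi> (replicate (Suc m) x) = x $ j *\<^sub>R \<psi> (replicate m x)"
proof -
  have "(\<Sum>l<Suc m. (replicate (Suc m) x ! l) $ j *\<^sub>R \<psi> (take l (replicate (Suc m) x) @ drop (Suc l) (replicate (Suc m) x)))
      = (\<Sum>l<Suc m. x $ j *\<^sub>R \<psi> (replicate m x))"
  proof (intro sum.cong refl)
    fix l assume "l \<in> {..<Suc m}"
    then have l: "l < Suc m" by simp
    then have "take l (replicate (Suc m) x) @ drop (Suc l) (replicate (Suc m) x) = replicate m x"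
      by (simp add: replicate_add[symmetric] del: replicate.simps)
    then show "(replicate (Suc m) x ! l) $ j *\<^sub>R \<psi> (take l (replicate (Suc m) x) @ drop (Suc l) (replicate (Suc m) x))
        = x $ j *\<^sub>R \<psi> (replicate m x)" using l by (simp del: replicate.simps)
  qed
  then show ?thesis by (simp add: sym_coord_mult_def sum_constant_scaleR del: replicate.simps sum.lessThan_Suc)
qed

lemma polyf_imp_poly_fun:
  fixes P :: "real ^ 'n \<Rightarrow> 'b::real_vector"
  assumes "polyf d P"
  shows "poly_fun (int d) P"
proof -
  have "\<exists>\<psi>. (\<forall>m\<le>d. sym_multilinear m (\<psi> m)) \<and> (\<forall>x. P x = (\<Sum>m\<le>d. \<psi> m (replicate m x)))"
    using assms
  proof (induction rule: polyf.induct)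
    case (const d c)
    have z: "sym_multilinear m (\<lambda>_ :: (real ^ 'n) list. if m = 0 then c else 0)" for m
      by (auto simp: sym_multilinear_def linear_iff)
    then show ?case by (intro exI[of _ "\<lambda>m _. if m = 0 then c else 0"]) auto
  next
    case (add d f g)
    then obtain \<psi> \<phi> where "\<And>m. m \<le> d \<Longrightarrow> sym_multilinear m (\<psi> m)" "\<And>x. f x = (\<Sum>m\<le>d. \<psi> m (replicate m x))"
      "\<And>m. m \<le> d \<Longrightarrow> sym_multilinear m (\<phi> m)" "\<And>x. g x = (\<Sum>m\<le>d. \<phi> m (replicate m x))"
      by blast
    then show ?case
      by (intro exI[of _ "\<lambda>m vs. \<psi> m vs + \<phi> m vs"]) (simp add: sym_multilinear_add sum.distrib)
  next
    case (coord d f j)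
    then obtain \<psi> where \<psi>: "\<And>m. m \<le> d \<Longrightarrow> sym_multilinear m (\<psi> m)" "\<And>x. f x = (\<Sum>m\<le>d. \<psi> m (replicate m x))"
      by blast
    let ?\<phi> = "\<lambda>m. case m of 0 \<Rightarrow> (\<lambda>_. 0) | Suc m' \<Rightarrow> sym_coord_mult j m' (\<psi> m')"
    have "sym_multilinear m (?\<phi> m)" if "m \<le> Suc d" for m
    proof (cases m)
      case 0
      then show ?thesis by (simp add: sym_multilinear_def)
    next
      case (Suc m')
      then show ?thesis using that \<psi>(1) by (simp add: sym_multilinear_coord_mult)
    qed
    moreover have "x $ j *\<^sub>R f x = (\<Sum>m\<le>Suc d. ?\<phi> m (replicate m x))" for x
      unfolding \<psi>(2) sum.atMost_Suc_shift
      by (simp only: nat.case sym_coord_mult_diag scaleR_sum_right add_0)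
    ultimately show ?case by blast
  qed
  then obtain \<psi> where "\<forall>m\<le>d. sym_multilinear m (\<psi> m)" "\<forall>x. P x = (\<Sum>m\<le>d. \<psi> m (replicate m x))"
    by blast
  moreover have "{m. int m \<le> int d} = {..d}" by auto
  ultimately show ?thesis unfolding poly_fun_def by (intro exI[of _ \<psi>]) simp
qed

section \<open>Integrals against test functions\<close>

lemma integrable_compact_support:
  fixes h :: "'a::euclidean_space \<Rightarrow> real"
  assumes h: "continuous_on UNIV h" "\<And>x. \<rho> < norm x \<Longrightarrow> h x = 0"
  shows "integrable lborel h"
proof -
  have "integrable lborel (\<lambda>x. indicator (cball 0 \<rho>) x *\<^sub>R h x)"
    by (intro borel_integrable_compact continuous_on_subset[OF h(1)]) auto
  also have "(\<lambda>x. indicator (cball 0 \<rho>) x *\<^sub>R h x) = h"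
    using h(2) by (auto simp: fun_eq_iff indicator_def not_le)
  finally show ?thesis .
qed

lemma integrable_lebesgue_compact_support:
  fixes h :: "'a::euclidean_space \<Rightarrow> real"
  assumes h: "continuous_on UNIV h" "\<And>x. \<rho> < norm x \<Longrightarrow> h x = 0"
  shows "integrable lebesgue h"
  using integrable_compact_support[OF h] by (subst integrable_completion) auto

lemma integral_lebesgue_eq_lborel:
  fixes h :: "'a::euclidean_space \<Rightarrow> real"
  assumes "continuous_on UNIV h"
  shows "integral\<^sup>L lebesgue h = integral\<^sup>L lborel h"
  by (rule integral_completion) (use borel_measurable_continuous_onI[OF assms] in simp)

lemma lborel_integral_affine:
  fixes h :: "'a::euclidean_space \<Rightarrow> real"
  assumes c: "0 < c" and h: "h \<in> borel_measurable borel"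
  shows "integral\<^sup>L lborel h = c ^ DIM('a) * (LINT x|lborel. h (t + c *\<^sub>R x))"
proof -
  have [measurable]: "h \<in> borel_measurable borel" by (rule h)
  have "integral\<^sup>L lborel h = integral\<^sup>L (density (distr lborel borel (\<lambda>x. t + c *\<^sub>R x)) (\<lambda>_. ennreal (\<bar>c\<bar> ^ DIM('a)))) h"
    using lborel_affine[of c t] c by simp
  also have "\<dots> = integral\<^sup>L (distr lborel borel (\<lambda>x. t + c *\<^sub>R x)) (\<lambda>x. \<bar>c\<bar> ^ DIM('a) *\<^sub>R h x)"
    by (rule integral_density) auto
  also have "\<dots> = (LINT x|lborel. \<bar>c\<bar> ^ DIM('a) *\<^sub>R h (t + c *\<^sub>R x))"
    by (rule integral_distr) auto
  finally show ?thesis using c by simp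
qed

text \<open>\<open>pair f t \<theta>\<close> is \<open>P\<^sup>a\<^sup>,\<^sup>t(\<theta>)\<close> for \<open>P x = f (x - a)\<close>.\<close>
definition pair :: "(real ^ 'n \<Rightarrow> 'b::real_normed_vector \<Rightarrow>\<^sub>L real) \<Rightarrow> real \<Rightarrow> (real ^ 'n \<Rightarrow> 'b) \<Rightarrow> real" where
  "pair f t \<theta> = (LINT x|lebesgue. blinfun_apply (f (t *\<^sub>R x)) (\<theta> x))"

lemma pair_integrand:
  fixes f :: "real ^ 'n \<Rightarrow> 'b::real_normed_vector \<Rightarrow>\<^sub>L real"
  assumes "continuous_on UNIV f" "\<theta> \<in> test_functions"
  shows "continuous_on UNIV (\<lambda>x. blinfun_apply (f (t *\<^sub>R x)) (\<theta> x))"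
    and "integrable lebesgue (\<lambda>x. blinfun_apply (f (t *\<^sub>R x)) (\<theta> x))"
proof -
  obtain \<rho> where \<rho>: "\<theta> \<in> test_functions_in (cball 0 \<rho>)" using test_functionsE[OF assms(2)] .
  show c: "continuous_on UNIV (\<lambda>x. blinfun_apply (f (t *\<^sub>R x)) (\<theta> x))"
    using smooth_continuous_on[OF test_functions_smooth[OF assms(2)]]
    by (intro continuous_intros continuous_on_compose2[OF assms(1)]) auto
  show "integrable lebesgue (\<lambda>x. blinfun_apply (f (t *\<^sub>R x)) (\<theta> x))"
    by (rule integrable_lebesgue_compact_support[OF c, of \<rho>])
       (use \<rho> in \<open>simp add: test_functions_in_cball_iff blinfun.zero_right\<close>)
qed

lemma pair_add_left:
  assumes "continuous_on UNIV f" "continuous_on UNIV g" "\<theta> \<in> test_functions"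
  shows "pair (\<lambda>u. f u + g u) t \<theta> = pair f t \<theta> + pair g t \<theta>"
  unfolding pair_def blinfun.add_left
  by (rule Bochner_Integration.integral_add) (intro pair_integrand assms)+

lemma pair_add_right:
  assumes "continuous_on UNIV f" "\<theta> \<in> test_functions" "\<eta> \<in> test_functions"
  shows "pair f t (\<lambda>x. \<theta> x + \<eta> x) = pair f t \<theta> + pair f t \<eta>"
  unfolding pair_def blinfun.add_right
  by (rule Bochner_Integration.integral_add) (intro pair_integrand assms)+

lemma pair_scaleR_right: "pair f t (\<lambda>x. c *\<^sub>R \<theta> x) = c * pair f t \<theta>"
  by (simp add: pair_def blinfun.scaleR_right)

lemma pair_coord: "pair (\<lambda>u. u $ j *\<^sub>R f u) t \<theta> = t * pair f t (times_coord j \<theta>)"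
  by (simp add: pair_def times_coord_def blinfun.scaleR_left blinfun.scaleR_right mult.assoc)

lemma pair_sum_left:
  assumes "\<And>j. j \<in> J \<Longrightarrow> continuous_on UNIV (f j)" "\<theta> \<in> test_functions"
  shows "pair (\<lambda>u. \<Sum>j\<in>J. f j u) t \<theta> = (\<Sum>j\<in>J. pair (f j) t \<theta>)"
  using assms
proof (induction J rule: infinite_finite_induct)
  case (insert j J)
  then show ?case by (simp add: pair_add_left continuous_on_sum)
qed (simp_all add: pair_def)

text \<open>A polynomial \<open>f\<close> has a radial primitive of the same degree: \<open>t\<^sup>e\<^sup>+\<^sup>1 q(t x)\<close> is the primitive of
  \<open>t\<^sup>e f(t x)\<close>. The exponent \<open>e\<close> is general because each coordinate factor of \<open>f\<close> contributes one power
  of \<open>t\<close>, and the derivative is only needed after pairing with test functions.\<close>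

lemma polyf_radial_primitive:
  fixes f :: "real ^ 'n \<Rightarrow> 'b::real_normed_vector \<Rightarrow>\<^sub>L real"
  assumes "polyf d f"
  shows "\<exists>q. polyf d q \<and> (\<forall>\<theta>\<in>test_functions. \<forall>t.
    ((\<lambda>t. t ^ Suc e * pair q t \<theta>) has_real_derivative t ^ e * pair f t \<theta>) (at t))"
  using assms
proof (induction arbitrary: e rule: polyf.induct)
  case (const d c)
  have p1: "pair (\<lambda>_. inverse (real (Suc e)) *\<^sub>R c) t \<theta> = inverse (real (Suc e)) * pair (\<lambda>_. c) 0 \<theta>"
    for t and \<theta> :: "real ^ 'n \<Rightarrow> 'b"
    by (simp add: pair_def blinfun.scaleR_left)
  have p2: "pair (\<lambda>_. c) t \<theta> = pair (\<lambda>_. c) 0 \<theta>" for t and \<theta> :: "real ^ 'n \<Rightarrow> 'b"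
    by (simp add: pair_def)
  have "((\<lambda>t. t ^ Suc e * (inverse (real (Suc e)) * b)) has_real_derivative t ^ e * b) (at t)" for b t :: real
    using DERIV_cmult_right[OF DERIV_pow[of "Suc e" t UNIV], of "inverse (real (Suc e)) * b"]
    by (simp add: field_simps del: power_Suc of_nat_Suc)
  then have "((\<lambda>t. t ^ Suc e * pair (\<lambda>_. inverse (real (Suc e)) *\<^sub>R c) t \<theta>)
      has_real_derivative t ^ e * pair (\<lambda>_. c) t \<theta>) (at t)" for t and \<theta> :: "real ^ 'n \<Rightarrow> 'b"
    unfolding p1 p2[of t \<theta>] .
  then show ?case
    by (intro exI[of _ "\<lambda>_. inverse (real (Suc e)) *\<^sub>R c"] conjI polyf.const ballI allI)
next
  case (add d f g)
  obtain q where q: "polyf d q" "\<And>\<theta> t. \<theta> \<in> test_functions \<Longrightarrow>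
    ((\<lambda>t. t ^ Suc e * pair q t \<theta>) has_real_derivative t ^ e * pair f t \<theta>) (at t)" using add.IH(1)[of e] by blast
  obtain p where p: "polyf d p" "\<And>\<theta> t. \<theta> \<in> test_functions \<Longrightarrow>
    ((\<lambda>t. t ^ Suc e * pair p t \<theta>) has_real_derivative t ^ e * pair g t \<theta>) (at t)" using add.IH(2)[of e] by blast
  have "((\<lambda>t. t ^ Suc e * pair (\<lambda>x. q x + p x) t \<theta>) has_real_derivative t ^ e * pair (\<lambda>x. f x + g x) t \<theta>) (at t)"
    if "\<theta> \<in> test_functions" for \<theta> t
    using DERIV_add[OF q(2)[OF that] p(2)[OF that], of t] q(1) p(1) add.hyps that
    by (simp add: pair_add_left polyf_continuous distrib_left)
  then show ?case using polyf.add[OF q(1) p(1)] by blast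
next
  case (coord d f j)
  obtain q where q: "polyf d q" "\<And>\<theta> t. \<theta> \<in> test_functions \<Longrightarrow>
    ((\<lambda>t. t ^ Suc (Suc e) * pair q t \<theta>) has_real_derivative t ^ Suc e * pair f t \<theta>) (at t)" using coord.IH[of "Suc e"] by blast
  have "((\<lambda>t. t ^ Suc e * pair (\<lambda>x. x $ j *\<^sub>R q x) t \<theta>) has_real_derivative t ^ e * pair (\<lambda>x. x $ j *\<^sub>R f x) t \<theta>) (at t)"
    if "\<theta> \<in> test_functions" for \<theta> t
    using q(2)[OF test_times_coord[OF that], of j t] by (simp add: pair_coord mult_ac)
  then show ?case using polyf.coord[OF q(1), of j] by blast
qed

lemma rescale_poly_distr:
  fixes P :: "real ^ 'n \<Rightarrow> 'b::real_normed_vector \<Rightarrow>\<^sub>L real"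
  assumes P: "continuous_on UNIV P" and \<theta>: "\<theta> \<in> test_functions" and r: "0 < r"
  shows "rescale (poly_distr P) a r \<theta> = pair (\<lambda>u. P (a + u)) r \<theta>"
proof -
  let ?h = "\<lambda>x. blinfun_apply (P x) (\<theta> (inverse r *\<^sub>R (x - a)))"
  have h: "continuous_on UNIV ?h"
    using smooth_continuous_on[OF smooth_scaleR_comp[OF test_functions_smooth[OF \<theta>]]]
    by (intro continuous_intros P)
  have c: "continuous_on UNIV (\<lambda>u. P (a + u))"
    by (intro continuous_on_compose2[OF P] continuous_intros) auto
  have "poly_distr P (\<lambda>x. \<theta> (inverse r *\<^sub>R (x - a))) = integral\<^sup>L lborel ?h"
    unfolding poly_distr_def by (rule integral_lebesgue_eq_lborel[OF h])
  also have "\<dots> = r ^ CARD('n) * (LINT x|lborel. ?h (a + r *\<^sub>R x))"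
    using lborel_integral_affine[OF r borel_measurable_continuous_onI[OF h], of a] by simp
  also have "(LINT x|lborel. ?h (a + r *\<^sub>R x)) = pair (\<lambda>u. P (a + u)) r \<theta>"
    using integral_lebesgue_eq_lborel[OF pair_integrand(1)[OF c \<theta>, of r]] r by (simp add: pair_def)
  finally show ?thesis using r by (simp add: rescale_def power_int_minus)
qed

text \<open>The difference quotients have integral \<open>0\<close> by translation invariance and converge boundedly.\<close>
lemma integral_dir_deriv_eq_0:
  fixes h :: "real ^ 'n \<Rightarrow> real"
  assumes h: "h \<in> test_functions"
  shows "(LINT x|lborel. dir_deriv (axis j 1) h x) = 0"
proof -
  let ?e = "axis j 1 :: real ^ 'n" and ?\<epsilon> = "\<lambda>n. inverse (real (Suc n))"
  let ?s = "\<lambda>n x. (h (x + ?\<epsilon> n *\<^sub>R ?e) - h x) / ?\<epsilon> n"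
  have sm: "smooth h" by (rule test_functions_smooth[OF h])
  obtain \<rho> where \<rho>: "h \<in> test_functions_in (cball 0 \<rho>)" using test_functionsE[OF h] .
  obtain B where B: "0 \<le> B" "derivs_le 1 B h" using test_derivs_le[OF h] by blast
  have B': "norm (dir_deriv ?e h x) \<le> B" for x
    using derivs_leD[OF B(2), of "[?e]" x] by (simp add: dir_deriv_def norm_axis_1)
  have ch: "continuous_on UNIV h" and cd: "continuous_on UNIV (dir_deriv ?e h)"
    by (intro smooth_continuous_on smooth_dir_deriv sm)+
  have [measurable]: "h \<in> borel_measurable borel" "dir_deriv ?e h \<in> borel_measurable borel"
    by (intro borel_measurable_continuous_onI ch cd)+
  have ih: "integrable lborel h"
    by (rule integrable_compact_support[OF ch, of \<rho>]) (use \<rho> in \<open>simp add: test_functions_in_cball_iff\<close>)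
  have line: "((\<lambda>s. h (x + s *\<^sub>R ?e)) has_vector_derivative dir_deriv ?e h (x + s *\<^sub>R ?e)) (at s)" for x s
    by (rule has_vector_derivative_line[OF sm])
  have "(\<lambda>n. integral\<^sup>L lborel (?s n)) \<longlonglongrightarrow> integral\<^sup>L lborel (dir_deriv ?e h)"
  proof (rule integral_dominated_convergence[where w = "\<lambda>x. indicator (cball 0 (\<rho> + 1)) x *\<^sub>R B"])
    show "integrable lborel (\<lambda>x :: real ^ 'n. indicator (cball 0 (\<rho> + 1)) x *\<^sub>R B)"
      by (intro borel_integrable_compact continuous_intros) simp
    show "AE x in lborel. (\<lambda>n. ?s n x) \<longlonglongrightarrow> dir_deriv ?e h x"
    proof (rule AE_I2)
      fix x
      have "((\<lambda>s. (h (x + s *\<^sub>R ?e) - h x) / s) \<longlongrightarrow> dir_deriv ?e h x) (at 0)"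
        using line[of x 0] unfolding has_real_derivative_iff_has_vector_derivative[symmetric]
        by (simp add: DERIV_def)
      then show "(\<lambda>n. ?s n x) \<longlonglongrightarrow> dir_deriv ?e h x"
        by (rule filterlim_compose[of _ _ _ ?\<epsilon>])
           (auto simp: filterlim_at LIMSEQ_inverse_real_of_nat simp del: of_nat_Suc)
    qed
    show "AE x in lborel. norm (?s n x) \<le> indicator (cball 0 (\<rho> + 1)) x *\<^sub>R B" for n
    proof (rule AE_I2)
      fix x
      have \<epsilon>: "0 < ?\<epsilon> n" "?\<epsilon> n \<le> 1" by (simp_all add: field_simps)
      show "norm (?s n x) \<le> indicator (cball 0 (\<rho> + 1)) x *\<^sub>R B"
      proof (cases "norm x \<le> \<rho> + 1")
        case True
        have "norm (h (x + ?\<epsilon> n *\<^sub>R ?e) - h (x + 0 *\<^sub>R ?e)) \<le> ?\<epsilon> n * B"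
          using \<epsilon> line B' by (intro norm_increment_le[where g = "\<lambda>s. h (x + s *\<^sub>R ?e)"]) auto
        then have "norm (h (x + ?\<epsilon> n *\<^sub>R ?e) - h x) / ?\<epsilon> n \<le> B"
          using \<epsilon> by (simp add: field_simps)
        then show ?thesis using True by simp
      next
        case False
        have "norm x \<le> norm (x + ?\<epsilon> n *\<^sub>R ?e) + norm (?\<epsilon> n *\<^sub>R ?e)"
          using norm_triangle_ineq4[of "x + ?\<epsilon> n *\<^sub>R ?e" "?\<epsilon> n *\<^sub>R ?e"] by simp
        also have "norm (?\<epsilon> n *\<^sub>R ?e) \<le> 1" using \<epsilon> by (simp add: norm_axis_1)
        finally have "\<rho> < norm (x + ?\<epsilon> n *\<^sub>R ?e)" "\<rho> < norm x" using False by auto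
        then have "h (x + ?\<epsilon> n *\<^sub>R ?e) = 0" "h x = 0" using \<rho> by (simp_all add: test_functions_in_cball_iff)
        then show ?thesis using B by simp
      qed
    qed
  qed auto
  moreover have "integral\<^sup>L lborel (?s n) = 0" for n
  proof -
    have "integrable lborel (\<lambda>x. h (?\<epsilon> n *\<^sub>R ?e + x))"
    proof (rule integrable_compact_support[of _ "\<rho> + norm (?\<epsilon> n *\<^sub>R ?e)"])
      fix x :: "real ^ 'n" assume "\<rho> + norm (?\<epsilon> n *\<^sub>R ?e) < norm x"
      moreover have "norm x - norm (?\<epsilon> n *\<^sub>R ?e) \<le> norm (?\<epsilon> n *\<^sub>R ?e + x)"
        using norm_diff_ineq[of x "?\<epsilon> n *\<^sub>R ?e"] by (simp add: add.commute)
      ultimately show "h (?\<epsilon> n *\<^sub>R ?e + x) = 0"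
        using \<rho> by (simp add: test_functions_in_cball_iff)
    qed (intro continuous_on_compose2[OF ch] continuous_intros, auto)
    moreover have "integral\<^sup>L lborel h = (LINT x|lborel. h (?\<epsilon> n *\<^sub>R ?e + x))"
      using lborel_integral_affine[of 1 h "?\<epsilon> n *\<^sub>R ?e"] by simp
    ultimately show ?thesis
      using ih by (simp add: add.commute)
  qed
  ultimately show ?thesis by (simp add: LIMSEQ_const_iff)
qed

lemma kills_derivatives_pair_const:
  fixes c :: "'b::real_normed_vector \<Rightarrow>\<^sub>L real"
  shows "kills_derivatives (pair (\<lambda>_ :: real ^ 'n. c) 1)"
  unfolding kills_derivatives_def
proof (intro conjI ballI allI)
  fix \<theta> \<eta> :: "real ^ 'n \<Rightarrow> 'b" assume "\<theta> \<in> test_functions" "\<eta> \<in> test_functions"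
  then show "pair (\<lambda>_. c) 1 (\<lambda>x. \<theta> x + \<eta> x) = pair (\<lambda>_. c) 1 \<theta> + pair (\<lambda>_. c) 1 \<eta>"
    by (intro pair_add_right continuous_intros)
next
  fix \<eta> :: "real ^ 'n \<Rightarrow> 'b" and j assume \<eta>: "\<eta> \<in> test_functions"
  let ?h = "\<lambda>x. blinfun_apply c (\<eta> x)"
  have sm: "smooth \<eta>" by (rule test_functions_smooth[OF \<eta>])
  obtain \<rho> where \<rho>: "\<eta> \<in> test_functions_in (cball 0 \<rho>)" using test_functionsE[OF \<eta>] .
  have "?h \<in> test_functions_in (cball 0 \<rho>)"
    using \<rho> smooth_linear_comp[OF blinfun.bounded_linear_right sm, of c]
    by (simp add: test_functions_in_cball_iff blinfun.zero_right)
  then have h: "?h \<in> test_functions" using test_functions_in_subset by blast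
  have eq: "dir_deriv v ?h = (\<lambda>x. blinfun_apply c (dir_deriv v \<eta> x))" for v
    by (intro dir_deriv_linear_comp blinfun.bounded_linear_right smooth_differentiable sm)
  have "continuous_on UNIV (dir_deriv (axis j 1) ?h)"
    by (intro smooth_continuous_on smooth_dir_deriv test_functions_smooth h)
  then show "pair (\<lambda>_. c) 1 (dir_deriv (axis j 1) \<eta>) = 0"
    using integral_dir_deriv_eq_0[OF h, of j] by (simp add: pair_def eq integral_lebesgue_eq_lborel)
qed

lemma integral_bump_prod_pos: "0 < (LINT x|lebesgue. bump_prod (x :: real ^ 'n))"
proof -
  have c: "continuous_on UNIV (bump_prod :: real ^ 'n \<Rightarrow> real)"
    unfolding bump_prod_def[abs_def] by (intro smooth_continuous_on smooth_prod_bump)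
  have t: "(\<lambda>x. bump_prod x *\<^sub>R (1 :: real)) \<in> test_functions" by (rule bump_prod_test)
  obtain \<rho> where \<rho>: "(\<lambda>x :: real ^ 'n. bump_prod x *\<^sub>R (1 :: real)) \<in> test_functions_in (cball 0 \<rho>)"
    using test_functionsE[OF t] .
  have i: "integrable lborel (bump_prod :: real ^ 'n \<Rightarrow> real)"
    by (rule integrable_compact_support[OF c, of \<rho>]) (use \<rho> in \<open>simp add: test_functions_in_cball_iff\<close>)
  have nn: "0 \<le> bump_prod x" for x :: "real ^ 'n" by (simp add: bump_prod_def prod_nonneg bump_nonneg)
  have "integral\<^sup>L lborel (bump_prod :: real ^ 'n \<Rightarrow> real) \<noteq> 0"
  proof
    assume "integral\<^sup>L lborel (bump_prod :: real ^ 'n \<Rightarrow> real) = 0"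
    then have "AE x in lborel. bump_prod (x :: real ^ 'n) = 0"
      using integral_nonneg_eq_0_iff_AE[OF i] nn by simp
    then have "AE x \<in> UNIV in lebesgue. bump_prod (x :: real ^ 'n) = 0"
      using AE_completion by auto
    then have "bump_prod (0 :: real ^ 'n) = 0"
      using mem_closed_if_AE_lebesgue[of "{x :: real ^ 'n. bump_prod x = 0}" 0]
        continuous_closed_vimage[of "{0}" "bump_prod :: real ^ 'n \<Rightarrow> real"] c
      by (auto simp: vimage_def continuous_on_eq_continuous_at)
    then show False using bump_0_pos by (simp add: bump_prod_def)
  qed
  moreover have "0 \<le> integral\<^sup>L lborel (bump_prod :: real ^ 'n \<Rightarrow> real)"
    using nn by simp
  ultimately show ?thesis by (simp add: integral_lebesgue_eq_lborel[OF c])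
qed

section \<open>Multiplication by a coordinate is bounded in the seminorms\<close>

lemma norm_D_zero_outside:
  fixes \<theta> :: "real ^ 'n \<Rightarrow> 'b::real_normed_vector"
  assumes \<theta>: "\<theta> \<in> test_functions_in (cball 0 \<rho>)" and x: "\<rho> < norm x"
  shows "norm_D i \<theta> x = 0"
proof -
  have "Dmult \<theta> vs x = 0" for vs
    using test_in_Dmult[OF compact_cball \<theta>, of vs] x by (simp add: test_functions_in_cball_iff)
  then have "norm_D i \<theta> x \<le> 0" by (intro norm_D_least) simp
  moreover have "0 \<le> norm_D i \<theta> x" using \<theta> test_functions_in_subset by (intro norm_D_nonneg) blast
  ultimately show ?thesis by simp
qed

lemma dir_deriv_norm_le:
  fixes f :: "real ^ 'n \<Rightarrow> 'b::real_normed_vector"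
  assumes f: "smooth f" and B: "\<And>v x. norm v \<le> 1 \<Longrightarrow> norm (dir_deriv v f x) \<le> B"
  shows "norm (dir_deriv v f x) \<le> norm v * B"
proof (cases "v = 0")
  case True
  then show ?thesis using linear_0[OF dir_deriv_linear_arg[OF f]] by simp
next
  case False
  have "norm (dir_deriv (norm v *\<^sub>R (inverse (norm v) *\<^sub>R v)) f x) \<le> norm v * B"
    unfolding dir_deriv_scaleR_arg[OF f, of "norm v"] norm_scaleR
    using False by (simp add: mult_left_mono B)
  then show ?thesis using False by simp
qed

lemma continuous_norm_D:
  fixes \<theta> :: "real ^ 'n \<Rightarrow> 'b::real_normed_vector"
  assumes \<theta>: "\<theta> \<in> test_functions"
  shows "continuous_on UNIV (norm_D j \<theta>)"
proof -
  obtain B where B: "0 \<le> B" "derivs_le (Suc j) B \<theta>" using test_derivs_le[OF \<theta>] by blast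
  have sm: "smooth \<theta>" by (rule test_functions_smooth[OF \<theta>])
  have lip: "norm_D j \<theta> x \<le> norm_D j \<theta> y + B * dist x y" for x y
  proof (rule norm_D_least)
    fix vs :: "(real ^ 'n) list" assume vs: "length vs = j" "\<forall>v\<in>set vs. norm v \<le> 1"
    let ?\<phi> = "Dmult \<theta> vs"
    have sp: "smooth ?\<phi>" by (rule smooth_Dmult[OF sm])
    have b: "norm (dir_deriv v ?\<phi> z) \<le> B" if "norm v \<le> 1" for v z
      using derivs_leD[OF B(2), of "v # vs" z] vs that by (simp add: Dmult_Cons del: Dmult.simps)
    have "norm (?\<phi> (y + 1 *\<^sub>R (x - y)) - ?\<phi> (y + 0 *\<^sub>R (x - y))) \<le> 1 * (norm (x - y) * B)"
      by (rule norm_increment_le[where g = "\<lambda>s. ?\<phi> (y + s *\<^sub>R (x - y))"])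
         (use has_vector_derivative_line[OF sp] dir_deriv_norm_le[OF sp b] in auto)
    then have "norm (?\<phi> x - ?\<phi> y) \<le> B * dist x y" by (simp add: dist_norm mult.commute)
    moreover have "norm (?\<phi> y) \<le> norm_D j \<theta> y" using vs by (intro norm_D_upper \<theta>)
    ultimately show "norm (?\<phi> x) \<le> norm_D j \<theta> y + B * dist x y"
      using norm_triangle_sub[of "?\<phi> x" "?\<phi> y"] by linarith
  qed
  have "\<bar>norm_D j \<theta> x - norm_D j \<theta> y\<bar> \<le> B * dist x y" for x y
    using lip[of x y] lip[of y x] by (auto simp: dist_commute abs_le_iff)
  then have "B-lipschitz_on UNIV (norm_D j \<theta>)"
    using B(1) by (intro lipschitz_onI) (auto simp: dist_real_def)
  then show ?thesis by (rule lipschitz_on_continuous_on)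
qed

text \<open>The length \<open>3\<close> of the segment makes its end point leave the closed unit ball, where all derivatives
  vanish.\<close>
lemma norm_D_le_line_integral:
  fixes \<theta> :: "real ^ 'n \<Rightarrow> 'b::banach"
  assumes \<theta>: "\<theta> \<in> test_functions_in (cball 0 1)" and e: "norm e = 1"
  shows "norm_D i \<theta> x \<le> integral {0..3} (\<lambda>t. norm_D (Suc i) \<theta> (x + t *\<^sub>R e))"
proof -
  have t: "\<theta> \<in> test_functions" using \<theta> test_functions_in_subset by blast
  have cont: "continuous_on {0..3} (\<lambda>t. norm_D (Suc i) \<theta> (x + t *\<^sub>R e))"
    by (intro continuous_on_compose2[OF continuous_norm_D[OF t]] continuous_intros) auto
  show ?thesis
  proof (cases "norm x \<le> 1")
    case True
    show ?thesis
    proof (rule norm_D_least)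
      fix vs :: "(real ^ 'n) list" assume vs: "length vs = i" "\<forall>v\<in>set vs. norm v \<le> 1"
      let ?\<phi> = "Dmult \<theta> vs"
      have sp: "smooth ?\<phi>" by (rule smooth_Dmult[OF test_functions_smooth[OF t]])
      have int: "((\<lambda>t. dir_deriv e ?\<phi> (x + t *\<^sub>R e)) has_integral (?\<phi> (x + 3 *\<^sub>R e) - ?\<phi> (x + 0 *\<^sub>R e))) {0..3}"
        by (intro fundamental_theorem_of_calculus has_vector_derivative_at_within[OF has_vector_derivative_line[OF sp]]) simp
      have "1 < norm (x + 3 *\<^sub>R e)"
        using True e norm_diff_ineq[of "3 *\<^sub>R e" x] by (simp add: add.commute)
      then have "?\<phi> (x + 3 *\<^sub>R e) = 0"
        using test_in_Dmult[OF compact_cball \<theta>, of vs] by (simp add: test_functions_in_cball_iff)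
      then have "norm (?\<phi> x) = norm (integral {0..3} (\<lambda>t. dir_deriv e ?\<phi> (x + t *\<^sub>R e)))"
        using integral_unique[OF int] by simp
      also have "\<dots> \<le> integral {0..3} (\<lambda>t. norm_D (Suc i) \<theta> (x + t *\<^sub>R e))"
      proof (rule integral_norm_bound_integral)
        show "(\<lambda>t. dir_deriv e ?\<phi> (x + t *\<^sub>R e)) integrable_on {0..3}" using int by blast
        show "(\<lambda>t. norm_D (Suc i) \<theta> (x + t *\<^sub>R e)) integrable_on {0..3}"
          by (rule integrable_continuous_real[OF cont])
        show "norm (dir_deriv e ?\<phi> (x + s *\<^sub>R e)) \<le> norm_D (Suc i) \<theta> (x + s *\<^sub>R e)" for s
          using norm_D_upper[OF t, of "e # vs" "Suc i"] vs e by (simp add: Dmult_Cons del: Dmult.simps)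
      qed
      finally show "norm (?\<phi> x) \<le> integral {0..3} (\<lambda>t. norm_D (Suc i) \<theta> (x + t *\<^sub>R e))" .
    qed
  next
    case False
    then have "norm_D i \<theta> x = 0" by (intro norm_D_zero_outside[OF \<theta>]) simp
    also have "0 \<le> integral {0..3} (\<lambda>t. norm_D (Suc i) \<theta> (x + t *\<^sub>R e))"
      using norm_D_nonneg[OF t] by (intro integral_nonneg integrable_continuous_real[OF cont])
    finally show ?thesis .
  qed
qed

lemma Dmult_times_coord:
  fixes \<theta> :: "real ^ 'n \<Rightarrow> 'b::real_normed_vector"
  assumes s: "smooth \<theta>"
  shows "Dmult (times_coord j \<theta>) vs = (\<lambda>x. x $ j *\<^sub>R Dmult \<theta> vs x
    + (\<Sum>l<length vs. (vs ! l) $ j *\<^sub>R Dmult \<theta> (take l vs @ drop (Suc l) vs) x))"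
proof (induction vs)
  case Nil
  then show ?case by (simp add: times_coord_def)
next
  case (Cons v vs)
  let ?r = "\<lambda>l x. (vs ! l) $ j *\<^sub>R Dmult \<theta> (take l vs @ drop (Suc l) vs) x"
  have sr: "smooth (?r l)" for l by (intro smooth_scaleR_const smooth_Dmult s)
  have dr: "dir_deriv v (?r l) = (\<lambda>x. (vs ! l) $ j *\<^sub>R Dmult \<theta> (v # take l vs @ drop (Suc l) vs) x)" for l
    using dir_deriv_linear_comp[OF bounded_linear_scaleR_right smooth_differentiable[OF smooth_Dmult[OF s]]]
    by (simp only: Dmult_Cons)
  have "Dmult (times_coord j \<theta>) vs = (\<lambda>x. times_coord j (Dmult \<theta> vs) x + (\<Sum>l<length vs. ?r l x))"
    by (simp only: Cons.IH times_coord_def[of j "Dmult \<theta> vs"])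
  then have "Dmult (times_coord j \<theta>) (v # vs) = dir_deriv v (\<lambda>x. times_coord j (Dmult \<theta> vs) x + (\<Sum>l<length vs. ?r l x))"
    by (simp only: Dmult_Cons)
  also have "\<dots> = (\<lambda>x. dir_deriv v (times_coord j (Dmult \<theta> vs)) x + dir_deriv v (\<lambda>x. \<Sum>l<length vs. ?r l x) x)"
    by (intro dir_deriv_add smooth_differentiable smooth_times_coord smooth_Dmult smooth_sum sr s)
  also have "\<dots> = (\<lambda>x. x $ j *\<^sub>R Dmult \<theta> (v # vs) x + (v $ j *\<^sub>R Dmult \<theta> vs x
      + (\<Sum>l<length vs. (vs ! l) $ j *\<^sub>R Dmult \<theta> (v # take l vs @ drop (Suc l) vs) x)))"
    by (simp only: dir_deriv_times_coord[OF smooth_Dmult[OF s]] dir_deriv_sum[OF sr] dr Dmult_Cons add.assoc)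
  also have "\<dots> = (\<lambda>x. x $ j *\<^sub>R Dmult \<theta> (v # vs) x
      + (\<Sum>l<length (v # vs). ((v # vs) ! l) $ j *\<^sub>R Dmult \<theta> (take l (v # vs) @ drop (Suc l) (v # vs)) x))"
    by (simp only: length_Cons sum.lessThan_Suc_shift nth_Cons_0 nth_Cons_Suc take_0 take_Suc_Cons drop_Suc_Cons drop_0 append_Nil append_Cons)
  finally show ?case .
qed

lemma norm_D_times_coord_le:
  fixes \<theta> :: "real ^ 'n \<Rightarrow> 'b::real_normed_vector"
  assumes \<theta>: "\<theta> \<in> test_functions"
  shows "norm_D i (times_coord j \<theta>) x \<le> norm x * norm_D i \<theta> x + real i * norm_D (i - 1) \<theta> x"
proof (rule norm_D_least)
  fix vs :: "(real ^ 'n) list" assume vs: "length vs = i" "\<forall>v\<in>set vs. norm v \<le> 1"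
  have term_le: "norm ((vs ! l) $ j *\<^sub>R Dmult \<theta> (take l vs @ drop (Suc l) vs) x) \<le> norm_D (i - 1) \<theta> x" if l: "l < i" for l
  proof -
    have "\<bar>(vs ! l) $ j\<bar> \<le> 1" using component_le_norm_cart[of "vs ! l" j] vs l by (meson nth_mem order_trans)
    moreover have "norm (Dmult \<theta> (take l vs @ drop (Suc l) vs) x) \<le> norm_D (i - 1) \<theta> x"
    proof (rule norm_D_upper[OF \<theta>])
      show "length (take l vs @ drop (Suc l) vs) = i - 1" using vs l by simp
      show "\<forall>v\<in>set (take l vs @ drop (Suc l) vs). norm v \<le> 1"
        using vs by (auto dest: in_set_takeD in_set_dropD)
    qed
    ultimately show ?thesis
      using mult_mono[of "\<bar>(vs ! l) $ j\<bar>" 1 "norm (Dmult \<theta> (take l vs @ drop (Suc l) vs) x)" "norm_D (i - 1) \<theta> x"] by simp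
  qed
  have "norm (\<Sum>l<length vs. (vs ! l) $ j *\<^sub>R Dmult \<theta> (take l vs @ drop (Suc l) vs) x) \<le> (\<Sum>l<i. norm_D (i - 1) \<theta> x)"
    unfolding vs(1) by (rule sum_norm_le) (rule term_le, simp)
  then have "norm (\<Sum>l<length vs. (vs ! l) $ j *\<^sub>R Dmult \<theta> (take l vs @ drop (Suc l) vs) x) \<le> real i * norm_D (i - 1) \<theta> x"
    by simp
  moreover have "norm (x $ j *\<^sub>R Dmult \<theta> vs x) \<le> norm x * norm_D i \<theta> x"
    unfolding norm_scaleR real_norm_def
    by (intro mult_mono component_le_norm_cart norm_D_upper \<theta> vs) auto
  ultimately show "norm (Dmult (times_coord j \<theta>) vs x) \<le> norm x * norm_D i \<theta> x + real i * norm_D (i - 1) \<theta> x"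
    unfolding Dmult_times_coord[OF test_functions_smooth[OF \<theta>]]
    by (intro norm_triangle_le add_mono)
qed

text \<open>By the Leibniz rule \<open>D\<^sup>i(x\<^sub>j \<theta>)\<close> involves \<open>D\<^sup>i\<^sup>-\<^sup>1 \<theta>\<close>, which is controlled by \<open>D\<^sup>i \<theta>\<close> along a segment.
  For \<open>i = 0\<close> the second term is absent, whatever \<open>norm_D (i - 1)\<close> means.\<close>
lemma norm_D_times_coord_line:
  fixes \<theta> :: "real ^ 'n \<Rightarrow> 'b::banach"
  assumes \<theta>: "\<theta> \<in> test_functions_in (cball 0 1)" and e: "norm e = 1"
  shows "norm_D i (times_coord j \<theta>) x \<le> norm_D i \<theta> x + real i * integral {0..3} (\<lambda>t. norm_D i \<theta> (x + t *\<^sub>R e))"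
proof -
  have t: "\<theta> \<in> test_functions" using \<theta> test_functions_in_subset by blast
  have 1: "norm x * norm_D i \<theta> x \<le> norm_D i \<theta> x"
    using norm_D_nonneg[OF t, of i x] norm_D_zero_outside[OF \<theta>, of x i]
    by (cases "norm x \<le> 1") (auto simp: mult_left_le_one_le)
  have 2: "real i * norm_D (i - 1) \<theta> x \<le> real i * integral {0..3} (\<lambda>t. norm_D i \<theta> (x + t *\<^sub>R e))"
    using norm_D_le_line_integral[OF \<theta> e, of "i - 1" x] by (cases i) (auto intro: mult_left_mono)
  show ?thesis using norm_D_times_coord_le[OF t, of i j x] 1 2 by linarith
qed

text \<open>The graph of \<open>u\<^sup>q\<close> lies above its tangent at \<open>a\<close>. For \<open>u > 0\<close> this is convexity of the exponential
  function between \<open>0\<close> and \<open>q ln (u/a)\<close>.\<close>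
lemma powr_ge_tangent:
  fixes a u q :: real
  assumes q: "1 \<le> q" and a: "0 < a" and u: "0 \<le> u"
  shows "a powr q + q * a powr (q - 1) * (u - a) \<le> u powr q"
proof (cases "u = 0")
  case True
  have A: "a powr (q - 1) * a = a powr q" using a by (simp add: powr_diff)
  have "q * a powr (q - 1) * (u - a) = - (q * (a powr (q - 1) * a))" using True by simp
  then have "q * a powr (q - 1) * (u - a) = - (q * a powr q)" unfolding A .
  moreover have "1 * a powr q \<le> q * a powr q" using q by (intro mult_right_mono) auto
  moreover have "u powr q = 0" using True by simp
  ultimately show ?thesis by linarith
next
  case False
  define s where "s = ln (u / a)"
  have ua: "0 < u / a" using a u False by simp
  have "exp ((1 - 1 / q) *\<^sub>R 0 + (1 / q) *\<^sub>R (q * s)) \<le> (1 - 1 / q) * exp 0 + (1 / q) * exp (q * s)"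
    using q by (intro convex_onD[OF exp_convex]) auto
  then have "exp s \<le> (1 - 1 / q) + (1 / q) * exp (q * s)" using q by simp
  then have "q * exp s \<le> q * ((1 - 1 / q) + (1 / q) * exp (q * s))"
    using q by (intro mult_left_mono) auto
  also have "\<dots> = (q - 1) + exp (q * s)" using q by (simp add: distrib_left right_diff_distrib)
  finally have "q * exp s \<le> (q - 1) + exp (q * s)" .
  moreover have "exp s = u / a" "exp (q * s) = (u / a) powr q"
    using ua a False by (simp_all add: s_def powr_def)
  ultimately have "q * (u / a) \<le> (q - 1) + u powr q / a powr q"
    using a u by (simp add: powr_divide)
  then have "(q * (u / a)) * a powr q \<le> ((q - 1) + u powr q / a powr q) * a powr q"
    by (intro mult_right_mono) auto
  moreover have "((q - 1) + u powr q / a powr q) * a powr q = (q - 1) * a powr q + u powr q"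
    using a by (simp add: field_simps)
  moreover have "a powr q = a powr (q - 1) * a" using a by (simp add: powr_diff)
  moreover have "q * (u / a) * (a powr (q - 1) * a) = q * a powr (q - 1) * u" using a by simp
  ultimately show ?thesis by (simp add: algebra_simps)
qed

text \<open>Jensen's inequality: integrate the tangent inequality at the mean value of \<open>g\<close>.\<close>
lemma power_mean_integral:
  fixes g :: "real \<Rightarrow> real"
  assumes q: "1 \<le> q" and g: "continuous_on {0..3} g" "\<And>t. 0 \<le> g t"
  shows "(integral {0..3} g) powr q \<le> 3 powr (q - 1) * integral {0..3} (\<lambda>t. g t powr q)"
proof -
  define a where "a = integral {0..3} g / 3"
  have cq: "continuous_on {0..3} (\<lambda>t. g t powr q)"
    using q g(2) by (intro continuous_on_powr' g(1) continuous_intros) auto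
  have "0 \<le> integral {0..3} g"
    using g by (intro integral_nonneg integrable_continuous_real)
  then have a0: "0 \<le> a" by (simp add: a_def)
  have "3 * a powr q \<le> integral {0..3} (\<lambda>t. g t powr q)"
  proof (cases "a = 0")
    case True
    then show ?thesis using cq by (simp add: integral_nonneg integrable_continuous_real)
  next
    case False
    then have a: "0 < a" using a0 by simp
    have hc: "((\<lambda>t. c) has_integral 3 * c) {0..3::real}" for c :: real
      using has_integral_const_real[of c 0 3] by simp
    have "((\<lambda>t. a powr q + q * a powr (q - 1) * (g t - a)) has_integral
        3 * (a powr q) + q * a powr (q - 1) * (integral {0..3} g - 3 * a)) {0..3}"
      by (intro has_integral_add has_integral_mult_right has_integral_diff hc
          integrable_integral integrable_continuous_real g(1))
    then have h: "((\<lambda>t. a powr q + q * a powr (q - 1) * (g t - a)) has_integral 3 * a powr q) {0..3}"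
      by (simp add: a_def)
    then show ?thesis
      by (rule has_integral_le[OF _ integrable_integral[OF integrable_continuous_real[OF cq]]])
         (rule powr_ge_tangent[OF q a g(2)])
  qed
  moreover have "(integral {0..3} g) powr q = 3 powr (q - 1) * (3 * a powr q)"
    using a0 by (simp add: a_def powr_divide powr_diff)
  ultimately show ?thesis by (simp add: mult_left_mono)
qed

lemma powr_add_le:
  fixes u v q :: real
  assumes "0 \<le> q" "0 \<le> u" "0 \<le> v"
  shows "(u + v) powr q \<le> 2 powr q * (u powr q + v powr q)"
proof -
  have "(u + v) powr q \<le> (2 * max u v) powr q" using assms by (intro powr_mono2) auto
  also have "\<dots> = 2 powr q * max u v powr q" using assms by (simp add: powr_mult)
  also have "\<dots> \<le> 2 powr q * (u powr q + v powr q)"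
    using assms by (intro mult_left_mono) (auto simp: max_def)
  finally show ?thesis .
qed

lemma nn_integral_translate:
  fixes h :: "'a::euclidean_space \<Rightarrow> ennreal"
  assumes [measurable]: "h \<in> borel_measurable borel"
  shows "(\<integral>\<^sup>+x. h (c + x) \<partial>lborel) = (\<integral>\<^sup>+x. h x \<partial>lborel)"
proof -
  have "(\<integral>\<^sup>+x. h x \<partial>lborel) = (\<integral>\<^sup>+x. h x \<partial>distr lborel borel ((+) c))"
    by (simp add: lborel_distr_plus)
  then show ?thesis by (simp add: nn_integral_distr)
qed

lemma nn_integral_line_integrals:
  fixes h :: "real ^ 'n \<Rightarrow> real"
  assumes h: "continuous_on UNIV h" "\<And>x. 0 \<le> h x"
  shows "(\<integral>\<^sup>+x. ennreal (integral {0..3} (\<lambda>t. h (x + t *\<^sub>R e))) \<partial>lborel) = 3 * (\<integral>\<^sup>+x. ennreal (h x) \<partial>lborel)"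
proof -
  have [measurable]: "h \<in> borel_measurable borel" by (rule borel_measurable_continuous_onI[OF h(1)])
  have "ennreal (integral {0..3} (\<lambda>t. h (x + t *\<^sub>R e))) = (\<integral>\<^sup>+t. indicator {0..3} t * ennreal (h (x + t *\<^sub>R e)) \<partial>lborel)" for x
  proof -
    have "continuous_on {0..3} (\<lambda>t. h (x + t *\<^sub>R e))"
      by (intro continuous_on_compose2[OF h(1)] continuous_intros) auto
    then have "((\<lambda>t. h (x + t *\<^sub>R e)) has_integral integral {0..3} (\<lambda>t. h (x + t *\<^sub>R e))) {0..3}"
      by (intro integrable_integral integrable_continuous_real)
    from nn_integral_has_integral_lebesgue[OF _ this] h(2)
    have "(\<integral>\<^sup>+t. ennreal (indicator {0..3} t * h (x + t *\<^sub>R e)) \<partial>lborel) = ennreal (integral {0..3} (\<lambda>t. h (x + t *\<^sub>R e)))"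
      by simp
    then show ?thesis by (simp add: ennreal_mult' ennreal_indicator h(2))
  qed
  then have "(\<integral>\<^sup>+x. ennreal (integral {0..3} (\<lambda>t. h (x + t *\<^sub>R e))) \<partial>lborel)
      = (\<integral>\<^sup>+x. \<integral>\<^sup>+t. indicator {0..3} t * ennreal (h (x + t *\<^sub>R e)) \<partial>lborel \<partial>lborel)"
    by simp
  also have "\<dots> = (\<integral>\<^sup>+t. \<integral>\<^sup>+x. indicator {0..3} t * ennreal (h (x + t *\<^sub>R e)) \<partial>lborel \<partial>lborel)"
    by (rule lborel_pair.Fubini') measurable
  also have "\<dots> = (\<integral>\<^sup>+t. indicator {0..3::real} t * (\<integral>\<^sup>+x. ennreal (h x) \<partial>lborel) \<partial>lborel)"
  proof -
    have "(\<integral>\<^sup>+x. ennreal (h (x + t *\<^sub>R e)) \<partial>lborel) = (\<integral>\<^sup>+x. ennreal (h x) \<partial>lborel)" for t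
      unfolding add.commute[of _ "t *\<^sub>R e"]
      by (rule nn_integral_translate[of "\<lambda>x. ennreal (h x)"]) measurable
    then show ?thesis by (simp add: nn_integral_cmult)
  qed
  also have "\<dots> = 3 * (\<integral>\<^sup>+x. ennreal (h x) \<partial>lborel)"
    by (simp add: nn_integral_multc)
  finally show ?thesis .
qed

lemma nu_integrand:
  fixes \<theta> :: "real ^ 'n \<Rightarrow> 'b::real_normed_vector"
  assumes \<theta>: "\<theta> \<in> test_functions" and q: "0 < q"
  shows "continuous_on UNIV (\<lambda>x. norm_D i \<theta> x powr q)"
    and "ennreal (LINT x|lebesgue. norm_D i \<theta> x powr q) = (\<integral>\<^sup>+x. ennreal (norm_D i \<theta> x powr q) \<partial>lborel)"
proof -
  show c: "continuous_on UNIV (\<lambda>x. norm_D i \<theta> x powr q)"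
    using q norm_D_nonneg[OF \<theta>] by (intro continuous_on_powr' continuous_norm_D[OF \<theta>] continuous_intros) auto
  obtain \<rho> where \<rho>: "\<theta> \<in> test_functions_in (cball 0 \<rho>)" using test_functionsE[OF \<theta>] .
  have "integrable lborel (\<lambda>x. norm_D i \<theta> x powr q)"
    by (rule integrable_compact_support[OF c, of \<rho>]) (simp add: norm_D_zero_outside[OF \<rho>])
  then show "ennreal (LINT x|lebesgue. norm_D i \<theta> x powr q) = (\<integral>\<^sup>+x. ennreal (norm_D i \<theta> x powr q) \<partial>lborel)"
    by (simp add: integral_lebesgue_eq_lborel[OF c] nn_integral_eq_integral)
qed

lemma enn2real_ge_1: "1 \<le> p \<Longrightarrow> p \<noteq> \<infinity> \<Longrightarrow> 1 \<le> enn2real p"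
  by (cases p) (auto simp: ennreal_1[symmetric] ennreal_le_iff top_ennreal_def simp del: ennreal_1)

lemma nu_nonneg:
  assumes "\<theta> \<in> test_functions"
  shows "0 \<le> nu i p \<theta>"
proof (cases "p = \<infinity>")
  case True
  obtain B where "derivs_le i B \<theta>" using test_derivs_le[OF assms] by blast
  then have "norm_D i \<theta> 0 \<le> (SUP x. norm_D i \<theta> x)"
    by (intro cSUP_upper bdd_aboveI2[where M = B] norm_D_le) auto
  then show ?thesis using norm_D_nonneg[OF assms, of i 0] True by (simp add: nu_def)
qed (simp add: nu_def)

lemma nu_le_of_nn_integral_le:
  assumes p: "1 \<le> p" "p \<noteq> \<infinity>" and \<theta>: "\<theta> \<in> test_functions" and \<eta>: "\<eta> \<in> test_functions" and C: "0 \<le> C"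
    and le: "(\<integral>\<^sup>+x. ennreal (norm_D i \<theta> x powr enn2real p) \<partial>lborel)
      \<le> ennreal C * (\<integral>\<^sup>+x. ennreal (norm_D i \<eta> x powr enn2real p) \<partial>lborel)"
  shows "nu i p \<theta> \<le> C powr (1 / enn2real p) * nu i p \<eta>"
proof -
  let ?q = "enn2real p"
  let ?I = "\<lambda>f. LINT x|lebesgue. norm_D i f x powr ?q" and ?J = "LINT x|lebesgue. norm_D i \<eta> x powr ?q"
  have q: "1 \<le> ?q" by (rule enn2real_ge_1[OF p])
  have nn: "0 \<le> (LINT x|lebesgue. norm_D i \<theta> x powr ?q)" "0 \<le> ?J" by simp_all
  have "ennreal (LINT x|lebesgue. norm_D i \<theta> x powr ?q) \<le> ennreal C * ennreal ?J"
    using le nu_integrand(2)[OF \<theta>, of ?q i] nu_integrand(2)[OF \<eta>, of ?q i] q by simp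
  then have "(LINT x|lebesgue. norm_D i \<theta> x powr ?q) \<le> C * ?J"
    using C nn by (simp add: ennreal_mult[symmetric] ennreal_le_iff)
  then have "(LINT x|lebesgue. norm_D i \<theta> x powr ?q) powr (1 / ?q) \<le> (C * ?J) powr (1 / ?q)"
    using q nn by (intro powr_mono2) auto
  then show ?thesis using p C nn by (simp add: nu_def powr_mult)
qed

lemma nu_mono:
  assumes p: "1 \<le> p" and \<theta>: "\<theta> \<in> test_functions" and \<eta>: "\<eta> \<in> test_functions" and C: "0 \<le> C"
    and le: "\<And>x. norm_D i \<theta> x \<le> C * norm_D i \<eta> x"
  shows "nu i p \<theta> \<le> C * nu i p \<eta>"
proof (cases "p = \<infinity>")
  case True
  obtain B where B: "derivs_le i B \<eta>" using test_derivs_le[OF \<eta>] by blast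
  have "norm_D i \<theta> x \<le> C * (SUP x. norm_D i \<eta> x)" for x
  proof -
    have "norm_D i \<eta> x \<le> (SUP x. norm_D i \<eta> x)"
      using B by (intro cSUP_upper bdd_aboveI2[where M = B] norm_D_le) auto
    then show ?thesis using le[of x] C by (meson mult_left_mono order_trans)
  qed
  then show ?thesis using True by (simp add: nu_def cSUP_least)
next
  case False
  let ?q = "enn2real p"
  have q: "1 \<le> ?q" by (rule enn2real_ge_1[OF p False])
  have [measurable]: "(\<lambda>x. norm_D i \<eta> x powr ?q) \<in> borel_measurable borel"
    using q by (intro borel_measurable_continuous_onI nu_integrand(1)[OF \<eta>]) auto
  have "norm_D i \<theta> x powr ?q \<le> C powr ?q * norm_D i \<eta> x powr ?q" for x
  proof -
    have "norm_D i \<theta> x powr ?q \<le> (C * norm_D i \<eta> x) powr ?q"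
      using q le norm_D_nonneg[OF \<theta>] by (intro powr_mono2) auto
    then show ?thesis using C norm_D_nonneg[OF \<eta>] by (simp add: powr_mult)
  qed
  then have "(\<integral>\<^sup>+x. ennreal (norm_D i \<theta> x powr ?q) \<partial>lborel)
      \<le> (\<integral>\<^sup>+x. ennreal (C powr ?q) * ennreal (norm_D i \<eta> x powr ?q) \<partial>lborel)"
    by (intro nn_integral_mono) (simp add: ennreal_mult[symmetric])
  also have "\<dots> = ennreal (C powr ?q) * (\<integral>\<^sup>+x. ennreal (norm_D i \<eta> x powr ?q) \<partial>lborel)"
    by (rule nn_integral_cmult) measurable
  finally have "nu i p \<theta> \<le> (C powr ?q) powr (1 / ?q) * nu i p \<eta>"
    by (intro nu_le_of_nn_integral_le p False \<theta> \<eta>) auto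
  then show ?thesis using C q by (simp add: powr_powr)
qed

lemma norm_D_scaleR:
  assumes "\<theta> \<in> test_functions"
  shows "norm_D i (\<lambda>x. c *\<^sub>R \<theta> x) x \<le> \<bar>c\<bar> * norm_D i \<theta> x"
  by (rule norm_D_least) (simp add: Dmult_scaleR test_functions_smooth assms norm_D_upper mult_left_mono)

lemma nu_scaleR_le:
  assumes "1 \<le> p" "\<theta> \<in> test_functions"
  shows "nu i p (\<lambda>x. c *\<^sub>R \<theta> x) \<le> \<bar>c\<bar> * nu i p \<theta>"
  by (rule nu_mono[OF assms(1) test_scaleR_const[OF assms(2)] assms(2)]) (simp_all add: norm_D_scaleR assms(2))

text \<open>For finite \<open>p\<close> the integral over the segment is handled by Jensen's inequality and Fubini's theorem,
  which replaces it by the integral of \<open>\<parallel>D\<^sup>i \<theta>\<parallel>\<^sup>p\<close> over the whole space. The support in the unit ball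
  bounds the factor \<open>x\<^sub>j\<close> and, through the length of the segments, the constant.\<close>
theorem nu_times_coord:
  assumes p: "1 \<le> p"
  shows "\<exists>C>0. \<forall>\<theta>\<in>test_functions_in (cball 0 1). \<forall>j.
    nu i p (times_coord j \<theta> :: real ^ 'n \<Rightarrow> 'b::banach) \<le> C * nu i p \<theta>"
proof -
  obtain e :: "real ^ 'n" where e: "norm e = 1"
    using norm_axis_1[of "undefined :: 'n"] by blast
  have tin: "\<theta> \<in> test_functions" "times_coord j \<theta> \<in> test_functions"
    if "\<theta> \<in> test_functions_in (cball 0 1)" for \<theta> :: "real ^ 'n \<Rightarrow> 'b" and j
    using that test_functions_in_subset test_times_coord by blast+
  show ?thesis
  proof (cases "p = \<infinity>")
    case True
    have "nu i p (times_coord j \<theta>) \<le> (1 + 3 * real i) * nu i p \<theta>"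
      if \<theta>: "\<theta> \<in> test_functions_in (cball 0 1)" for \<theta> :: "real ^ 'n \<Rightarrow> 'b" and j
    proof -
      note t = tin[OF \<theta>]
      let ?s = "SUP x. norm_D i \<theta> x"
      obtain B where B: "derivs_le i B \<theta>" using test_derivs_le[OF t(1)] by blast
      have s: "norm_D i \<theta> x \<le> ?s" for x
        using B by (intro cSUP_upper bdd_aboveI2[where M = B] norm_D_le) auto
      have "norm_D i (times_coord j \<theta>) x \<le> (1 + 3 * real i) * ?s" for x
      proof -
        have c: "continuous_on {0..3} (\<lambda>t. norm_D i \<theta> (x + t *\<^sub>R e))"
          by (intro continuous_on_compose2[OF continuous_norm_D[OF t(1)]] continuous_intros) auto
        have "integral {0..3} (\<lambda>t. norm_D i \<theta> (x + t *\<^sub>R e)) \<le> integral {0..3} (\<lambda>t::real. ?s)"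
          by (intro integral_le integrable_continuous_real c s continuous_intros)
        then have "integral {0..3} (\<lambda>t. norm_D i \<theta> (x + t *\<^sub>R e)) \<le> 3 * ?s" by simp
        then have "real i * integral {0..3} (\<lambda>t. norm_D i \<theta> (x + t *\<^sub>R e)) \<le> real i * (3 * ?s)"
          by (rule mult_left_mono) simp
        with norm_D_times_coord_line[OF \<theta> e, of i j x] s[of x] show ?thesis by (simp add: algebra_simps)
      qed
      then show ?thesis using True by (simp add: nu_def cSUP_least)
    qed
    then show ?thesis by (intro exI[of _ "1 + 3 * real i"]) auto
  next
    case False
    let ?q = "enn2real p"
    have q: "1 \<le> ?q" by (rule enn2real_ge_1[OF p False])
    define b where "b = 2 powr ?q * (real i powr ?q * 3 powr (?q - 1))"
    define C where "C = 2 powr ?q + 3 * b"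
    have b: "0 \<le> b" by (simp add: b_def)
    then have C: "0 < C" by (simp add: C_def add_pos_nonneg)
    have "nu i p (times_coord j \<theta>) \<le> C powr (1 / ?q) * nu i p \<theta>"
      if \<theta>: "\<theta> \<in> test_functions_in (cball 0 1)" for \<theta> :: "real ^ 'n \<Rightarrow> 'b" and j
    proof (rule nu_le_of_nn_integral_le[OF p False])
      note t = tin[OF \<theta>]
      show "\<theta> \<in> test_functions" "times_coord j \<theta> \<in> test_functions" by (rule t)+
      show "0 \<le> C" using C by simp
      let ?g = "norm_D i \<theta>"
      let ?h = "\<lambda>x. ?g x powr ?q"
      let ?H = "\<lambda>x. integral {0..3} (\<lambda>t. ?h (x + t *\<^sub>R e))"
      have ch: "continuous_on UNIV ?h" using q by (intro nu_integrand(1) t) auto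
      have "continuous_on (UNIV \<times> cbox 0 3) (\<lambda>(x, t). ?h (x + t *\<^sub>R e))"
        unfolding case_prod_unfold by (intro continuous_on_compose2[OF ch] continuous_intros) auto
      from integral_continuous_on_param[OF this]
      have cH: "continuous_on UNIV ?H" by simp
      have [measurable]: "?h \<in> borel_measurable borel" "?H \<in> borel_measurable borel"
        by (intro borel_measurable_continuous_onI ch cH)+
      have H: "0 \<le> ?H x" for x
        by (intro integral_nonneg integrable_continuous_real continuous_on_compose2[OF ch] continuous_intros) auto
      have pw: "norm_D i (times_coord j \<theta>) x powr ?q \<le> 2 powr ?q * ?h x + b * ?H x" for x
      proof -
        let ?A = "integral {0..3} (\<lambda>t. ?g (x + t *\<^sub>R e))"
        have c: "continuous_on {0..3} (\<lambda>t. ?g (x + t *\<^sub>R e))"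
          by (intro continuous_on_compose2[OF continuous_norm_D[OF t(1)]] continuous_intros) auto
        have A: "0 \<le> ?A" using norm_D_nonneg[OF t(1)] by (intro integral_nonneg integrable_continuous_real c)
        have "norm_D i (times_coord j \<theta>) x powr ?q \<le> (?g x + real i * ?A) powr ?q"
          using q norm_D_nonneg[OF t(2)] by (intro powr_mono2 norm_D_times_coord_line[OF \<theta> e]) auto
        also have "\<dots> \<le> 2 powr ?q * (?h x + (real i * ?A) powr ?q)"
          using q A norm_D_nonneg[OF t(1)] by (intro powr_add_le) auto
        also have "(real i * ?A) powr ?q = real i powr ?q * ?A powr ?q" using A by (simp add: powr_mult)
        also have "2 powr ?q * (?h x + real i powr ?q * ?A powr ?q)
            \<le> 2 powr ?q * (?h x + real i powr ?q * (3 powr (?q - 1) * ?H x))"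
          using power_mean_integral[OF q c] norm_D_nonneg[OF t(1)] by (intro mult_left_mono add_mono) auto
        finally show ?thesis by (simp add: b_def algebra_simps)
      qed
      have "(\<integral>\<^sup>+x. ennreal (norm_D i (times_coord j \<theta>) x powr ?q) \<partial>lborel)
          \<le> (\<integral>\<^sup>+x. ennreal (2 powr ?q) * ennreal (?h x) + ennreal b * ennreal (?H x) \<partial>lborel)"
        using pw H b by (intro nn_integral_mono) (simp add: ennreal_mult[symmetric] ennreal_plus[symmetric] del: ennreal_plus)
      also have "\<dots> = (\<integral>\<^sup>+x. ennreal (2 powr ?q) * ennreal (?h x) \<partial>lborel) + (\<integral>\<^sup>+x. ennreal b * ennreal (?H x) \<partial>lborel)"
        by (rule nn_integral_add) measurable
      also have "\<dots> = ennreal (2 powr ?q) * (\<integral>\<^sup>+x. ennreal (?h x) \<partial>lborel) + ennreal b * (3 * (\<integral>\<^sup>+x. ennreal (?h x) \<partial>lborel))"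
        using nn_integral_line_integrals[OF ch, of e] by (simp add: nn_integral_cmult)
      also have "\<dots> = ennreal C * (\<integral>\<^sup>+x. ennreal (?h x) \<partial>lborel)"
      proof -
        have "ennreal C = ennreal (2 powr ?q) + ennreal b * 3"
          using b by (simp add: C_def ennreal_mult mult.commute)
        then show ?thesis by (simp only: distrib_right mult.assoc)
      qed
      finally show "(\<integral>\<^sup>+x. ennreal (norm_D i (times_coord j \<theta>) x powr ?q) \<partial>lborel)
          \<le> ennreal C * (\<integral>\<^sup>+x. ennreal (norm_D i \<theta> x powr ?q) \<partial>lborel)" .
    qed
    moreover have "0 < C powr (1 / ?q)" using C by simp
    ultimately show ?thesis by blast
  qed
qed

section \<open>The limit of the dilations\<close>

lemma unit_tests_test_in: "\<theta> \<in> unit_tests \<nu> \<Longrightarrow> \<theta> \<in> test_functions_in (cball 0 1)"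
  by (simp add: unit_tests_def)

lemma unit_tests_test: "\<theta> \<in> unit_tests \<nu> \<Longrightarrow> \<theta> \<in> test_functions"
  using unit_tests_test_in test_functions_in_subset by blast

lemma zero_unit_tests:
  assumes "1 \<le> p"
  shows "(\<lambda>x :: real ^ 'n. 0 :: 'y::real_normed_vector) \<in> unit_tests (nu i p)"
proof -
  have z: "(\<lambda>x. 0 :: 'y) \<in> (test_functions :: (real ^ 'n \<Rightarrow> 'y) set)"
    using test_zero test_functions_in_subset by blast
  have "nu i p (\<lambda>x :: real ^ 'n. 0 :: 'y) \<le> 0" using nu_scaleR_le[OF assms z, of i 0] by simp
  then show ?thesis by (simp add: unit_tests_def test_zero)
qed

lemma dilate_test_in_unit:
  assumes "0 < \<rho>" "\<theta> \<in> test_functions_in (cball 0 \<rho>)"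
  shows "dilate 0 (inverse \<rho>) \<theta> \<in> test_functions_in (cball 0 1)"
  using dilate_test_in[of "inverse \<rho>" "inverse \<rho>" \<rho> \<theta> 0] assms by simp

text \<open>Estimates are given for functions in the unit ball with small seminorm; up to a factor and a change of the
  dilation parameter these are all test functions.\<close>
lemma unit_tests_rescaling:
  fixes \<theta> :: "real ^ 'n \<Rightarrow> 'b::real_normed_vector"
  assumes p: "1 \<le> p" and \<theta>: "\<theta> \<in> test_functions"
  obtains \<rho> b \<eta> where "0 < \<rho>" "\<eta> \<in> unit_tests (nu i p)"
    "\<And>a t. dilate a t \<theta> = (\<lambda>x. b *\<^sub>R dilate a (t * \<rho>) \<eta> x)"
proof -
  obtain \<rho> where \<rho>: "0 < \<rho>" "\<theta> \<in> test_functions_in (cball 0 \<rho>)" using test_functionsE[OF \<theta>] .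
  define \<theta>' where "\<theta>' = dilate 0 (inverse \<rho>) \<theta>"
  have t': "\<theta>' \<in> test_functions_in (cball 0 1)" unfolding \<theta>'_def by (rule dilate_test_in_unit[OF \<rho>])
  then have t'': "\<theta>' \<in> test_functions" using test_functions_in_subset by blast
  define b where "b = 1 + nu i p \<theta>'"
  have b: "0 < b" "nu i p \<theta>' \<le> b" using nu_nonneg[OF t'', of i p] by (simp_all add: b_def)
  define \<eta> where "\<eta> = (\<lambda>x. inverse b *\<^sub>R \<theta>' x)"
  have "nu i p \<eta> \<le> \<bar>inverse b\<bar> * nu i p \<theta>'" unfolding \<eta>_def by (rule nu_scaleR_le[OF p t''])
  also have "\<dots> \<le> 1" using b by (simp add: field_simps)
  finally have "\<eta> \<in> unit_tests (nu i p)"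
    unfolding unit_tests_def \<eta>_def using test_in_scaleR_const[OF compact_cball t'] by simp
  moreover have "dilate a t \<theta> = (\<lambda>x. b *\<^sub>R dilate a (t * \<rho>) \<eta> x)" for a t
    using b \<rho>(1) by (simp add: \<eta>_def dilate_scaleR \<theta>'_def dilate_dilate mult.assoc)
  ultimately show ?thesis using that \<rho>(1) by blast
qed

text \<open>The bound is asymmetric, in terms of the larger argument only, as it arises from integrating a
  derivative that is bounded on \<open>{0<..r}\<close>.\<close>
lemma tendsto_at_right_of_Cauchy_bound:
  fixes h :: "real \<Rightarrow> real"
  assumes r0: "0 < r0" and K: "0 \<le> K"
    and h: "\<And>r s. 0 < s \<Longrightarrow> s \<le> r \<Longrightarrow> r \<le> r0 \<Longrightarrow> \<bar>h r - h s\<bar> \<le> K * r"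
  shows "\<exists>L. (h \<longlongrightarrow> L) (at_right 0)"
proof -
  define s where "s n = r0 * inverse (real (Suc n))" for n
  have s0: "s \<longlonglongrightarrow> 0"
    unfolding s_def using tendsto_mult_right_zero[OF LIMSEQ_inverse_real_of_nat] .
  have s: "0 < s n" "s n \<le> r0" for n
    using r0 by (simp_all add: s_def field_simps)
  have sm: "s m \<le> s n" if "n \<le> m" for m n
    using r0 that by (simp add: s_def field_simps)
  have "Cauchy (\<lambda>n. h (s n))"
  proof (rule metric_CauchyI)
    fix e :: real assume e: "0 < e"
    have "(\<lambda>n. K * s n) \<longlonglongrightarrow> 0" using tendsto_mult_right_zero[OF s0] .
    then obtain N where N: "\<And>n. n \<ge> N \<Longrightarrow> K * s n < e / 2"
      using order_tendstoD(2)[of _ 0 sequentially "e / 2"] e by (auto simp: eventually_sequentially)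
    have d: "\<bar>h (s N) - h (s n)\<bar> < e / 2" if "n \<ge> N" for n
      using h[OF s(1) sm[OF that] s(2)] N[of N] by force
    have "dist (h (s m)) (h (s n)) < e" if "m \<ge> N" "n \<ge> N" for m n
      using d[OF that(1)] d[OF that(2)] unfolding dist_real_def by linarith
    then show "\<exists>M. \<forall>m\<ge>M. \<forall>n\<ge>M. dist (h (s m)) (h (s n)) < e" by blast
  qed
  then obtain L where L: "(\<lambda>n. h (s n)) \<longlonglongrightarrow> L" using Cauchy_convergent convergent_def by blast
  have le: "\<bar>h r - L\<bar> \<le> K * r" if r: "0 < r" "r \<le> r0" for r
  proof (rule tendsto_upperbound)
    show "(\<lambda>n. \<bar>h r - h (s n)\<bar>) \<longlonglongrightarrow> \<bar>h r - L\<bar>" by (intro tendsto_intros L)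
    have "\<forall>\<^sub>F n in sequentially. s n < r" using order_tendstoD(2)[OF s0 r(1)] .
    then show "\<forall>\<^sub>F n in sequentially. \<bar>h r - h (s n)\<bar> \<le> K * r"
      by eventually_elim (use h s r in auto)
  qed simp
  have "((\<lambda>r. h r - L) \<longlongrightarrow> 0) (at_right 0)"
  proof (rule Lim_null_comparison)
    show "\<forall>\<^sub>F r in at_right 0. norm (h r - L) \<le> K * r"
      unfolding eventually_at_right_field using le r0 by (intro exI[of _ r0]) auto
    have "((\<lambda>r. K * r) \<longlongrightarrow> K * 0) (at_right 0)" by (intro tendsto_intros)
    then show "((\<lambda>r. K * r) \<longlongrightarrow> 0) (at_right 0)" by simp
  qed
  then show ?thesis using LIM_zero_cancel by blast
qed

lemma pair_polyf_tendsto: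
  fixes f :: "real ^ 'n \<Rightarrow> 'b::real_normed_vector \<Rightarrow>\<^sub>L real"
  assumes "polyf d f" "\<theta> \<in> test_functions"
  shows "\<exists>l. ((\<lambda>t. pair f t \<theta>) \<longlongrightarrow> l) (at 0)"
  using assms
proof (induction arbitrary: \<theta> rule: polyf.induct)
  case (const d c)
  have "(\<lambda>t. pair (\<lambda>_. c) t \<theta>) = (\<lambda>t. pair (\<lambda>_. c) 0 \<theta>)" by (simp add: pair_def)
  then show ?case by (metis tendsto_const)
next
  case (add d f g)
  then obtain l m where "((\<lambda>t. pair f t \<theta>) \<longlongrightarrow> l) (at 0)" "((\<lambda>t. pair g t \<theta>) \<longlongrightarrow> m) (at 0)" by blast
  then have "((\<lambda>t. pair f t \<theta> + pair g t \<theta>) \<longlongrightarrow> l + m) (at 0)" by (rule tendsto_add)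
  then show ?case using add by (auto simp: pair_add_left polyf_continuous)
next
  case (coord d f j)
  then obtain l where "((\<lambda>t. pair f t (times_coord j \<theta>)) \<longlongrightarrow> l) (at 0)" using test_times_coord by blast
  then have "((\<lambda>t. t * pair f t (times_coord j \<theta>)) \<longlongrightarrow> 0 * l) (at 0)" by (intro tendsto_mult tendsto_ident_at)
  then show ?case by (auto simp: pair_coord)
qed

lemma pair_mult_bump_bound:
  fixes g :: "real ^ 'n \<Rightarrow> 'b::real_normed_vector \<Rightarrow>\<^sub>L real" and \<phi> :: "real ^ 'n \<Rightarrow> real"
  assumes g: "continuous_on UNIV g" and \<phi>: "\<phi> \<in> test_functions"
  shows "\<exists>K. \<forall>y. norm y \<le> 1 \<longrightarrow> \<bar>pair g r (\<lambda>x. \<phi> x *\<^sub>R y)\<bar> \<le> K"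
proof -
  obtain \<rho> where \<rho>: "\<phi> \<in> test_functions_in (cball 0 \<rho>)" using test_functionsE[OF \<phi>] .
  have c\<phi>: "continuous_on UNIV \<phi>" by (intro smooth_continuous_on test_functions_smooth \<phi>)
  have c: "continuous_on UNIV (\<lambda>x. norm (g (r *\<^sub>R x)) * \<bar>\<phi> x\<bar>)"
    by (intro continuous_intros c\<phi> continuous_on_compose2[OF g]) auto
  have int: "integrable lebesgue (\<lambda>x. norm (g (r *\<^sub>R x)) * \<bar>\<phi> x\<bar>)"
    by (rule integrable_lebesgue_compact_support[OF c, of \<rho>]) (use \<rho> in \<open>simp add: test_functions_in_cball_iff\<close>)
  have "\<bar>pair g r (\<lambda>x. \<phi> x *\<^sub>R y)\<bar> \<le> (LINT x|lebesgue. norm (g (r *\<^sub>R x)) * \<bar>\<phi> x\<bar>)" if y: "norm y \<le> 1" for y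
  proof -
    have t: "(\<lambda>x. \<phi> x *\<^sub>R y) \<in> test_functions"
    proof -
      have "(\<lambda>x. \<phi> x *\<^sub>R y) \<in> test_functions_in (cball 0 \<rho>)"
        using \<rho> smooth_scaleR[OF test_functions_smooth[OF \<phi>] smooth_const[of y]]
        by (simp add: test_functions_in_cball_iff)
      then show ?thesis using test_functions_in_subset by blast
    qed
    have "\<bar>pair g r (\<lambda>x. \<phi> x *\<^sub>R y)\<bar> \<le> (LINT x|lebesgue. \<bar>blinfun_apply (g (r *\<^sub>R x)) (\<phi> x *\<^sub>R y)\<bar>)"
      unfolding pair_def by (rule integral_abs_bound)
    also have "\<dots> \<le> (LINT x|lebesgue. norm (g (r *\<^sub>R x)) * \<bar>\<phi> x\<bar>)"
    proof (rule integral_mono[OF integrable_abs[OF pair_integrand(2)[OF g t]] int])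
      fix x
      have "\<bar>blinfun_apply (g (r *\<^sub>R x)) (\<phi> x *\<^sub>R y)\<bar> \<le> norm (g (r *\<^sub>R x)) * norm (\<phi> x *\<^sub>R y)"
        using norm_blinfun[of "g (r *\<^sub>R x)" "\<phi> x *\<^sub>R y"] by simp
      also have "norm (\<phi> x *\<^sub>R y) \<le> \<bar>\<phi> x\<bar> * 1" unfolding norm_scaleR using y by (intro mult_left_mono) auto
      finally show "\<bar>blinfun_apply (g (r *\<^sub>R x)) (\<phi> x *\<^sub>R y)\<bar> \<le> norm (g (r *\<^sub>R x)) * \<bar>\<phi> x\<bar>"
        by (simp add: mult_left_mono)
    qed
    finally show ?thesis .
  qed
  then show ?thesis by blast
qed

lemma Dmult_scaleR_vector:
  fixes \<phi> :: "real ^ 'n \<Rightarrow> real"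
  assumes "smooth \<phi>"
  shows "Dmult (\<lambda>x. \<phi> x *\<^sub>R y) vs = (\<lambda>x. Dmult \<phi> vs x *\<^sub>R y)"
  by (rule Dmult_linear_comp[OF bounded_linear_scaleR_left assms])

text \<open>The error in approximating \<open>D\<^sub>j S\<close> by the polynomial \<open>f j\<close> at scale \<open>t\<close>.\<close>
definition deriv_defect ::
    "((real ^ 'n \<Rightarrow> 'b::real_normed_vector) \<Rightarrow> real) \<Rightarrow> ('n \<Rightarrow> real ^ 'n \<Rightarrow> 'b \<Rightarrow>\<^sub>L real) \<Rightarrow> real ^ 'n
      \<Rightarrow> 'n \<Rightarrow> real \<Rightarrow> (real ^ 'n \<Rightarrow> 'b) \<Rightarrow> real" where
  "deriv_defect S f a j t \<theta> = - S (dir_deriv (axis j 1) (dilate a t \<theta>)) - pair (f j) t \<theta>"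

text \<open>The bound \<open>M\<close> only serves to establish the limit \<open>L\<close>, which has to exist before sharper bounds for the
  defects, one for each \<open>\<epsilon>\<close>, can be turned into bounds for the distance from it.\<close>
locale derivs_approx =
  fixes S :: "(real ^ 'n \<Rightarrow> 'y::banach) \<Rightarrow> real" and f :: "'n \<Rightarrow> real ^ 'n \<Rightarrow> 'y \<Rightarrow>\<^sub>L real"
    and a :: "real ^ 'n" and d i :: nat and p :: ennreal and r0 M :: real
  assumes S: "dist_bounded S" and f: "\<And>j. polyf d (f j)" and p: "1 \<le> p" and r0: "0 < r0"
    and M: "\<And>t \<theta> j. 0 < t \<Longrightarrow> t \<le> r0 \<Longrightarrow> \<theta> \<in> unit_tests (nu i p) \<Longrightarrow> \<bar>deriv_defect S f a j t \<theta>\<bar> \<le> M"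
begin

lemma S_scaleR: "\<theta> \<in> test_functions \<Longrightarrow> S (\<lambda>x. c *\<^sub>R \<theta> x) = c * S \<theta>"
  by (rule dist_bounded_scaleR[OF S])

lemmas zero_unit = zero_unit_tests[OF p, of i]

lemma M_nonneg: "0 \<le> M"
  using M[OF r0 order_refl zero_unit, of undefined] by linarith

lemma defect_scaleR:
  assumes "0 < t" "\<theta> \<in> test_functions"
  shows "deriv_defect S f a j t (\<lambda>x. c *\<^sub>R \<theta> x) = c * deriv_defect S f a j t \<theta>"
proof -
  have "dir_deriv (axis j 1) (dilate a t (\<lambda>x. c *\<^sub>R \<theta> x)) = (\<lambda>x. c *\<^sub>R dir_deriv (axis j 1) (dilate a t \<theta>) x)"
    unfolding dilate_scaleR using assms
    by (intro dir_deriv_linear_comp bounded_linear_scaleR_right smooth_differentiable smooth_dilate test_functions_smooth)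
  then show ?thesis
    using assms by (simp add: deriv_defect_def S_scaleR test_dir_deriv dilate_test pair_scaleR_right algebra_simps)
qed

text \<open>A radial primitive of \<open>f j\<close>: the derivative of \<open>t q j(t x)\<close> in \<open>t\<close> is \<open>f j(t x)\<close>, in the weak sense.\<close>
definition q where
  "q j = (SOME q. polyf d q \<and> (\<forall>\<theta>\<in>test_functions. \<forall>t.
    ((\<lambda>t. t * pair q t \<theta>) has_real_derivative pair (f j) t \<theta>) (at t)))"

lemma q: "polyf d (q j)"
  "\<theta> \<in> test_functions \<Longrightarrow> ((\<lambda>t. t * pair (q j) t \<theta>) has_real_derivative pair (f j) t \<theta>) (at t)"
proof -
  have "\<exists>q. polyf d q \<and> (\<forall>\<theta>\<in>test_functions. \<forall>t.
    ((\<lambda>t. t * pair q t \<theta>) has_real_derivative pair (f j) t \<theta>) (at t))"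
    using polyf_radial_primitive[OF f[of j], of 0] by simp
  from someI_ex[OF this]
  show "polyf d (q j)" "\<theta> \<in> test_functions \<Longrightarrow> ((\<lambda>t. t * pair (q j) t \<theta>) has_real_derivative pair (f j) t \<theta>) (at t)"
    unfolding q_def[symmetric] by blast+
qed

definition g0 :: "real ^ 'n \<Rightarrow> 'y \<Rightarrow>\<^sub>L real" where
  "g0 u = (\<Sum>j\<in>UNIV. u $ j *\<^sub>R q j u)"

lemma polyf_g0: "polyf (Suc d) g0"
  unfolding g0_def[abs_def] by (intro polyf_sum polyf.coord q)

lemma pair_g0:
  assumes "\<theta> \<in> test_functions"
  shows "pair g0 t \<theta> = (\<Sum>j\<in>UNIV. t * pair (q j) t (times_coord j \<theta>))"
  unfolding g0_def[abs_def]
  by (subst pair_sum_left)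
     (auto simp: pair_coord assms intro!: polyf_continuous polyf.coord q)

lemma pair_g0_tendsto: 
  assumes "\<theta> \<in> test_functions"
  shows "((\<lambda>t. pair g0 t \<theta>) \<longlongrightarrow> 0) (at_right 0)"
proof -
  have "((\<lambda>t. t * pair (q j) t (times_coord j \<theta>)) \<longlongrightarrow> 0 * pair (q j) 0 (times_coord j \<theta>)) (at_right 0)" for j
  proof -
    have "((\<lambda>t. t * pair (q j) t (times_coord j \<theta>)) has_real_derivative pair (f j) 0 (times_coord j \<theta>)) (at 0)"
      by (rule q(2)[OF test_times_coord[OF assms]])
    from DERIV_isCont[OF this] show ?thesis
      unfolding isCont_def by (rule tendsto_within_subset) simp
  qed
  then have "((\<lambda>t. \<Sum>j\<in>UNIV. t * pair (q j) t (times_coord j \<theta>)) \<longlongrightarrow> (\<Sum>j\<in>(UNIV :: 'n set). 0)) (at_right 0)"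
    by (intro tendsto_sum) simp
  then show ?thesis by (simp add: pair_g0[OF assms])
qed

definition h :: "(real ^ 'n \<Rightarrow> 'y) \<Rightarrow> real \<Rightarrow> real" where
  "h \<theta> t = S (dilate a t \<theta>) - pair g0 t \<theta>"

text \<open>The radial derivative of \<open>g0\<close> cancels the polynomial parts of the derivatives of \<open>S\<close>, so that only the
  defects at \<open>x\<^sub>j \<theta>\<close> remain.\<close>
lemma h_DERIV:
  assumes \<theta>: "\<theta> \<in> test_functions" and t: "0 < t"
  shows "(h \<theta> has_real_derivative (\<Sum>j\<in>UNIV. deriv_defect S f a j t (times_coord j \<theta>))) (at t)"
proof -
  note tc = test_times_coord[OF \<theta>]
  have eq: "S (dilate a t (dir_deriv (axis j 1) (times_coord j \<theta>))) = t * S (dir_deriv (axis j 1) (dilate a t (times_coord j \<theta>)))" for j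
    using t by (simp add: dir_deriv_dilate test_functions_smooth tc S_scaleR dilate_test test_dir_deriv)
  have "S (dilate a t (euler \<theta>)) = (\<Sum>j\<in>UNIV. S (dilate a t (dir_deriv (axis j 1) (times_coord j \<theta>))))"
    unfolding euler_def[abs_def] dilate_sum
    by (intro dist_bounded_sum[OF S] dilate_test test_dir_deriv tc t)
  then have "- inverse t * S (dilate a t (euler \<theta>)) = (\<Sum>j\<in>UNIV. - S (dir_deriv (axis j 1) (dilate a t (times_coord j \<theta>))))"
    using t by (simp add: eq sum_distrib_left[symmetric] sum_negf)
  with dist_bounded_dilate_DERIV[OF S \<theta> t, of a]
  have 1: "((\<lambda>t. S (dilate a t \<theta>)) has_real_derivative
      (\<Sum>j\<in>UNIV. - S (dir_deriv (axis j 1) (dilate a t (times_coord j \<theta>))))) (at t)" by simp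
  have "((\<lambda>t. \<Sum>j\<in>UNIV. t * pair (q j) t (times_coord j \<theta>)) has_real_derivative
      (\<Sum>j\<in>UNIV. pair (f j) t (times_coord j \<theta>))) (at t)"
    by (intro DERIV_sum q tc)
  from DERIV_diff[OF 1 this] show ?thesis
    by (simp add: h_def[abs_def] pair_g0[OF \<theta>] deriv_defect_def sum_subtractf sum_negf)
qed

definition C1 where
  "C1 = (SOME C. 0 < C \<and> (\<forall>\<theta>\<in>test_functions_in (cball 0 1). \<forall>j.
    nu i p (times_coord j \<theta> :: real ^ 'n \<Rightarrow> 'y) \<le> C * nu i p \<theta>))"

lemma C1: "0 < C1" "\<theta> \<in> test_functions_in (cball 0 1) \<Longrightarrow> nu i p (times_coord j \<theta> :: real ^ 'n \<Rightarrow> 'y) \<le> C1 * nu i p \<theta>"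
  using someI_ex[OF nu_times_coord[OF p, of i, where ?'n = 'n and ?'b = 'y]] unfolding C1_def[symmetric] by blast+

lemma times_coord_unit:
  fixes \<theta> :: "real ^ 'n \<Rightarrow> 'y"
  assumes "\<theta> \<in> unit_tests (nu i p)"
  shows "(\<lambda>x. inverse C1 *\<^sub>R times_coord j \<theta> x) \<in> unit_tests (nu i p)"
proof -
  have \<theta>: "\<theta> \<in> test_functions_in (cball 0 1)" "nu i p \<theta> \<le> 1" using assms by (auto simp: unit_tests_def)
  have tt: "times_coord j \<theta> \<in> test_functions" by (intro test_times_coord unit_tests_test[OF assms])
  have "nu i p (\<lambda>x. inverse C1 *\<^sub>R times_coord j \<theta> x) \<le> \<bar>inverse C1\<bar> * nu i p (times_coord j \<theta>)"
    by (rule nu_scaleR_le[OF p tt])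
  also have "\<dots> \<le> \<bar>inverse C1\<bar> * (C1 * nu i p \<theta>)" by (intro mult_left_mono C1(2)[OF \<theta>(1)]) simp
  also have "\<dots> = nu i p \<theta>" using C1(1) by simp
  also have "\<dots> \<le> 1" by (rule \<theta>(2))
  finally show ?thesis
    using test_in_scaleR_const[OF compact_cball test_in_times_coord[OF \<theta>(1)]] by (simp add: unit_tests_def)
qed

lemma h_increment:
  assumes \<epsilon>: "\<And>t \<theta> j. 0 < t \<Longrightarrow> t \<le> r \<Longrightarrow> \<theta> \<in> unit_tests (nu i p) \<Longrightarrow> \<bar>deriv_defect S f a j t \<theta>\<bar> \<le> B"
    and s: "0 < s" "s \<le> r" and \<theta>: "\<theta> \<in> unit_tests (nu i p)"
  shows "\<bar>h \<theta> r - h \<theta> s\<bar> \<le> real CARD('n) * C1 * B * r"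
proof -
  have tt: "\<theta> \<in> test_functions" by (rule unit_tests_test[OF \<theta>])
  have B: "0 \<le> B" using \<epsilon>[OF s zero_unit, of undefined] by linarith
  have le: "\<bar>\<Sum>j\<in>UNIV. deriv_defect S f a j t (times_coord j \<theta>)\<bar> \<le> real CARD('n) * C1 * B" if t: "0 < t" "t \<le> r" for t
  proof -
    have "\<bar>deriv_defect S f a j t (times_coord j \<theta>)\<bar> \<le> C1 * B" for j
    proof -
      have "\<bar>inverse C1 * deriv_defect S f a j t (times_coord j \<theta>)\<bar> \<le> B"
        using \<epsilon>[OF t times_coord_unit[OF \<theta>, of j], of j] defect_scaleR[OF t(1) test_times_coord[OF tt, of j], of j "inverse C1"]
        by simp
      then have "\<bar>deriv_defect S f a j t (times_coord j \<theta>)\<bar> / C1 \<le> B"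
        using C1(1) by (simp add: abs_mult divide_inverse mult.commute)
      then show ?thesis using C1(1) by (simp add: pos_divide_le_eq mult.commute)
    qed
    then have "(\<Sum>j\<in>(UNIV :: 'n set). \<bar>deriv_defect S f a j t (times_coord j \<theta>)\<bar>) \<le> of_nat CARD('n) * (C1 * B)"
      by (intro sum_bounded_above) auto
    from order_trans[OF sum_abs this] show ?thesis by (simp add: mult.assoc)
  qed
  have "norm (h \<theta> r - h \<theta> s) \<le> real CARD('n) * C1 * B * norm (r - s)"
  proof (rule field_differentiable_bound[of "{s..r}"])
    fix t assume "t \<in> {s..r}"
    then have t: "0 < t" "t \<le> r" using s by auto
    show "(h \<theta> has_field_derivative (\<Sum>j\<in>UNIV. deriv_defect S f a j t (times_coord j \<theta>))) (at t within {s..r})"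
      by (rule has_field_derivative_at_within[OF h_DERIV[OF tt t(1)]])
    show "norm (\<Sum>j\<in>UNIV. deriv_defect S f a j t (times_coord j \<theta>)) \<le> real CARD('n) * C1 * B"
      using le[OF t] by simp
  qed (use s in auto)
  also have "\<dots> \<le> real CARD('n) * C1 * B * r" using s B C1(1) by (intro mult_left_mono) auto
  finally show ?thesis by simp
qed

definition L :: "(real ^ 'n \<Rightarrow> 'y) \<Rightarrow> real" where
  "L \<theta> = (THE l. ((\<lambda>t. S (dilate a t \<theta>)) \<longlongrightarrow> l) (at_right 0))"

lemma L_eqI: "((\<lambda>t. S (dilate a t \<theta>)) \<longlongrightarrow> l) (at_right 0) \<Longrightarrow> L \<theta> = l"
  unfolding L_def by (rule the_equality) (auto intro: tendsto_unique[OF trivial_limit_at_right_real])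

lemma rescale_tendsto:
  fixes F :: "real \<Rightarrow> real"
  assumes "0 < \<rho>" "(F \<longlongrightarrow> l) (at_right 0)"
  shows "((\<lambda>t. F (t * \<rho>)) \<longlongrightarrow> l) (at_right 0)"
proof (rule filterlim_compose[OF assms(2)])
  have "((\<lambda>t. t * \<rho>) \<longlongrightarrow> 0 * \<rho>) (at_right 0)" by (intro tendsto_intros)
  then show "filterlim (\<lambda>t. t * \<rho>) (at_right 0) (at_right 0)"
    using assms(1) by (auto simp: filterlim_at eventually_at_right_less intro!: eventually_mono[OF eventually_at_right_less])
qed

lemma S_dilate_rescale:
  assumes "0 < t" "0 < \<rho>" "\<eta> \<in> test_functions" "dilate a t \<theta> = (\<lambda>x. b *\<^sub>R dilate a (t * \<rho>) \<eta> x)"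
  shows "S (dilate a t \<theta>) = b * S (dilate a (t * \<rho>) \<eta>)"
  using assms by (simp add: S_scaleR dilate_test)

lemma L_tendsto_unit:
  assumes "\<theta> \<in> unit_tests (nu i p)"
  shows "((\<lambda>t. S (dilate a t \<theta>)) \<longlongrightarrow> L \<theta>) (at_right 0)"
    and "(h \<theta> \<longlongrightarrow> L \<theta>) (at_right 0)"
proof -
  have tt: "\<theta> \<in> test_functions" by (rule unit_tests_test[OF assms])
  have "\<exists>l. (h \<theta> \<longlongrightarrow> l) (at_right 0)"
  proof (rule tendsto_at_right_of_Cauchy_bound[OF r0])
    show "0 \<le> real CARD('n) * C1 * M" using C1(1) M_nonneg by simp
    show "\<bar>h \<theta> r - h \<theta> s\<bar> \<le> real CARD('n) * C1 * M * r" if "0 < s" "s \<le> r" "r \<le> r0" for r s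
      using that by (intro h_increment[OF _ that(1,2) assms] M) auto
  qed
  then obtain l where l: "(h \<theta> \<longlongrightarrow> l) (at_right 0)" by blast
  have "((\<lambda>t. h \<theta> t + pair g0 t \<theta>) \<longlongrightarrow> l + 0) (at_right 0)"
    by (intro tendsto_add l pair_g0_tendsto[OF tt])
  then have "((\<lambda>t. S (dilate a t \<theta>)) \<longlongrightarrow> l) (at_right 0)" by (simp add: h_def)
  then show "((\<lambda>t. S (dilate a t \<theta>)) \<longlongrightarrow> L \<theta>) (at_right 0)" "(h \<theta> \<longlongrightarrow> L \<theta>) (at_right 0)"
    using L_eqI l by auto
qed

lemma L_tendsto:
  assumes "\<theta> \<in> test_functions"
  shows "((\<lambda>t. S (dilate a t \<theta>)) \<longlongrightarrow> L \<theta>) (at_right 0)"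
proof -
  obtain \<rho> b \<eta> where \<rho>: "0 < \<rho>" and \<eta>: "\<eta> \<in> unit_tests (nu i p)"
    and eq: "\<And>a t. dilate a t \<theta> = (\<lambda>x. b *\<^sub>R dilate a (t * \<rho>) \<eta> x)"
    using unit_tests_rescaling[OF p assms, of i] by metis
  have "((\<lambda>t. b * S (dilate a (t * \<rho>) \<eta>)) \<longlongrightarrow> b * L \<eta>) (at_right 0)"
    by (intro tendsto_mult tendsto_const rescale_tendsto[OF \<rho>, of "\<lambda>t. S (dilate a t \<eta>)"] L_tendsto_unit \<eta>)
  then have "((\<lambda>t. S (dilate a t \<theta>)) \<longlongrightarrow> b * L \<eta>) (at_right 0)"
  proof (rule Lim_transform_eventually)
    show "\<forall>\<^sub>F t in at_right 0. b * S (dilate a (t * \<rho>) \<eta>) = S (dilate a t \<theta>)"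
      using eventually_at_right_less[of 0]
      by eventually_elim (simp add: S_dilate_rescale[OF _ \<rho> unit_tests_test[OF \<eta>] eq])
  qed
  with L_eqI show ?thesis by metis
qed

lemma S_deriv_tendsto_unit:
  assumes "\<theta> \<in> unit_tests (nu i p)"
  shows "((\<lambda>t. t * S (dir_deriv (axis j 1) (dilate a t \<theta>))) \<longlongrightarrow> 0) (at_right 0)"
proof -
  obtain l where l: "((\<lambda>t. pair (f j) t \<theta>) \<longlongrightarrow> l) (at 0)"
    using pair_polyf_tendsto[OF f unit_tests_test[OF assms]] by blast
  have "((\<lambda>t. t * pair (f j) t \<theta>) \<longlongrightarrow> 0 * l) (at 0)" by (intro tendsto_mult tendsto_ident_at l)
  then have 1: "((\<lambda>t. t * pair (f j) t \<theta>) \<longlongrightarrow> 0) (at_right 0)"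
    using tendsto_within_subset[of _ _ 0 UNIV "{0<..}"] by simp
  have 2: "((\<lambda>t. t * deriv_defect S f a j t \<theta>) \<longlongrightarrow> 0) (at_right 0)"
  proof (rule Lim_null_comparison)
    show "\<forall>\<^sub>F t in at_right 0. norm (t * deriv_defect S f a j t \<theta>) \<le> t * M"
      unfolding eventually_at_right_field using r0 M[OF _ _ assms, of _ j]
      by (intro exI[of _ r0]) (auto simp: abs_mult intro!: mult_left_mono)
    have "((\<lambda>t. t * M) \<longlongrightarrow> 0 * M) (at_right 0)" by (intro tendsto_intros)
    then show "((\<lambda>t. t * M) \<longlongrightarrow> 0) (at_right 0)" by simp
  qed
  have "((\<lambda>t. - (t * deriv_defect S f a j t \<theta> + t * pair (f j) t \<theta>)) \<longlongrightarrow> - (0 + 0)) (at_right 0)"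
    by (intro tendsto_minus tendsto_add 1 2)
  then show ?thesis by (simp add: deriv_defect_def algebra_simps)
qed

text \<open>A derivative of a dilation carries a factor \<open>1/t\<close>, so \<open>S\<close> applied to the dilated derivative is \<open>t\<close> times
  a bounded quantity.\<close>
lemma L_kills_derivatives: "kills_derivatives L"
  unfolding kills_derivatives_def
proof (intro conjI ballI allI)
  fix \<theta> \<eta> :: "real ^ 'n \<Rightarrow> 'y" assume t: "\<theta> \<in> test_functions" "\<eta> \<in> test_functions"
  have "((\<lambda>t. S (dilate a t \<theta>) + S (dilate a t \<eta>)) \<longlongrightarrow> L \<theta> + L \<eta>) (at_right 0)"
    by (intro tendsto_add L_tendsto t)
  then show "L (\<lambda>x. \<theta> x + \<eta> x) = L \<theta> + L \<eta>"
  proof (intro L_eqI, elim Lim_transform_eventually)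
    show "\<forall>\<^sub>F s in at_right 0. S (dilate a s \<theta>) + S (dilate a s \<eta>) = S (dilate a s (\<lambda>x. \<theta> x + \<eta> x))"
      using eventually_at_right_less[of 0]
      by eventually_elim (simp add: dilate_add dist_bounded_add[OF S] dilate_test t)
  qed
next
  fix \<theta> :: "real ^ 'n \<Rightarrow> 'y" and j assume t: "\<theta> \<in> test_functions"
  obtain \<rho> b \<eta> where \<rho>: "0 < \<rho>" and \<eta>: "\<eta> \<in> unit_tests (nu i p)"
    and eq: "\<And>a t. dilate a t \<theta> = (\<lambda>x. b *\<^sub>R dilate a (t * \<rho>) \<eta> x)"
    using unit_tests_rescaling[OF p t, of i] by metis
  let ?D = "dir_deriv (axis j 1) :: (real ^ 'n \<Rightarrow> 'y) \<Rightarrow> real ^ 'n \<Rightarrow> 'y"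
  note te = unit_tests_test[OF \<eta>]
  have "((\<lambda>t. (b * inverse \<rho>) * ((t * \<rho>) * S (?D (dilate a (t * \<rho>) \<eta>)))) \<longlongrightarrow> (b * inverse \<rho>) * 0) (at_right 0)"
    by (intro tendsto_mult tendsto_const rescale_tendsto[OF \<rho>, of "\<lambda>t. t * S (?D (dilate a t \<eta>))"] S_deriv_tendsto_unit \<eta>)
  then have "((\<lambda>t. S (dilate a t (?D \<theta>))) \<longlongrightarrow> (b * inverse \<rho>) * 0) (at_right 0)"
  proof (rule Lim_transform_eventually)
    show "\<forall>\<^sub>F t in at_right 0. (b * inverse \<rho>) * ((t * \<rho>) * S (?D (dilate a (t * \<rho>) \<eta>))) = S (dilate a t (?D \<theta>))"
      using eventually_at_right_less[of 0]
    proof eventually_elim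
      case (elim s)
      have "S (dilate a s (?D \<theta>)) = s * S (?D (dilate a s \<theta>))"
        using elim t by (simp add: dir_deriv_dilate test_functions_smooth S_scaleR dilate_test test_dir_deriv)
      also have "?D (dilate a s \<theta>) = (\<lambda>x. b *\<^sub>R ?D (dilate a (s * \<rho>) \<eta>) x)"
        unfolding eq
        by (intro dir_deriv_linear_comp bounded_linear_scaleR_right smooth_differentiable smooth_dilate test_functions_smooth te)
      also have "S \<dots> = b * S (?D (dilate a (s * \<rho>) \<eta>))"
        using elim \<rho> te by (intro S_scaleR test_dir_deriv dilate_test) auto
      finally show ?case using \<rho> by simp
    qed
  qed
  then show "L (?D \<theta>) = 0" using L_eqI by fastforce
qed

lemma bump_vector_unit:
  obtains \<rho> b \<phi> where "0 < \<rho>" "\<phi> \<in> test_functions"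
    "\<And>y :: 'y. norm y \<le> 1 \<Longrightarrow> (\<lambda>x. \<phi> x *\<^sub>R y) \<in> unit_tests (nu i p)"
    "\<And>t (y :: 'y). dilate a t (\<lambda>x. bump_prod x *\<^sub>R y) = (\<lambda>x. b *\<^sub>R dilate a (t * \<rho>) (\<lambda>x. \<phi> x *\<^sub>R y) x)"
proof -
  have bp: "(bump_prod :: real ^ 'n \<Rightarrow> real) \<in> test_functions" using bump_prod_test[of "1 :: real"] by simp
  obtain \<rho> b \<phi> where \<rho>: "0 < \<rho>" and \<phi>: "\<phi> \<in> unit_tests (nu i p)"
    and eq: "\<And>a t. dilate a t (bump_prod :: real ^ 'n \<Rightarrow> real) = (\<lambda>x. b *\<^sub>R dilate a (t * \<rho>) \<phi> x)"
    using unit_tests_rescaling[OF p bp, of i] by metis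
  note t\<phi> = unit_tests_test[OF \<phi>]
  have "(\<lambda>x. \<phi> x *\<^sub>R y) \<in> unit_tests (nu i p)" if y: "norm y \<le> 1" for y :: 'y
  proof -
    have ti: "(\<lambda>x. \<phi> x *\<^sub>R y) \<in> test_functions_in (cball 0 1)"
      using unit_tests_test_in[OF \<phi>] smooth_scaleR[OF test_functions_smooth[OF t\<phi>] smooth_const[of y]]
      by (simp add: test_functions_in_cball_iff)
    then have tt: "(\<lambda>x. \<phi> x *\<^sub>R y) \<in> test_functions" using test_functions_in_subset by blast
    have "norm_D i (\<lambda>x. \<phi> x *\<^sub>R y) x \<le> 1 * norm_D i \<phi> x" for x
    proof (rule norm_D_least)
      fix vs :: "(real ^ 'n) list" assume vs: "length vs = i" "\<forall>v\<in>set vs. norm v \<le> 1"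
      have "norm (Dmult \<phi> vs x) * norm y \<le> norm_D i \<phi> x * 1"
        using y by (intro mult_mono norm_D_upper t\<phi> vs norm_D_nonneg) auto
      then show "norm (Dmult (\<lambda>x. \<phi> x *\<^sub>R y) vs x) \<le> 1 * norm_D i \<phi> x"
        by (simp add: Dmult_scaleR_vector test_functions_smooth t\<phi>)
    qed
    then have "nu i p (\<lambda>x. \<phi> x *\<^sub>R y) \<le> 1 * nu i p \<phi>" by (intro nu_mono p tt t\<phi>) auto
    then show ?thesis using ti \<phi> by (simp add: unit_tests_def)
  qed
  moreover have "dilate a t (\<lambda>x. bump_prod x *\<^sub>R y) = (\<lambda>x. b *\<^sub>R dilate a (t * \<rho>) (\<lambda>x. \<phi> x *\<^sub>R y) x)" for t and y :: 'y
  proof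
    fix x
    have "dilate a t (\<lambda>x. bump_prod x *\<^sub>R y) x = dilate a t bump_prod x *\<^sub>R y" by (simp add: dilate_def)
    also have "\<dots> = b *\<^sub>R dilate a (t * \<rho>) (\<lambda>x. \<phi> x *\<^sub>R y) x" unfolding eq by (simp add: dilate_def)
    finally show "dilate a t (\<lambda>x. bump_prod x *\<^sub>R y) x = b *\<^sub>R dilate a (t * \<rho>) (\<lambda>x. \<phi> x *\<^sub>R y) x" .
  qed
  ultimately show ?thesis using that[OF \<rho> t\<phi>] by blast
qed

lemma L_scaleR:
  assumes "\<theta> \<in> test_functions"
  shows "L (\<lambda>x. c *\<^sub>R \<theta> x) = c * L \<theta>"
proof (rule L_eqI)
  have "((\<lambda>t. c * S (dilate a t \<theta>)) \<longlongrightarrow> c * L \<theta>) (at_right 0)"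
    by (intro tendsto_mult tendsto_const L_tendsto assms)
  then show "((\<lambda>t. S (dilate a t (\<lambda>x. c *\<^sub>R \<theta> x))) \<longlongrightarrow> c * L \<theta>) (at_right 0)"
  proof (rule Lim_transform_eventually)
    show "\<forall>\<^sub>F t in at_right 0. c * S (dilate a t \<theta>) = S (dilate a t (\<lambda>x. c *\<^sub>R \<theta> x))"
      using eventually_at_right_less[of 0] by eventually_elim (simp add: dilate_scaleR S_scaleR dilate_test assms)
  qed
qed

text \<open>One scale \<open>r0\<close> and one normalisation of the bump function serve for all \<open>y\<close> in the unit ball: then
  \<open>L\<close> differs from the value of \<open>S\<close> at this scale by a bounded amount, and \<open>S\<close> is continuous.\<close>
lemma L_bump_bounded: "\<exists>K. \<forall>y :: 'y. norm y \<le> 1 \<longrightarrow> \<bar>L (\<lambda>x. bump_prod x *\<^sub>R y)\<bar> \<le> K"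
proof -
  obtain \<rho> b \<phi> where \<rho>: "0 < \<rho>" and \<phi>: "\<phi> \<in> test_functions"
    and unit: "\<And>y :: 'y. norm y \<le> 1 \<Longrightarrow> (\<lambda>x. \<phi> x *\<^sub>R y) \<in> unit_tests (nu i p)"
    and eq: "\<And>t (y :: 'y). dilate a t (\<lambda>x. bump_prod x *\<^sub>R y) = (\<lambda>x. b *\<^sub>R dilate a (t * \<rho>) (\<lambda>x. \<phi> x *\<^sub>R y) x)"
    using bump_vector_unit by metis
  let ?\<phi> = "\<lambda>y x. \<phi> x *\<^sub>R (y :: 'y)"
  define R where "R = norm a + r0 * 1"
  have "0 < R" using r0 by (simp add: R_def add_nonneg_pos)
  then obtain N C where NC: "\<And>\<theta> B. \<theta> \<in> test_functions_in (cball 0 R) \<Longrightarrow> 0 \<le> B \<Longrightarrow> derivs_le N B \<theta> \<Longrightarrow> \<bar>S \<theta>\<bar> \<le> C * B"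
    using S unfolding dist_bounded_def by meson
  have d\<phi>: "dilate a r0 \<phi> \<in> test_functions" by (rule dilate_test[OF r0 \<phi>])
  obtain B where B: "0 \<le> B" "derivs_le N B (dilate a r0 \<phi>)" using test_derivs_le[OF d\<phi>] by blast
  obtain K where K: "\<And>y :: 'y. norm y \<le> 1 \<Longrightarrow> \<bar>pair g0 r0 (?\<phi> y)\<bar> \<le> K"
    using pair_mult_bump_bound[OF polyf_continuous[OF polyf_g0] \<phi>, of r0] by blast
  let ?K = "C * B + K + real CARD('n) * C1 * M * r0"
  have "\<bar>L (?\<phi> y)\<bar> \<le> ?K" if y: "norm y \<le> 1" for y
  proof -
    have "derivs_le N B (dilate a r0 (?\<phi> y))"
      unfolding derivs_le_def
    proof (intro allI impI)
      fix vs :: "(real ^ 'n) list" and x assume "length vs \<le> N" "\<forall>v\<in>set vs. norm v \<le> 1"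
      then have "norm (Dmult (dilate a r0 \<phi>) vs x) * norm y \<le> B * 1"
        using y B(1) by (intro mult_mono derivs_leD[OF B(2)]) auto
      moreover have "dilate a r0 (?\<phi> y) = (\<lambda>x. dilate a r0 \<phi> x *\<^sub>R y)" by (simp add: dilate_def fun_eq_iff)
      ultimately show "norm (Dmult (dilate a r0 (?\<phi> y)) vs x) \<le> B"
        by (simp add: Dmult_scaleR_vector test_functions_smooth[OF d\<phi>])
    qed
    moreover have "dilate a r0 (?\<phi> y) \<in> test_functions_in (cball 0 R)"
      unfolding R_def by (intro dilate_test_in r0 unit_tests_test_in[OF unit[OF y]]) simp_all
    ultimately have "\<bar>S (dilate a r0 (?\<phi> y))\<bar> \<le> C * B" using NC B(1) by blast
    then have h: "\<bar>h (?\<phi> y) r0\<bar> \<le> C * B + K" using K[OF y] unfolding h_def by linarith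
    have "((\<lambda>s. \<bar>h (?\<phi> y) r0 - h (?\<phi> y) s\<bar>) \<longlongrightarrow> \<bar>h (?\<phi> y) r0 - L (?\<phi> y)\<bar>) (at_right 0)"
      by (intro tendsto_intros L_tendsto_unit(2) unit y)
    moreover have "\<forall>\<^sub>F s in at_right 0. \<bar>h (?\<phi> y) r0 - h (?\<phi> y) s\<bar> \<le> real CARD('n) * C1 * M * r0"
      unfolding eventually_at_right_field
      using r0 by (intro exI[of _ r0]) (auto intro!: h_increment M unit y)
    ultimately have "\<bar>h (?\<phi> y) r0 - L (?\<phi> y)\<bar> \<le> real CARD('n) * C1 * M * r0"
      by (rule tendsto_upperbound) simp
    with h show ?thesis by linarith
  qed
  moreover have "L (\<lambda>x. bump_prod x *\<^sub>R y) = b * L (?\<phi> y)" if "norm y \<le> 1" for y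
  proof (rule L_eqI)
    have t: "?\<phi> y \<in> test_functions" by (rule unit_tests_test[OF unit[OF that]])
    have "((\<lambda>t. b * S (dilate a (t * \<rho>) (?\<phi> y))) \<longlongrightarrow> b * L (?\<phi> y)) (at_right 0)"
      by (intro tendsto_mult tendsto_const rescale_tendsto[OF \<rho>, of "\<lambda>t. S (dilate a t (?\<phi> y))"] L_tendsto t)
    then show "((\<lambda>t. S (dilate a t (\<lambda>x. bump_prod x *\<^sub>R y))) \<longlongrightarrow> b * L (?\<phi> y)) (at_right 0)"
    proof (rule Lim_transform_eventually)
      show "\<forall>\<^sub>F t in at_right 0. b * S (dilate a (t * \<rho>) (?\<phi> y)) = S (dilate a t (\<lambda>x. bump_prod x *\<^sub>R y))"
        using eventually_at_right_less[of 0]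
        by eventually_elim (simp add: S_dilate_rescale[OF _ \<rho> t eq])
    qed
  qed
  ultimately have "\<bar>L (\<lambda>x. bump_prod x *\<^sub>R y)\<bar> \<le> \<bar>b\<bar> * ?K" if "norm y \<le> 1" for y
    using that by (simp add: abs_mult mult_left_mono)
  then show ?thesis by blast
qed

text \<open>Both sides vanish on derivatives, hence they agree as soon as they agree on \<open>bump_prod x *\<^sub>R y\<close>;
  dividing by the integral of \<^const>\<open>bump_prod\<close> achieves this.\<close>
lemma L_representation: "\<exists>c. \<forall>\<theta>\<in>test_functions. \<forall>t. L \<theta> = pair (\<lambda>_. c) t \<theta>"
proof -
  define I where "I = (LINT x|lebesgue. bump_prod (x :: real ^ 'n))"
  have I: "0 < I" unfolding I_def by (rule integral_bump_prod_pos)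
  define l where "l y = L (\<lambda>x. bump_prod x *\<^sub>R y) / I" for y
  have lscale: "l (b *\<^sub>R y) = b * l y" for b y
    using L_scaleR[OF bump_prod_test, of b y] by (simp add: l_def mult.commute)
  have ladd: "l (x + y) = l x + l y" for x y
    using kills_derivatives_add[OF L_kills_derivatives bump_prod_test bump_prod_test, of x y]
    by (simp add: l_def scaleR_add_right add_divide_distrib)
  obtain K where K: "\<And>y. norm y \<le> 1 \<Longrightarrow> \<bar>L (\<lambda>x. bump_prod x *\<^sub>R y)\<bar> \<le> K" using L_bump_bounded by blast
  have "bounded_linear l"
  proof (rule bounded_linear_intro[where K = "K / I"])
    fix y
    show "norm (l y) \<le> norm y * (K / I)"
    proof (cases "y = 0")
      case True
      then show ?thesis using lscale[of 0 0] by simp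
    next
      case False
      then have "\<bar>l (inverse (norm y) *\<^sub>R y)\<bar> \<le> K / I"
        using K[of "inverse (norm y) *\<^sub>R y"] I by (simp add: l_def divide_right_mono)
      then show ?thesis using False by (simp add: lscale abs_mult field_simps)
    qed
  qed (simp_all add: ladd lscale)
  then have c: "blinfun_apply (Blinfun l) y = l y" for y by (simp add: bounded_linear_Blinfun_apply)
  have "L \<theta> = pair (\<lambda>_. Blinfun l) t \<theta>" if \<theta>: "\<theta> \<in> test_functions" for \<theta> t
  proof -
    obtain y where y: "\<And>F. kills_derivatives F \<Longrightarrow> F \<theta> = F (\<lambda>x. bump_prod x *\<^sub>R y)"
      using kills_derivatives_representative[OF \<theta>] by blast
    have "pair (\<lambda>_. Blinfun l) t \<theta> = pair (\<lambda>_. Blinfun l) 1 \<theta>" by (simp add: pair_def)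
    also have "\<dots> = pair (\<lambda>_. Blinfun l) 1 (\<lambda>x :: real ^ 'n. bump_prod x *\<^sub>R y)" by (rule y[OF kills_derivatives_pair_const])
    also have "\<dots> = I * l y" by (simp add: pair_def blinfun.scaleR_right c I_def)
    also have "\<dots> = L (\<lambda>x. bump_prod x *\<^sub>R y)" using I by (simp add: l_def)
    also have "\<dots> = L \<theta>" by (rule y[OF L_kills_derivatives, symmetric])
    finally show ?thesis by simp
  qed
  then show ?thesis by blast
qed

theorem polynomial_approximation:
  "\<exists>C\<ge>0. \<exists>c. (\<forall>\<epsilon> r1.
     (\<forall>t \<theta> j. 0 < t \<longrightarrow> t \<le> r1 \<longrightarrow> \<theta> \<in> unit_tests (nu i p) \<longrightarrow> \<bar>deriv_defect S f a j t \<theta>\<bar> \<le> \<epsilon> * t ^ d) \<longrightarrow>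
     (\<forall>r \<theta>. 0 < r \<longrightarrow> r \<le> r1 \<longrightarrow> \<theta> \<in> unit_tests (nu i p) \<longrightarrow> 
       \<bar>S (dilate a r \<theta>) - pair (\<lambda>u. g0 u + c) r \<theta>\<bar> \<le> C * \<epsilon> * r ^ Suc d))"
proof -
  obtain c where c: "\<And>\<theta> t. \<theta> \<in> test_functions \<Longrightarrow> L \<theta> = pair (\<lambda>_. c) t \<theta>" using L_representation by blast
  let ?C = "real CARD('n) * C1"
  have "0 \<le> ?C" using C1(1) by simp
  moreover have "\<bar>S (dilate a r \<theta>) - pair (\<lambda>u. g0 u + c) r \<theta>\<bar> \<le> ?C * \<epsilon> * r ^ Suc d"
    if \<epsilon>: "\<And>t \<theta> j. 0 < t \<Longrightarrow> t \<le> r1 \<Longrightarrow> \<theta> \<in> unit_tests (nu i p) \<Longrightarrow> \<bar>deriv_defect S f a j t \<theta>\<bar> \<le> \<epsilon> * t ^ d"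
      and r: "0 < r" "r \<le> r1" and \<theta>: "\<theta> \<in> unit_tests (nu i p)" for \<epsilon> r1 r \<theta>
  proof -
    have tt: "\<theta> \<in> test_functions" by (rule unit_tests_test[OF \<theta>])
    have "0 * r ^ d \<le> \<epsilon> * r ^ d" using \<epsilon>[OF r zero_unit, of undefined] by linarith
    then have \<epsilon>0: "0 \<le> \<epsilon>" by (rule mult_right_le_imp_le) (use r in simp)
    have bound: "\<bar>deriv_defect S f a j t \<theta>\<bar> \<le> \<epsilon> * r ^ d"
      if "0 < t" "t \<le> r" "\<theta> \<in> unit_tests (nu i p)" for t \<theta> j
    proof -
      have "\<bar>deriv_defect S f a j t \<theta>\<bar> \<le> \<epsilon> * t ^ d" using that r by (intro \<epsilon>) auto
      also have "\<dots> \<le> \<epsilon> * r ^ d" using that \<epsilon>0 by (intro mult_left_mono power_mono) auto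
      finally show ?thesis .
    qed
    have "((\<lambda>s. \<bar>h \<theta> r - h \<theta> s\<bar>) \<longlongrightarrow> \<bar>h \<theta> r - L \<theta>\<bar>) (at_right 0)"
      by (intro tendsto_intros L_tendsto_unit(2) \<theta>)
    moreover have "\<forall>\<^sub>F s in at_right 0. \<bar>h \<theta> r - h \<theta> s\<bar> \<le> ?C * (\<epsilon> * r ^ d) * r"
      unfolding eventually_at_right_field
      using r by (intro exI[of _ r]) (auto intro!: h_increment bound \<theta>)
    ultimately have "\<bar>h \<theta> r - L \<theta>\<bar> \<le> ?C * (\<epsilon> * r ^ d) * r"
      by (rule tendsto_upperbound) simp
    moreover have "S (dilate a r \<theta>) - pair (\<lambda>u. g0 u + c) r \<theta> = h \<theta> r - L \<theta>"
      unfolding h_def c[OF tt, of r]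
      by (simp add: pair_add_left polyf_continuous[OF polyf_g0] tt)
    ultimately show ?thesis by (simp add: mult_ac)
  qed
  ultimately show ?thesis by blast
qed

text \<open>Used for order \<open>(-1, 1)\<close>, where the approximating polynomial has to be constant although \<^const>\<open>g0\<close>
  formally has degree \<open>1\<close>.\<close>
lemma pair_g0_eq_0:
  assumes f0: "\<And>j t \<theta>. pair (f j) t \<theta> = 0" and \<theta>: "\<theta> \<in> test_functions"
  shows "pair g0 t \<theta> = 0"
proof -
  have "t * pair (q j) t (times_coord j \<theta>) = 0" for j
  proof -
    have "((\<lambda>t. t * pair (q j) t (times_coord j \<theta>)) has_real_derivative 0) (at s)" for s
      using q(2)[OF test_times_coord[OF \<theta>]] by (simp add: f0)
    then have "t * pair (q j) t (times_coord j \<theta>) = 0 * pair (q j) 0 (times_coord j \<theta>)"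
      by (intro DERIV_isconst_all[of "\<lambda>t. t * pair (q j) t (times_coord j \<theta>)"]) blast
    then show ?thesis by simp
  qed
  then show ?thesis unfolding pair_g0[OF \<theta>] by (intro sum.neutral ballI)
qed

end

section \<open>Pointwise differentiability\<close>

lemma rescale_eq_dilate:
  assumes "dist_bounded S" "\<theta> \<in> test_functions" "0 < r"
  shows "rescale S a r \<theta> = S (dilate a r \<theta>)"
proof -
  have r: "r \<noteq> 0" using assms(3) by simp
  have "(\<lambda>x. \<theta> (inverse r *\<^sub>R (x - a))) = (\<lambda>x. (r ^ CARD('a)) *\<^sub>R dilate a r \<theta> x)"
    using r by (simp add: dilate_def fun_eq_iff power_inverse)
  then show ?thesis
    using r by (simp add: rescale_def dist_bounded_scaleR[OF assms(1)] dilate_test assms power_int_minus)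
qed

lemma rescale_minus_poly:
  fixes S :: "(real ^ 'n \<Rightarrow> 'y::real_normed_vector) \<Rightarrow> real"
  assumes "dist_bounded S" "continuous_on UNIV P" "\<theta> \<in> test_functions" "0 < r"
  shows "rescale (\<lambda>\<eta>. S \<eta> - poly_distr P \<eta>) a r \<theta> = S (dilate a r \<theta>) - pair (\<lambda>u. P (a + u)) r \<theta>"
proof -
  have "rescale (\<lambda>\<eta>. S \<eta> - poly_distr P \<eta>) a r \<theta> = rescale S a r \<theta> - rescale (poly_distr P) a r \<theta>"
    by (simp add: rescale_def right_diff_distrib)
  then show ?thesis using assms by (simp add: rescale_eq_dilate rescale_poly_distr)
qed

lemma unit_tests_uminus:
  assumes "1 \<le> p" "\<theta> \<in> unit_tests (nu i p)"
  shows "(\<lambda>x. (- 1) *\<^sub>R \<theta> x) \<in> unit_tests (nu i p)"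
  using nu_scaleR_le[OF assms(1) unit_tests_test[OF assms(2)], of i "- 1"]
    test_in_scaleR_const[OF compact_cball unit_tests_test_in[OF assms(2)], of "- 1"] assms(2)
  by (simp add: unit_tests_def)

definition defect :: "((real ^ 'n \<Rightarrow> 'y::real_normed_vector) \<Rightarrow> real) \<Rightarrow> (real ^ 'n \<Rightarrow> 'y \<Rightarrow>\<^sub>L real)
    \<Rightarrow> real ^ 'n \<Rightarrow> real \<Rightarrow> (real ^ 'n \<Rightarrow> 'y) \<Rightarrow> real" where
  "defect S g a t \<theta> = S (dilate a t \<theta>) - pair g t \<theta>"

lemma defect_uminus:
  assumes "dist_bounded S" "\<theta> \<in> test_functions" "0 < t"
  shows "defect S g a t (\<lambda>x. (- 1) *\<^sub>R \<theta> x) = - defect S g a t \<theta>"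
proof -
  have "pair g t (\<lambda>x. (- 1) *\<^sub>R \<theta> x) = (- 1) * pair g t \<theta>" by (rule pair_scaleR_right)
  moreover have "S (dilate a t (\<lambda>x. (- 1) *\<^sub>R \<theta> x)) = (- 1) * S (dilate a t \<theta>)"
    unfolding dilate_scaleR by (intro dist_bounded_scaleR assms dilate_test)
  ultimately show ?thesis by (simp add: defect_def)
qed

text \<open>The condition in \<^const>\<open>pt_diff\<close>, with the supremum and the limit resolved and with the polynomial in the
  variable \<open>x - a\<close>.\<close>
definition approximates :: "nat \<Rightarrow> ennreal \<Rightarrow> real ^ 'n \<Rightarrow> nat
    \<Rightarrow> ((real ^ 'n \<Rightarrow> 'y::real_normed_vector) \<Rightarrow> real) \<Rightarrow> (real ^ 'n \<Rightarrow> 'y \<Rightarrow>\<^sub>L real) \<Rightarrow> bool" where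
  "approximates i p a k S g \<longleftrightarrow>
     (\<forall>\<epsilon>>0. \<exists>r0>0. \<forall>t \<theta>. 0 < t \<longrightarrow> t \<le> r0 \<longrightarrow> \<theta> \<in> unit_tests (nu i p) \<longrightarrow> \<bar>defect S g a t \<theta>\<bar> \<le> \<epsilon> * t ^ k)"

lemma eventually_at_right_0E:
  assumes "\<forall>\<^sub>F r in at_right (0 :: real). Q r"
  obtains r0 where "0 < r0" "\<And>r. 0 < r \<Longrightarrow> r \<le> r0 \<Longrightarrow> Q r"
proof -
  obtain b where "b > 0" "\<And>r. 0 < r \<Longrightarrow> r < b \<Longrightarrow> Q r"
    using assms unfolding eventually_at_right_field by blast
  then show ?thesis by (intro that[of "b / 2"]) auto
qed

text \<open>The supremum has no absolute value, but the unit tests are symmetric.\<close>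
lemma abs_defect_le:
  fixes S :: "(real ^ 'n \<Rightarrow> 'y::real_normed_vector) \<Rightarrow> real"
  assumes p: "1 \<le> p" and S: "dist_bounded S" and t: "0 < t" and b: "0 < b"
    and le: "(SUP \<theta>\<in>unit_tests (nu i p). ereal (b * defect S g a t \<theta>)) < ereal \<epsilon>"
    and \<theta>: "\<theta> \<in> unit_tests (nu i p)"
  shows "\<bar>defect S g a t \<theta>\<bar> \<le> \<epsilon> * inverse b"
proof -
  have *: "b * defect S g a t \<eta> < \<epsilon>" if "\<eta> \<in> unit_tests (nu i p)" for \<eta>
    using le_less_trans[OF SUP_upper[OF that, of "\<lambda>\<theta>. ereal (b * defect S g a t \<theta>)"] le] by simp
  have "\<bar>b * defect S g a t \<theta>\<bar> \<le> \<epsilon>"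
    using *[OF \<theta>] *[OF unit_tests_uminus[OF p \<theta>]] defect_uminus[OF S unit_tests_test[OF \<theta>] t, of g a]
    by simp
  then show ?thesis using b by (simp add: abs_mult field_simps)
qed

lemma pt_diff_imp_approximates:
  fixes S :: "(real ^ 'n \<Rightarrow> 'y::real_normed_vector) \<Rightarrow> real"
  assumes p: "1 \<le> p" and S: "dist_bounded S" and d: "pt_diff (nu i p) (int k) S a"
  shows "\<exists>g. polyf k g \<and> approximates i p a k S g"
proof -
  obtain P :: "real ^ 'n \<Rightarrow> 'y \<Rightarrow>\<^sub>L real" where P: "poly_fun (int k) P"
    and lim: "((\<lambda>r. SUP \<theta>\<in>unit_tests (nu i p).
      ereal (r powi (- int k) * rescale (\<lambda>\<eta>. S \<eta> - poly_distr P \<eta>) a r \<theta>)) \<longlongrightarrow> 0) (at_right 0)"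
    using d unfolding pt_diff_def by blast
  have pP: "polyf k P" by (rule poly_fun_imp_polyf[OF P])
  let ?g = "\<lambda>u. P (a + u)"
  have "\<exists>r0>0. \<forall>t \<theta>. 0 < t \<longrightarrow> t \<le> r0 \<longrightarrow> \<theta> \<in> unit_tests (nu i p) \<longrightarrow> \<bar>defect S ?g a t \<theta>\<bar> \<le> \<epsilon> * t ^ k"
    if \<epsilon>: "0 < \<epsilon>" for \<epsilon>
  proof -
    have "\<forall>\<^sub>F r in at_right 0. (SUP \<theta>\<in>unit_tests (nu i p).
        ereal (r powi (- int k) * rescale (\<lambda>\<eta>. S \<eta> - poly_distr P \<eta>) a r \<theta>)) < ereal \<epsilon>"
      using \<epsilon> by (intro order_tendstoD(2)[OF lim]) simp
    then obtain r0 where r0: "0 < r0" "\<And>r. 0 < r \<Longrightarrow> r \<le> r0 \<Longrightarrow> (SUP \<theta>\<in>unit_tests (nu i p).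
        ereal (r powi (- int k) * rescale (\<lambda>\<eta>. S \<eta> - poly_distr P \<eta>) a r \<theta>)) < ereal \<epsilon>"
      using eventually_at_right_0E by blast
    have "\<bar>defect S ?g a t \<theta>\<bar> \<le> \<epsilon> * t ^ k" if t: "0 < t" "t \<le> r0" and \<theta>: "\<theta> \<in> unit_tests (nu i p)" for t \<theta>
    proof -
      have "(SUP \<theta>\<in>unit_tests (nu i p). ereal (inverse (t ^ k) * defect S ?g a t \<theta>))
          = (SUP \<theta>\<in>unit_tests (nu i p). ereal (t powi (- int k) * rescale (\<lambda>\<eta>. S \<eta> - poly_distr P \<eta>) a t \<theta>))"
        using t(1) by (intro SUP_cong refl)
          (simp add: rescale_minus_poly[OF S polyf_continuous[OF pP] unit_tests_test] defect_def power_int_minus)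
      also have "\<dots> < ereal \<epsilon>" by (rule r0(2)[OF t])
      finally have "\<bar>defect S ?g a t \<theta>\<bar> \<le> \<epsilon> * inverse (inverse (t ^ k))"
        using t(1) by (intro abs_defect_le[OF p S t(1) _ _ \<theta>]) simp_all
      then show ?thesis by simp
    qed
    with r0(1) show ?thesis by blast
  qed
  then have "approximates i p a k S ?g" unfolding approximates_def by blast
  with polyf_translate[OF pP, of a] show ?thesis by blast
qed

lemma approximates_imp_pt_diff:
  fixes S :: "(real ^ 'n \<Rightarrow> 'y::real_normed_vector) \<Rightarrow> real"
  assumes p: "1 \<le> p" and S: "dist_bounded S" and g: "polyf k g" and ap: "approximates i p a k S g"
  shows "pt_diff (nu i p) (int k) S a"
proof -
  define P where "P = (\<lambda>x. g (- a + x))"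
  have pP: "polyf k P" unfolding P_def by (rule polyf_translate[OF g])
  have Pa: "(\<lambda>u. P (a + u)) = g" by (simp add: P_def)
  let ?F = "\<lambda>r. SUP \<theta>\<in>unit_tests (nu i p). ereal (r powi (- int k) * rescale (\<lambda>\<eta>. S \<eta> - poly_distr P \<eta>) a r \<theta>)"
  have F: "?F r = (SUP \<theta>\<in>unit_tests (nu i p). ereal (inverse (r ^ k) * defect S g a r \<theta>))" if "0 < r" for r
    using that by (intro SUP_cong refl)
      (simp add: rescale_minus_poly[OF S polyf_continuous[OF pP] unit_tests_test] Pa defect_def power_int_minus)
  have "(?F \<longlongrightarrow> 0) (at_right 0)"
  proof (rule order_tendstoI)
    fix b :: ereal assume b: "b < 0"
    show "\<forall>\<^sub>F r in at_right 0. b < ?F r"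
      using eventually_at_right_less[of 0]
    proof eventually_elim
      case (elim r)
      \<comment> \<open>the supremum is nonnegative, since the zero function is a unit test\<close>
      have "defect S g a r (\<lambda>x. (- 1) *\<^sub>R 0) = - defect S g a r (\<lambda>x. 0)"
        using elim by (intro defect_uminus S unit_tests_test[OF zero_unit_tests[OF p]])
      then have "defect S g a r (\<lambda>x. 0) = 0" by simp
      then have "0 \<le> (SUP \<theta>\<in>unit_tests (nu i p). ereal (inverse (r ^ k) * defect S g a r \<theta>))"
        by (intro SUP_upper2[OF zero_unit_tests[OF p]]) simp
      with b show ?case unfolding F[OF elim] by (rule less_le_trans)
    qed
  next
    fix b :: ereal assume "0 < b"
    then obtain \<epsilon> where \<epsilon>: "0 < ereal \<epsilon>" "ereal \<epsilon> < b" using ereal_dense2 by blast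
    then obtain r0 where r0: "r0 > 0"
      "\<And>t \<theta>. 0 < t \<Longrightarrow> t \<le> r0 \<Longrightarrow> \<theta> \<in> unit_tests (nu i p) \<Longrightarrow> \<bar>defect S g a t \<theta>\<bar> \<le> \<epsilon> * t ^ k"
      using ap unfolding approximates_def by (metis ereal_less(2))
    have "?F r < b" if r: "0 < r" "r < r0" for r
    proof -
      have "?F r \<le> ereal \<epsilon>"
        unfolding F[OF r(1)]
      proof (rule SUP_least)
        fix \<theta> :: "real ^ 'n \<Rightarrow> 'y" assume "\<theta> \<in> unit_tests (nu i p)"
        then have "\<bar>defect S g a r \<theta>\<bar> \<le> \<epsilon> * r ^ k" using r by (intro r0) auto
        then have "inverse (r ^ k) * defect S g a r \<theta> \<le> inverse (r ^ k) * (\<epsilon> * r ^ k)"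
          using r by (intro mult_left_mono) auto
        also have "inverse (r ^ k) * (\<epsilon> * r ^ k) = \<epsilon>" using r by simp
        finally show "ereal (inverse (r ^ k) * defect S g a r \<theta>) \<le> ereal \<epsilon>" by simp
      qed
      then show ?thesis using \<epsilon>(2) by (rule le_less_trans)
    qed
    then show "\<forall>\<^sub>F r in at_right 0. ?F r < b"
      unfolding eventually_at_right_field using r0(1) by blast
  qed
  with polyf_imp_poly_fun[OF pP] show ?thesis unfolding pt_diff_def by blast
qed

lemma pt_diff_holder_bound:
  fixes S :: "(real ^ 'n \<Rightarrow> 'y::real_normed_vector) \<Rightarrow> real"
  assumes p: "1 \<le> p" and S: "dist_bounded S"
    and P: "continuous_on UNIV P"
    and lim: "Limsup (at_right 0) (\<lambda>r. SUP \<theta>\<in>unit_tests (nu i p).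
          ereal (r powr (- of_int k - \<alpha>) * rescale (\<lambda>\<eta>. S \<eta> - poly_distr P \<eta>) a r \<theta>)) < \<infinity>"
  shows "\<exists>C\<ge>0. \<exists>r0>0. \<forall>t \<theta>. 0 < t \<longrightarrow> t \<le> r0 \<longrightarrow> \<theta> \<in> unit_tests (nu i p)
    \<longrightarrow> \<bar>defect S (\<lambda>u. P (a + u)) a t \<theta>\<bar> \<le> C * t powr (of_int k + \<alpha>)"
proof -
  let ?g = "\<lambda>u. P (a + u)"
  obtain C0 where "Limsup (at_right 0) (\<lambda>r. SUP \<theta>\<in>unit_tests (nu i p).
          ereal (r powr (- of_int k - \<alpha>) * rescale (\<lambda>\<eta>. S \<eta> - poly_distr P \<eta>) a r \<theta>)) < ereal C0"
    using ereal_dense2[OF lim] by blast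
  then have "\<forall>\<^sub>F r in at_right 0. (SUP \<theta>\<in>unit_tests (nu i p).
          ereal (r powr (- of_int k - \<alpha>) * rescale (\<lambda>\<eta>. S \<eta> - poly_distr P \<eta>) a r \<theta>)) < ereal C0"
    by (rule Limsup_lessD)
  then obtain r0 where r0: "0 < r0" "\<And>r. 0 < r \<Longrightarrow> r \<le> r0 \<Longrightarrow> (SUP \<theta>\<in>unit_tests (nu i p).
          ereal (r powr (- of_int k - \<alpha>) * rescale (\<lambda>\<eta>. S \<eta> - poly_distr P \<eta>) a r \<theta>)) < ereal C0"
    using eventually_at_right_0E by blast
  have "\<bar>defect S ?g a t \<theta>\<bar> \<le> \<bar>C0\<bar> * t powr (of_int k + \<alpha>)"
    if t: "0 < t" "t \<le> r0" and \<theta>: "\<theta> \<in> unit_tests (nu i p)" for t \<theta>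
  proof -
    let ?b = "t powr (- of_int k - \<alpha>)"
    have "(SUP \<theta>\<in>unit_tests (nu i p). ereal (?b * defect S ?g a t \<theta>))
        = (SUP \<theta>\<in>unit_tests (nu i p). ereal (?b * rescale (\<lambda>\<eta>. S \<eta> - poly_distr P \<eta>) a t \<theta>))"
      using t(1) by (intro SUP_cong refl)
        (simp add: rescale_minus_poly[OF S P unit_tests_test] defect_def)
    also have "\<dots> < ereal C0" by (rule r0(2)[OF t])
    finally have "\<bar>defect S ?g a t \<theta>\<bar> \<le> C0 * inverse ?b"
      using t(1) by (intro abs_defect_le[OF p S t(1) _ _ \<theta>]) simp_all
    also have "\<dots> \<le> \<bar>C0\<bar> * inverse ?b" by (intro mult_right_mono) auto
    also have "inverse ?b = t powr (of_int k + \<alpha>)"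
      using powr_minus[of t "- of_int k - \<alpha>"] by (simp add: algebra_simps)
    finally show ?thesis .
  qed
  with r0(1) show ?thesis by (intro exI[of _ "\<bar>C0\<bar>"]) auto
qed

lemma holder_bound_imp_approximates:
  fixes S :: "(real ^ 'n \<Rightarrow> 'y::real_normed_vector) \<Rightarrow> real"
  assumes \<alpha>: "0 < \<alpha>" and C: "0 \<le> C" and r0: "0 < r0"
    and le: "\<And>t \<theta>. 0 < t \<Longrightarrow> t \<le> r0 \<Longrightarrow> \<theta> \<in> unit_tests (nu i p) \<Longrightarrow> \<bar>defect S g a t \<theta>\<bar> \<le> C * t powr (real k + \<alpha>)"
  shows "approximates i p a k S g"
  unfolding approximates_def
proof (intro allI impI)
  fix \<epsilon> :: real assume \<epsilon>: "0 < \<epsilon>"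
  have "((\<lambda>t. C * t powr \<alpha>) \<longlongrightarrow> C * 0) (at_right 0)"
    using \<alpha> by (intro tendsto_mult tendsto_const tendsto_zero_powrI[of "\<lambda>t. t" _ "\<lambda>_. \<alpha>" \<alpha>] tendsto_ident_at)
       (auto intro!: eventually_mono[OF eventually_at_right_less[of 0]])
  then have "\<forall>\<^sub>F t in at_right 0. C * t powr \<alpha> < \<epsilon>" using \<epsilon> by (intro order_tendstoD(2)) auto
  then obtain r1 where r1: "0 < r1" "\<And>t. 0 < t \<Longrightarrow> t \<le> r1 \<Longrightarrow> C * t powr \<alpha> < \<epsilon>"
    using eventually_at_right_0E by blast
  have "\<bar>defect S g a t \<theta>\<bar> \<le> \<epsilon> * t ^ k"
    if t: "0 < t" "t \<le> min r0 r1" and \<theta>: "\<theta> \<in> unit_tests (nu i p)" for t \<theta>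
  proof -
    have "\<bar>defect S g a t \<theta>\<bar> \<le> C * t powr (real k + \<alpha>)" using t by (intro le \<theta>) auto
    also have "\<dots> = (C * t powr \<alpha>) * t ^ k" using t by (simp add: powr_add powr_realpow)
    also have "\<dots> \<le> \<epsilon> * t ^ k" using t r1(2)[of t] by (intro mult_right_mono) auto
    finally show ?thesis .
  qed
  with r0 r1(1) show "\<exists>r0>0. \<forall>t \<theta>. 0 < t \<longrightarrow> t \<le> r0 \<longrightarrow> \<theta> \<in> unit_tests (nu i p) \<longrightarrow> \<bar>defect S g a t \<theta>\<bar> \<le> \<epsilon> * t ^ k"
    by (intro exI[of _ "min r0 r1"]) auto
qed

subsection \<open>Partial derivatives of distributions\<close>

lemma partial_D_list:
  fixes \<xi> :: "'n::finite \<Rightarrow> nat"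
  obtains js where "\<And>j. count_list js j = \<xi> j"
    "\<And>f :: real ^ 'n \<Rightarrow> 'y::real_normed_vector. partial_D \<xi> f = Dmult f (map (\<lambda>j. axis j 1) js)"
proof -
  have "count (Abs_multiset \<xi>) = \<xi>" by (rule count_Abs_multiset) simp
  moreover obtain js where "mset js = Abs_multiset \<xi>" using ex_mset by blast
  ultimately have "\<forall>j. count_list js j = \<xi> j" by (metis count_mset)
  then have "\<forall>j. count_list (SOME js. \<forall>j. count_list js j = \<xi> j) j = \<xi> j" by (rule someI)
  then show ?thesis by (intro that[of "SOME js. \<forall>j. count_list js j = \<xi> j"]) (simp_all add: partial_D_def)
qed

lemma distr_D_dist_bounded:
  fixes T :: "(real ^ 'n \<Rightarrow> 'y::real_normed_vector) \<Rightarrow> real"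
  assumes "dist_bounded T"
  shows "dist_bounded (distr_D \<xi> T)"
proof -
  obtain js where "\<And>f :: real ^ 'n \<Rightarrow> 'y. partial_D \<xi> f = Dmult f (map (\<lambda>j. axis j 1) js)"
    using partial_D_list[of \<xi>] by metis
  then have "distr_D \<xi> T = (\<lambda>\<theta>. (- 1) ^ (\<Sum>j\<in>UNIV. \<xi> j) * T (Dmult \<theta> (map (\<lambda>j. axis j 1) js)))"
    by (intro ext) (simp add: distr_D_def)
  moreover have "dist_bounded (\<lambda>\<theta>. (- 1) ^ (\<Sum>j\<in>UNIV. \<xi> j) * T (Dmult \<theta> (map (\<lambda>j. axis j 1) js)))"
    by (rule dist_bounded_Dmult[OF assms]) (auto simp: norm_axis_1)
  ultimately show ?thesis by simp
qed

lemma sum_fun_upd_Suc: "(\<Sum>l\<in>UNIV. (\<beta>(j := Suc (\<beta> j))) l) = Suc (\<Sum>l\<in>UNIV. \<beta> l)" for \<beta> :: "'n::finite \<Rightarrow> nat"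
proof -
  have "(\<Sum>l\<in>UNIV. (\<beta>(j := Suc (\<beta> j))) l) = (\<Sum>l\<in>UNIV. \<beta> l + (if l = j then 1 else 0))"
    by (intro sum.cong) auto
  then show ?thesis by (simp add: sum.distrib)
qed

lemma distr_D_Suc:
  fixes T :: "(real ^ 'n \<Rightarrow> 'y::real_normed_vector) \<Rightarrow> real"
  assumes "\<theta> \<in> test_functions"
  shows "distr_D (\<beta>(j := Suc (\<beta> j))) T \<theta> = - distr_D \<beta> T (dir_deriv (axis j 1) \<theta>)"
proof -
  let ?\<xi> = "\<beta>(j := Suc (\<beta> j))"
  obtain js where js: "\<And>j. count_list js j = \<beta> j"
    "\<And>f :: real ^ 'n \<Rightarrow> 'y. partial_D \<beta> f = Dmult f (map (\<lambda>j. axis j 1) js)"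
    using partial_D_list[of \<beta>] by metis
  obtain ks where ks: "\<And>l. count_list ks l = ?\<xi> l"
    "\<And>f :: real ^ 'n \<Rightarrow> 'y. partial_D ?\<xi> f = Dmult f (map (\<lambda>j. axis j 1) ks)"
    using partial_D_list[of ?\<xi>] by metis
  have "mset ks = mset (js @ [j])"
    by (rule multiset_eqI) (simp add: count_mset[symmetric] ks js, simp add: count_mset ks js)
  then have "mset (map (\<lambda>j. axis j 1) ks) = mset (map (\<lambda>j. axis j 1 :: real ^ 'n) (js @ [j]))"
    by (simp only: mset_map)
  then have "Dmult \<theta> (map (\<lambda>j. axis j 1) ks) = Dmult \<theta> (map (\<lambda>j. axis j 1) (js @ [j]))"
    by (rule Dmult_mset_eq[OF test_functions_smooth[OF assms]])
  also have "\<dots> = Dmult (dir_deriv (axis j 1) \<theta>) (map (\<lambda>j. axis j 1) js)"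
    by (simp only: map_append list.map Dmult_snoc)
  finally show ?thesis
    unfolding distr_D_def sum_fun_upd_Suc js(2) ks(2) by simp
qed

lemma distr_D_defect:
  assumes "dist_bounded T" "\<theta> \<in> test_functions" "0 < t"
  shows "defect (distr_D (\<beta>(j := Suc (\<beta> j))) T) (f j) a t \<theta> = deriv_defect (distr_D \<beta> T) f a j t \<theta>"
  using assms by (simp add: defect_def deriv_defect_def distr_D_Suc dilate_test)

lemma finite_common_radius:
  fixes Q :: "'n::finite \<Rightarrow> real \<Rightarrow> bool"
  assumes "\<forall>j. \<exists>r0>0. \<forall>t. 0 < t \<longrightarrow> t \<le> r0 \<longrightarrow> Q j t"
  shows "\<exists>r0>0. \<forall>j t. 0 < t \<longrightarrow> t \<le> r0 \<longrightarrow> Q j t"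
proof -
  obtain r where r: "\<And>j. 0 < r j" "\<And>j t. 0 < t \<Longrightarrow> t \<le> r j \<Longrightarrow> Q j t" using assms by metis
  have "0 < Min (range r)" using r(1) by (subst Min_gr_iff) auto
  moreover have "Q j t" if "0 < t" "t \<le> Min (range r)" for j t
    using that Min_le[of "range r" "r j"] by (intro r) auto
  ultimately show ?thesis by blast
qed

text \<open>Integrating the errors \<open>o(t\<^sup>d)\<close> of the first derivatives in the dilation parameter gives \<open>o(t\<^sup>d\<^sup>+\<^sup>1)\<close>
  for the distribution itself; the limit functional fixes the constant term of the polynomial.\<close>
lemma approximates_step:
  fixes T :: "(real ^ 'n \<Rightarrow> 'y::banach) \<Rightarrow> real"
  assumes p: "1 \<le> p" and T: "dist_bounded T"
    and D: "\<And>j. \<exists>g. polyf d g \<and> approximates i p a d (distr_D (\<beta>(j := Suc (\<beta> j))) T) g"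
  shows "\<exists>g. polyf (Suc d) g \<and> approximates i p a (Suc d) (distr_D \<beta> T) g"
proof -
  let ?S = "distr_D \<beta> T"
  have S: "dist_bounded ?S" by (rule distr_D_dist_bounded[OF T])
  obtain f where f: "\<And>j. polyf d (f j)"
    and ap: "\<And>j. approximates i p a d (distr_D (\<beta>(j := Suc (\<beta> j))) T) (f j)" using D by metis
  have small: "\<exists>r0>0. \<forall>t \<theta> j. 0 < t \<longrightarrow> t \<le> r0 \<longrightarrow> \<theta> \<in> unit_tests (nu i p) \<longrightarrow> \<bar>deriv_defect ?S f a j t \<theta>\<bar> \<le> \<epsilon> * t ^ d"
    if \<epsilon>: "0 < \<epsilon>" for \<epsilon>
  proof -
    have "\<exists>r0>0. \<forall>t. 0 < t \<longrightarrow> t \<le> r0 \<longrightarrow>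
        (\<forall>\<theta>\<in>unit_tests (nu i p). \<bar>deriv_defect ?S f a j t \<theta>\<bar> \<le> \<epsilon> * t ^ d)" for j
    proof -
      obtain r0 where "0 < r0" "\<And>t \<theta>. 0 < t \<Longrightarrow> t \<le> r0 \<Longrightarrow> \<theta> \<in> unit_tests (nu i p) \<Longrightarrow>
          \<bar>defect (distr_D (\<beta>(j := Suc (\<beta> j))) T) (f j) a t \<theta>\<bar> \<le> \<epsilon> * t ^ d"
        using ap[of j] \<epsilon> unfolding approximates_def by blast
      then show ?thesis
        by (intro exI[of _ r0]) (simp add: distr_D_defect[OF T unit_tests_test, symmetric])
    qed
    then have "\<forall>j. \<exists>r0>0. \<forall>t. 0 < t \<longrightarrow> t \<le> r0 \<longrightarrow>
        (\<forall>\<theta>\<in>unit_tests (nu i p). \<bar>deriv_defect ?S f a j t \<theta>\<bar> \<le> \<epsilon> * t ^ d)" by (rule allI)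
    from finite_common_radius[OF this] show ?thesis by blast
  qed
  obtain r0 where r0: "0 < r0" "\<And>t \<theta> j. 0 < t \<Longrightarrow> t \<le> r0 \<Longrightarrow> \<theta> \<in> unit_tests (nu i p) \<Longrightarrow>
      \<bar>deriv_defect ?S f a j t \<theta>\<bar> \<le> 1 * t ^ d"
    using small[of 1] by auto
  interpret derivs_approx ?S f a d i p r0 "r0 ^ d"
  proof
    fix t and \<theta> :: "real ^ 'n \<Rightarrow> 'y" and j assume t: "0 < t" "t \<le> r0" "\<theta> \<in> unit_tests (nu i p)"
    have "\<bar>deriv_defect ?S f a j t \<theta>\<bar> \<le> 1 * t ^ d" by (rule r0(2)[OF t])
    also have "\<dots> \<le> r0 ^ d" using t by (simp add: power_mono)
    finally show "\<bar>deriv_defect ?S f a j t \<theta>\<bar> \<le> r0 ^ d" .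
  qed (rule S f p r0(1))+
  obtain C c where C: "0 \<le> C" and approx: "\<And>\<epsilon> r1 r \<theta>.
     (\<And>t \<theta> j. 0 < t \<Longrightarrow> t \<le> r1 \<Longrightarrow> \<theta> \<in> unit_tests (nu i p) \<Longrightarrow> \<bar>deriv_defect ?S f a j t \<theta>\<bar> \<le> \<epsilon> * t ^ d) \<Longrightarrow>
     0 < r \<Longrightarrow> r \<le> r1 \<Longrightarrow> \<theta> \<in> unit_tests (nu i p) \<Longrightarrow>
     \<bar>?S (dilate a r \<theta>) - pair (\<lambda>u. g0 u + c) r \<theta>\<bar> \<le> C * \<epsilon> * r ^ Suc d"
    using polynomial_approximation by blast
  let ?g = "\<lambda>u. g0 u + c"
  have "approximates i p a (Suc d) ?S ?g"
    unfolding approximates_def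
  proof (intro allI impI)
    fix \<epsilon> :: real assume \<epsilon>: "0 < \<epsilon>"
    let ?e = "\<epsilon> / (C + 1)"
    have e: "0 < ?e" "C * ?e \<le> \<epsilon>" using \<epsilon> C by (simp_all add: field_simps)
    obtain r1 where r1: "0 < r1" "\<And>t \<theta> j. 0 < t \<Longrightarrow> t \<le> r1 \<Longrightarrow> \<theta> \<in> unit_tests (nu i p) \<Longrightarrow>
        \<bar>deriv_defect ?S f a j t \<theta>\<bar> \<le> ?e * t ^ d"
      using small[OF e(1)] by auto
    have "\<bar>defect ?S ?g a t \<theta>\<bar> \<le> \<epsilon> * t ^ Suc d"
      if t: "0 < t" "t \<le> r1" and \<theta>: "\<theta> \<in> unit_tests (nu i p)" for t \<theta>
    proof -
      have "\<bar>defect ?S ?g a t \<theta>\<bar> \<le> C * ?e * t ^ Suc d"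
        unfolding defect_def by (rule approx[OF r1(2) t \<theta>])
      also have "\<dots> \<le> \<epsilon> * t ^ Suc d" using e(2) t by (intro mult_right_mono) auto
      finally show ?thesis .
    qed
    with r1(1) show "\<exists>r0>0. \<forall>t \<theta>. 0 < t \<longrightarrow> t \<le> r0 \<longrightarrow> \<theta> \<in> unit_tests (nu i p) \<longrightarrow> \<bar>defect ?S ?g a t \<theta>\<bar> \<le> \<epsilon> * t ^ Suc d"
      by blast
  qed
  moreover have "polyf (Suc d) ?g" by (intro polyf.add polyf_g0 polyf.const)
  ultimately show ?thesis by blast
qed

text \<open>The case of order \<open>(-1, 1)\<close>: the derivatives are bounded and no polynomials are subtracted. The
  estimate gives \<open>O(t)\<close>, hence order \<open>0\<close> with a constant.\<close>

lemma approximates_of_bounded_derivs: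
  fixes T :: "(real ^ 'n \<Rightarrow> 'y::banach) \<Rightarrow> real"
  assumes p: "1 \<le> p" and T: "dist_bounded T"
    and D: "\<And>j. \<exists>C. \<exists>r0>0. \<forall>t \<theta>. 0 < t \<longrightarrow> t \<le> r0 \<longrightarrow> \<theta> \<in> unit_tests (nu i p) \<longrightarrow>
      \<bar>defect (distr_D (\<beta>(j := Suc (\<beta> j))) T) (\<lambda>_. 0) a t \<theta>\<bar> \<le> C"
  shows "\<exists>g. polyf 0 g \<and> approximates i p a 0 (distr_D \<beta> T) g"
proof -
  let ?S = "distr_D \<beta> T" and ?f = "\<lambda>(_ :: 'n) (_ :: real ^ 'n). 0 :: 'y \<Rightarrow>\<^sub>L real"
  have S: "dist_bounded ?S" by (rule distr_D_dist_bounded[OF T])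
  obtain C where C: "\<And>j. \<exists>r0>0. \<forall>t \<theta>. 0 < t \<longrightarrow> t \<le> r0 \<longrightarrow> \<theta> \<in> unit_tests (nu i p) \<longrightarrow>
      \<bar>defect (distr_D (\<beta>(j := Suc (\<beta> j))) T) (\<lambda>_. 0) a t \<theta>\<bar> \<le> C j" using D by metis
  define M where "M = Max (range C)"
  have M: "C j \<le> M" for j unfolding M_def by (rule Max_ge) auto
  have "\<exists>r0>0. \<forall>t. 0 < t \<longrightarrow> t \<le> r0 \<longrightarrow> (\<forall>\<theta>\<in>unit_tests (nu i p). \<bar>deriv_defect ?S ?f a j t \<theta>\<bar> \<le> M)" for j
  proof -
    obtain r0 where "0 < r0" "\<And>t \<theta>. 0 < t \<Longrightarrow> t \<le> r0 \<Longrightarrow> \<theta> \<in> unit_tests (nu i p) \<Longrightarrow>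
        \<bar>defect (distr_D (\<beta>(j := Suc (\<beta> j))) T) (?f j) a t \<theta>\<bar> \<le> C j"
      using C[of j] by blast
    then show ?thesis
      using order_trans[OF _ M[of j]]
      by (intro exI[of _ r0]) (simp add: distr_D_defect[OF T unit_tests_test, symmetric])
  qed
  then have "\<forall>j. \<exists>r0>0. \<forall>t. 0 < t \<longrightarrow> t \<le> r0 \<longrightarrow>
      (\<forall>\<theta>\<in>unit_tests (nu i p). \<bar>deriv_defect ?S ?f a j t \<theta>\<bar> \<le> M)" by (rule allI)
  from finite_common_radius[OF this]
  obtain r0 where rad: "0 < r0" "\<And>j t. 0 < t \<Longrightarrow> t \<le> r0 \<Longrightarrow>
      \<forall>\<theta>\<in>unit_tests (nu i p). \<bar>deriv_defect ?S ?f a j t \<theta>\<bar> \<le> M"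
    by blast
  interpret derivs_approx ?S ?f a 0 i p r0 M
    by unfold_locales (use rad S p in \<open>auto intro: polyf.const\<close>)
  obtain K c where K: "0 \<le> K" and approx: "\<And>\<epsilon> r1 r \<theta>.
     (\<And>t \<theta> j. 0 < t \<Longrightarrow> t \<le> r1 \<Longrightarrow> \<theta> \<in> unit_tests (nu i p) \<Longrightarrow> \<bar>deriv_defect ?S ?f a j t \<theta>\<bar> \<le> \<epsilon> * t ^ 0) \<Longrightarrow>
     0 < r \<Longrightarrow> r \<le> r1 \<Longrightarrow> \<theta> \<in> unit_tests (nu i p) \<Longrightarrow>
     \<bar>?S (dilate a r \<theta>) - pair (\<lambda>u. g0 u + c) r \<theta>\<bar> \<le> K * \<epsilon> * r ^ Suc 0"
    using polynomial_approximation by blast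
  have "approximates i p a 0 ?S (\<lambda>_. c)"
  proof (rule holder_bound_imp_approximates[of 1 "K * M" r0])
    fix t and \<theta> :: "real ^ 'n \<Rightarrow> 'y" assume t: "0 < t" "t \<le> r0" and \<theta>: "\<theta> \<in> unit_tests (nu i p)"
    have "\<bar>?S (dilate a t \<theta>) - pair (\<lambda>u. g0 u + c) t \<theta>\<bar> \<le> K * M * t ^ Suc 0"
      using rad(2) by (intro approx[OF _ t \<theta>]) auto
    moreover have "pair (\<lambda>u. g0 u + c) t \<theta> = pair (\<lambda>_. c) t \<theta>"
      using pair_g0_eq_0[OF _ unit_tests_test[OF \<theta>], of t]
      by (simp add: pair_add_left polyf_continuous[OF polyf_g0] unit_tests_test[OF \<theta>]) (simp add: pair_def)
    ultimately show "\<bar>defect ?S (\<lambda>_. c) a t \<theta>\<bar> \<le> K * M * t powr (real 0 + 1)"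
      using t by (simp add: defect_def)
  qed (use K M_nonneg rad(1) in auto)
  with polyf.const[of 0 c] show ?thesis by blast
qed

lemma approximates_descent:
  fixes T :: "(real ^ 'n \<Rightarrow> 'y::banach) \<Rightarrow> real"
  assumes p: "1 \<le> p" and T: "dist_bounded T"
    and D: "\<And>\<xi>. \<xi> \<in> multi_indices m \<Longrightarrow> \<exists>g. polyf d g \<and> approximates i p a d (distr_D \<xi> T) g"
  shows "\<beta> \<in> multi_indices l \<Longrightarrow> l + e = m \<Longrightarrow>
    \<exists>g. polyf (d + e) g \<and> approximates i p a (d + e) (distr_D \<beta> T) g"
proof (induction e arbitrary: \<beta> l)
  case 0
  then show ?case using D by simp
next
  case (Suc e)
  have mi: "\<beta>(j := Suc (\<beta> j)) \<in> multi_indices (Suc l)" for j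
    using Suc.prems(1) by (simp only: multi_indices_def mem_Collect_eq sum_fun_upd_Suc)
  have "\<exists>g. polyf (d + e) g \<and> approximates i p a (d + e) (distr_D (\<beta>(j := Suc (\<beta> j))) T) g" for j
    by (rule Suc.IH[OF mi]) (use Suc.prems(2) in simp)
  from approximates_step[OF p T this] show ?case by simp
qed

lemma pt_diff_of_derivs:
  fixes T :: "(real ^ 'n \<Rightarrow> 'y::banach) \<Rightarrow> real"
  assumes p: "1 \<le> p" and T: "dist_bounded T"
    and D: "\<And>\<xi>. \<xi> \<in> multi_indices m \<Longrightarrow> \<exists>g. polyf d g \<and> approximates i p a d (distr_D \<xi> T) g"
    and \<beta>: "l \<le> m" "\<beta> \<in> multi_indices l"
  shows "pt_diff (nu i p) (int d - int l + int m) (distr_D \<beta> T) a"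
proof -
  have "\<exists>g. polyf (d + (m - l)) g \<and> approximates i p a (d + (m - l)) (distr_D \<beta> T) g"
    by (rule approximates_descent[OF p T D \<beta>(2)]) (use \<beta>(1) in simp_all)
  then obtain g where g: "polyf (d + (m - l)) g" "approximates i p a (d + (m - l)) (distr_D \<beta> T) g"
    by blast
  have "pt_diff (nu i p) (int (d + (m - l))) (distr_D \<beta> T) a"
    by (rule approximates_imp_pt_diff[OF p distr_D_dist_bounded[OF T] g])
  moreover have "int (d + (m - l)) = int d - int l + int m" using \<beta>(1) by (simp add: of_nat_diff)
  ultimately show ?thesis by (simp only:)
qed

theorem theorem1:
  fixes i m :: nat and k :: int and \<alpha> :: real and p :: ennreal
    and T :: "(real ^ 'n \<Rightarrow> 'y::banach) \<Rightarrow> real" and a :: "real ^ 'n"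
  assumes "0 < \<alpha>" "\<alpha> \<le> 1" "1 \<le> p" "distribution T"
  shows
    "(0 \<le> k \<and> (\<forall>\<xi>\<in>multi_indices m. pt_diff (nu i p) k (distr_D \<xi> T) a) \<longrightarrow>
       (\<forall>l<m. \<forall>\<beta>\<in>multi_indices l. pt_diff (nu i p) (k - int l + int m) (distr_D \<beta> T) a)) \<and>
     (0 \<le> of_int k + \<alpha> \<and> (\<forall>\<xi>\<in>multi_indices m. pt_diff_holder (nu i p) k \<alpha> (distr_D \<xi> T) a) \<longrightarrow>
       (\<forall>l<m. \<forall>\<beta>\<in>multi_indices l. pt_diff (nu i p) (k - int l + int m) (distr_D \<beta> T) a))"
proof (intro conjI impI allI ballI; elim conjE)
  have T: "dist_bounded T" by (rule distribution_dist_bounded[OF assms(4)])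
  note p = assms(3) and DT = distr_D_dist_bounded[OF T]
  {
    fix l and \<beta> :: "'n \<Rightarrow> nat" assume k: "0 \<le> k" and D: "\<forall>\<xi>\<in>multi_indices m. pt_diff (nu i p) k (distr_D \<xi> T) a"
      and l: "l < m" and \<beta>: "\<beta> \<in> multi_indices l"
    have kd: "int (nat k) = k" using k by simp
    have "pt_diff (nu i p) (int (nat k) - int l + int m) (distr_D \<beta> T) a"
      using D kd l by (intro pt_diff_of_derivs[OF p T _ _ \<beta>] pt_diff_imp_approximates[OF p DT]) auto
    then show "pt_diff (nu i p) (k - int l + int m) (distr_D \<beta> T) a" using kd by simp
  }
  {
    fix l and \<beta> :: "'n \<Rightarrow> nat" assume k: "0 \<le> of_int k + \<alpha>" and D: "\<forall>\<xi>\<in>multi_indices m. pt_diff_holder (nu i p) k \<alpha> (distr_D \<xi> T) a"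
      and l: "l < m" and \<beta>: "\<beta> \<in> multi_indices l"
    show "pt_diff (nu i p) (k - int l + int m) (distr_D \<beta> T) a"
    proof (cases "0 \<le> k")
      case True
      then have kd: "int (nat k) = k" by simp
      have "\<exists>g. polyf (nat k) g \<and> approximates i p a (nat k) (distr_D \<xi> T) g" if "\<xi> \<in> multi_indices m" for \<xi>
      proof -
        have "pt_diff_holder (nu i p) k \<alpha> (distr_D \<xi> T) a" using D that by simp
        then obtain P :: "real ^ 'n \<Rightarrow> 'y \<Rightarrow>\<^sub>L real" where P: "poly_fun k P"
          and lim: "Limsup (at_right 0) (\<lambda>r. SUP \<theta>\<in>unit_tests (nu i p).
            ereal (r powr (- of_int k - \<alpha>) * rescale (\<lambda>\<eta>. distr_D \<xi> T \<eta> - poly_distr P \<eta>) a r \<theta>)) < \<infinity>"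
          unfolding pt_diff_holder_def by (elim exE conjE)
        have pP: "polyf (nat k) P" using poly_fun_imp_polyf[of "nat k" P] P unfolding kd .
        have kr: "real_of_int k = real (nat k)" using True by simp
        from pt_diff_holder_bound[OF p DT polyf_continuous[OF pP] lim]
        obtain C r0 where C: "0 \<le> C" "0 < r0" "\<And>t \<theta>. 0 < t \<Longrightarrow> t \<le> r0 \<Longrightarrow> \<theta> \<in> unit_tests (nu i p) \<Longrightarrow>
            \<bar>defect (distr_D \<xi> T) (\<lambda>u. P (a + u)) a t \<theta>\<bar> \<le> C * t powr (real (nat k) + \<alpha>)"
          unfolding kr by (elim exE conjE) blast
        have "approximates i p a (nat k) (distr_D \<xi> T) (\<lambda>u. P (a + u))"
          by (rule holder_bound_imp_approximates[OF assms(1) C])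
        with polyf_translate[OF pP, of a] show ?thesis by blast
      qed
      then have "pt_diff (nu i p) (int (nat k) - int l + int m) (distr_D \<beta> T) a"
        using l by (intro pt_diff_of_derivs[OF p T _ _ \<beta>]) auto
      then show ?thesis using kd by simp
    next
      case False
      have k1: "k = -1" and \<alpha>1: "\<alpha> = 1"
      proof -
        have "- 1 \<le> real_of_int k" using k assms(2) by linarith
        then show "k = -1" using False by linarith
        with k assms(2) show "\<alpha> = 1" by simp
      qed
      obtain m' where m': "m = Suc m'" using l by (cases m) auto
      have "\<exists>g. polyf 0 g \<and> approximates i p a 0 (distr_D \<xi> T) g" if \<xi>: "\<xi> \<in> multi_indices m'" for \<xi>
      proof (rule approximates_of_bounded_derivs[OF p T])
        fix j
        have "\<xi>(j := Suc (\<xi> j)) \<in> multi_indices m"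
          using \<xi> by (simp only: multi_indices_def mem_Collect_eq sum_fun_upd_Suc m')
        then have "pt_diff_holder (nu i p) k \<alpha> (distr_D (\<xi>(j := Suc (\<xi> j))) T) a" using D by blast
        then obtain P :: "real ^ 'n \<Rightarrow> 'y \<Rightarrow>\<^sub>L real" where P: "poly_fun k P"
          and lim: "Limsup (at_right 0) (\<lambda>r. SUP \<theta>\<in>unit_tests (nu i p).
            ereal (r powr (- of_int k - \<alpha>) * rescale (\<lambda>\<eta>. distr_D (\<xi>(j := Suc (\<xi> j))) T \<eta> - poly_distr P \<eta>) a r \<theta>)) < \<infinity>"
          unfolding pt_diff_holder_def by (elim exE conjE)
        have "P x = 0" for x using P k1 by (auto simp: poly_fun_def)
        then have P0: "P = (\<lambda>_. 0)" by blast
        obtain C r0 where C: "0 \<le> C" "0 < r0" "\<And>t \<theta>. 0 < t \<Longrightarrow> t \<le> r0 \<Longrightarrow> \<theta> \<in> unit_tests (nu i p) \<Longrightarrow>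
            \<bar>defect (distr_D (\<xi>(j := Suc (\<xi> j))) T) (\<lambda>_. 0) a t \<theta>\<bar> \<le> C * t powr (of_int k + \<alpha>)"
          using pt_diff_holder_bound[OF p DT continuous_on_const lim[unfolded P0]] by blast
        then show "\<exists>C. \<exists>r0>0. \<forall>t \<theta>. 0 < t \<longrightarrow> t \<le> r0 \<longrightarrow> \<theta> \<in> unit_tests (nu i p) \<longrightarrow>
            \<bar>defect (distr_D (\<xi>(j := Suc (\<xi> j))) T) (\<lambda>_. 0) a t \<theta>\<bar> \<le> C"
          by (intro exI[of _ C] exI[of _ r0]) (auto simp: k1 \<alpha>1)
      qed
      then have "pt_diff (nu i p) (int 0 - int l + int m') (distr_D \<beta> T) a"
        using l m' by (intro pt_diff_of_derivs[OF p T _ _ \<beta>]) auto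
      then show ?thesis using k1 m' by simp
    qed
  }
qed

end
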